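(* Let $(S^+,H^+,S^-,H^-)$ be the unique quadruple of operators solving $$V^{-1}\Big(\frac{\partial}{\partial s}+\widetilde\Lambda\Big)\begin{pmatrix} I^+ & S^-\\ S^+ & I^-\end{pmatrix}\begin{pmatrix} g^+\\ g^-\end{pmatrix}=\begin{pmatrix} I^+ & S^-\\ S^+ & I^-\end{pmatrix}\begin{pmatrix} H^+ & 0\\ 0 & -H^-\end{pmatrix}\begin{pmatrix} g^+\\ g^-\end{pmatrix},\qquad g^\pm\in C_0^1(\overline{\mathcal X_\pm}),$$ subject to: (a$^\pm$) $S^\pm:C_0(\overline{\mathcal X_\pm})\to C_0(\overline{\mathcal X_\mp})$ is bounded, (i) for any $g^\pm\in C_c(\overline{\mathcal X_\pm})$ with $\operatorname{supp}g^\pm\subset[0,\eta]\times\mathbf E_\pm$, $\eta\in(0,\infty)$, one has $\operatorname{supp}S^\pm g^\pm\subset[0,\eta]\times\mathbf E_\mp$, and (ii) $S^\pm g^\pm\in C_0^1(\overline{\mathcal X_\mp})$ for any $g^\pm\in C_0^1(\overline{\mathcal X_\pm})$; (b$^\pm$) $H^\pm$ is the strong generator of a strongly continuous positive contraction semigroup $(\mathcal Q^\pm_\ell)_{\ell\in\mathbb R_+}$ on $C_0(\overline{\mathcal X_\pm})$ with domain $C_0^1(\overline{\mathcal X_\pm})$. Then for any $g^\pm\in C_0(\overline{\mathcal X_\pm})$, $$S^\pm g^\pm=J^\pm g^\pm\quad\text{and}\quad \mathcal Q^\pm_\ell g^\pm=\mathcal P^\pm_\ell g^\pm\quad\text{for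 any }\ell\in\mathbb R_+ .$$ Moreover, $G^+$ is the strong generator of $(\mathcal P^+_\ell)_{\ell\ge0}$ with domain $C_0^1(\overline{\mathcal X_+})$, and $G^-$ is the strong generator of $(\mathcal P^-_\ell)_{\ell\ge0}$ with domain $C_0^1(\overline{\mathcal X_-})$.
   Context: Setting. $\mathbf E$ is a finite set, $|\mathbf E|=m>1$; $\partial$ is a coffin state isolated from $\mathbf E$; $\overline{\mathbf E}=\mathbf E\cup\{\partial\}$; $\mathbb R_+=[0,\infty)$. $(\Lambda_s)_{s\in\mathbb R_+}$ is a family of $m\times m$ generator matrices (non-negative off-diagonal entries, zero row sums) indexed by $\mathbf E$, with $|\Lambda_s(i,j)|\le K$ for all $s,i,j$ and some $K\in(0,\infty)$, and $s\mapsto\Lambda_s$ continuous; $\Lambda_\infty:=0$. $v:\overline{\mathbf E}\to\mathbb R$ satisfies $v(i)\neq0$ for $i\in\mathbf E$, $v(\partial)=0$; $V=\mathrm{diag}\{v(i)\}$; $\mathbf E_\pm=\{i\in\mathbf E:\pm v(i)>0\}$, both non-empty. $\mathcal X=\mathbb R_+\times\mathbf E$, $\mathcal X_\pm=\mathbb R_+\times\mathbf E_\pm$, $\overline{\mathcal X}=\mathcal X\cup\{(\infty,\partial)\}$, $\overline{\mathcal X_\pm}=\mathcal X_\pm\cup\{(\infty,\partial)\}$. $(\widetilde\Lambda g)(s,i)=(\Lambda_sg(s,\cdot))(i)$, $(V^{-1}g)(s,i)=v(i)^{-1}g(s,i)$; a function on $\overline{\mathcal X}$ is identified with the pair of its restrictions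 to $\overline{\mathcal X_\pm}$; $I^\pm$ are identities. Function spaces: $L^\infty(\overline{\mathcal X_\pm})$: bounded Borel real functions on $\overline{\mathcal X_\pm}$ vanishing at $(\infty,\partial)$. $C_0(\overline{\mathcal X_\pm})$ (resp. $C_c(\overline{\mathcal X_\pm})$): those $f\in L^\infty$ with $f(\cdot,i)$ continuous and vanishing at infinity (resp. continuous with compact support) for all $i\in\mathbf E_\pm$. $C_0^1(\overline{\mathcal X_\pm})$: those $f\in C_0(\overline{\mathcal X_\pm})$ such that $\partial f(\cdot,i)/\partial s$ exists and is in $C_0(\mathbb R_+)$ for all $i$ (with value $0$ at $(\infty,\partial)$). Sup norm is used. The strong generator of a strongly continuous semigroup is the sup-norm limit $\lim_{\ell\to0+}\ell^{-1}(\mathcal Q_\ell g-g)$, with domain all $g$ for which it exists. Markov family. $\Omega^*$ is the set of càdlàg functions $\omega:\mathbb R_+\to\mathbf E$, with $\omega(\infty):=\partial$; $X^*_t(\omega)=\omega(t)$. $\mathcal F^{s,*}_t=\bigcap_{r>t}\sigma(X^*_u:u\in[s,r])$, $\mathcal F^{s,*}_\infty=\sigma(\bigcup_{t\ge s}\mathcal F^{s,*}_t)$. $(\mathbb P^*_{s,i})_{(s,i)\in\overline{\mathcal X}}$ is the standard canonical time-inhomogeneous Markov family with generators $\Lambda_s$: $\mathbb P^*_{s,i}$ is a probability on $\mathcal F^{s,*}_\infty$, $\mathbb P^*_{s,i}(X^*_s=i)=1$, $\mathbb P^*_{s,i}(X^*_r\in B\mid\mathcal F^{s,*}_t)=\mathbb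 P^*_{t,X^*_t}(X^*_r\in B)$ a.s. for $s\le t\le r\le\infty$, and the evolution system $U^*_{s,t}f(i)=\mathbb E^*_{s,i}f(X^*_t)$ is strongly continuous in $s,t$ with $\lim_{h\downarrow0}h^{-1}(U^*_{s,s+h}f(i)-f(i))=\Lambda_sf(i)$ for all $f:\mathbf E\to\mathbb R$. For $s\in[0,\infty]$, $\phi^*_t(s)=\int_s^tv(X^*_u)\,du$ for $t\in[s,\infty)$, $\phi^*_\infty(s):=\infty$, and for $\ell\in\mathbb R_+$, $\tau^{+,*}_\ell(s)=\inf\{t\in[s,\infty]:\phi^*_t(s)>\ell\}$, $\tau^{-,*}_\ell(s)=\inf\{t\in[s,\infty]:\phi^*_t(s)<-\ell\}$ ($\inf\emptyset=\infty$); under $\mathbb P^*_{s,i}$ the argument $s$ is omitted. Operators, for $g^\pm\in L^\infty(\overline{\mathcal X_\pm})$: $(J^\pm g^\pm)(s,i)=\mathbb E^*_{s,i}\big(g^\pm(\tau^{\pm,*}_0,X^*_{\tau^{\pm,*}_0})\big)$ for $(s,i)\in\overline{\mathcal X_\mp}$; $(\mathcal P^\pm_\ell g^\pm)(s,i)=\mathbb E^*_{s,i}\big(g^\pm(\tau^{\pm,*}_\ell,X^*_{\tau^{\pm,*}_\ell})\big)$ for $(s,i)\in\overline{\mathcal X_\pm}$, $\ell\in\mathbb R_+$; and $(G^\pm g^\pm)(s,i)=\lim_{\ell\to0+}\ell^{-1}\big(\mathcal P^\pm_\ell g^\pm(s,i)-g^\pm(s,i)\big)$, $(s,i)\in\overline{\mathcal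 X_\pm}$, for $g^\pm\in C_0(\overline{\mathcal X_\pm})$ such that the limit exists and is finite. *)

theory Defs
  imports "HOL-Probability.Probability"
begin

text \<open>
  The finite set \<open>E\<close> is a type \<open>'e\<close> of class \<open>finite\<close>; the extended set with the coffin state is
  \<open>'e option\<close>, with \<^term>\<open>None\<close> the coffin state. A point of the extended half-plane is a pair in
  \<open>ereal \<times> 'e option\<close>: either \<open>(ereal s, Some i)\<close> with \<open>s \<ge> 0\<close>, or \<open>(\<infinity>, None)\<close>.
  The superscripts/subscripts \<open>\<plusminus>\<close> are handled by an index of type \<open>pm\<close>.
\<close>

datatype pm = Plus | Minus

primrec opp :: "pm \<Rightarrow> pm" where
  "opp Plus = Minus"
| "opp Minus = Plus"

primrec E_pm :: "('e option \<Rightarrow> real) \<Rightarrow> pm \<Rightarrow> 'e set" where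
  "E_pm v Plus = {i. v (Some i) > 0}"
| "E_pm v Minus = {i. - v (Some i) > 0}"

type_synonym 'e pt = "ereal \<times> 'e option"
type_synonym 'e xfun = "'e pt \<Rightarrow> real"

definition X_full :: "'e pt set" where
  "X_full = {(ereal s, Some i) | s i. 0 \<le> s}"

definition Xbar_full :: "'e pt set" where
  "Xbar_full = insert (\<infinity>, None) X_full"

definition X_pm :: "('e option \<Rightarrow> real) \<Rightarrow> pm \<Rightarrow> 'e pt set" where
  "X_pm v \<sigma> = {(ereal s, Some i) | s i. 0 \<le> s \<and> i \<in> E_pm v \<sigma>}"

definition Xbar_pm :: "('e option \<Rightarrow> real) \<Rightarrow> pm \<Rightarrow> 'e pt set" where
  "Xbar_pm v \<sigma> = insert (\<infinity>, None) (X_pm v \<sigma>)"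

text \<open>
  A function on \<open>Xbar_pm v \<sigma>\<close> that vanishes at \<open>(\<infinity>, None)\<close> is represented by its extension by zero
  to the whole type, so that equality of functions on the carrier is equality in HOL.
\<close>

definition Linf :: "('e option \<Rightarrow> real) \<Rightarrow> pm \<Rightarrow> 'e xfun set" where
  "Linf v \<sigma> = {f. (\<forall>p. p \<notin> X_pm v \<sigma> \<longrightarrow> f p = 0) \<and> bounded (range f) \<and>
                  f \<in> borel_measurable (borel \<Otimes>\<^sub>M count_space UNIV)}"

definition sup_norm :: "'e xfun \<Rightarrow> real" where
  "sup_norm f = (SUP p. \<bar>f p\<bar>)"

definition C0 :: "('e option \<Rightarrow> real) \<Rightarrow> pm \<Rightarrow> 'e xfun set" where
  "C0 v \<sigma> = {f \<in> Linf v \<sigma>. \<forall>i\<in>E_pm v \<sigma>.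
      continuous_on {0..} (\<lambda>s. f (ereal s, Some i)) \<and>
      ((\<lambda>s. f (ereal s, Some i)) \<longlongrightarrow> 0) at_top}"

text \<open>The closure is taken in each fibre, \<open>'e\<close> being discrete.\<close>

definition supp :: "'e xfun \<Rightarrow> (real \<times> 'e) set" where
  "supp f = {(s, i). s \<in> closure {u. f (ereal u, Some i) \<noteq> 0}}"

definition Cc :: "('e option \<Rightarrow> real) \<Rightarrow> pm \<Rightarrow> 'e xfun set" where
  "Cc v \<sigma> = {f \<in> Linf v \<sigma>. \<forall>i\<in>E_pm v \<sigma>.
      continuous_on {0..} (\<lambda>s. f (ereal s, Some i)) \<and>
      compact {s. (s, i) \<in> supp f}}"

text \<open>Derivative in \<open>s\<close>, one-sided at \<open>s = 0\<close>.\<close>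

definition ds :: "'e xfun \<Rightarrow> 'e xfun" where
  "ds f p = (case p of
      (ereal s, Some i) \<Rightarrow>
        (if 0 \<le> s then vector_derivative (\<lambda>u. f (ereal u, Some i)) (at s within {0..}) else 0)
    | _ \<Rightarrow> 0)"

definition C01 :: "('e option \<Rightarrow> real) \<Rightarrow> pm \<Rightarrow> 'e xfun set" where
  "C01 v \<sigma> = {f \<in> C0 v \<sigma>.
      (\<forall>i\<in>E_pm v \<sigma>. \<forall>s\<ge>0. (\<lambda>u. f (ereal u, Some i)) differentiable (at s within {0..})) \<and>
      ds f \<in> C0 v \<sigma>}"

definition linear_op :: "'e xfun set \<Rightarrow> 'e xfun set \<Rightarrow> ('e xfun \<Rightarrow> 'e xfun) \<Rightarrow> bool" where
  "linear_op C D T \<longleftrightarrow>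
     (\<forall>f\<in>C. T f \<in> D) \<and>
     (\<forall>f\<in>C. \<forall>g\<in>C. T (\<lambda>p. f p + g p) = (\<lambda>p. T f p + T g p)) \<and>
     (\<forall>c. \<forall>f\<in>C. T (\<lambda>p. c * f p) = (\<lambda>p. c * T f p))"

definition bounded_op :: "'e xfun set \<Rightarrow> 'e xfun set \<Rightarrow> ('e xfun \<Rightarrow> 'e xfun) \<Rightarrow> bool" where
  "bounded_op C D T \<longleftrightarrow>
     linear_op C D T \<and> (\<exists>B. \<forall>f\<in>C. sup_norm (T f) \<le> B * sup_norm f)"

definition sc_pos_contr_semigroup :: "'e xfun set \<Rightarrow> (real \<Rightarrow> 'e xfun \<Rightarrow> 'e xfun) \<Rightarrow> bool" where
  "sc_pos_contr_semigroup C Q \<longleftrightarrow>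
     (\<forall>l\<ge>0. linear_op C C (Q l)) \<and>
     (\<forall>f\<in>C. Q 0 f = f) \<and>
     (\<forall>k\<ge>0. \<forall>l\<ge>0. \<forall>f\<in>C. Q (k + l) f = Q k (Q l f)) \<and>
     (\<forall>l\<ge>0. \<forall>f\<in>C. (\<forall>p. 0 \<le> f p) \<longrightarrow> (\<forall>p. 0 \<le> Q l f p)) \<and>
     (\<forall>l\<ge>0. \<forall>f\<in>C. sup_norm (Q l f) \<le> sup_norm f) \<and>
     (\<forall>f\<in>C. uniform_limit UNIV (\<lambda>l. Q l f) f (at_right 0))"

text \<open>
  \<open>D\<close> is the full set where the sup-norm limit exists (uniform convergence is convergence in sup norm);
  the values of \<open>A\<close> off \<open>D\<close> are irrelevant.
\<close>

definition strong_generator ::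
  "'e xfun set \<Rightarrow> (real \<Rightarrow> 'e xfun \<Rightarrow> 'e xfun) \<Rightarrow> ('e xfun \<Rightarrow> 'e xfun) \<Rightarrow> 'e xfun set \<Rightarrow> bool" where
  "strong_generator C Q A D \<longleftrightarrow>
     D = {g \<in> C. \<exists>h. uniform_limit UNIV (\<lambda>l p. (Q l g p - g p) / l) h (at_right 0)} \<and>
     (\<forall>g\<in>D. uniform_limit UNIV (\<lambda>l p. (Q l g p - g p) / l) (A g) (at_right 0))"

definition generator_family :: "(real \<Rightarrow> real^'e^'e) \<Rightarrow> bool" where
  "generator_family \<Lambda> \<longleftrightarrow>
     (\<forall>s\<ge>0. \<forall>i j. i \<noteq> j \<longrightarrow> 0 \<le> \<Lambda> s $ i $ j) \<and>
     (\<forall>s\<ge>0. \<forall>i. (\<Sum>j\<in>UNIV. \<Lambda> s $ i $ j) = 0) \<and>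
     (\<exists>K>0. \<forall>s\<ge>0. \<forall>i j. \<bar>\<Lambda> s $ i $ j\<bar> \<le> K) \<and>
     continuous_on {0..} \<Lambda>"

text \<open>
  Cadlag functions from \<open>[0, \<infinity>)\<close> to the discrete space \<open>'e\<close>: convergence in \<open>'e\<close> means being
  eventually constant.
\<close>

definition paths :: "(real \<Rightarrow> 'e) set" where
  "paths = {\<omega> \<in> extensional {0..}.
     (\<forall>t\<ge>0. eventually (\<lambda>u. \<omega> u = \<omega> t) (at_right t)) \<and>
     (\<forall>t>0. \<exists>j. eventually (\<lambda>u. \<omega> u = j) (at_left t))}"

definition Xst :: "ereal \<Rightarrow> (real \<Rightarrow> 'e) \<Rightarrow> 'e option" where
  "Xst t \<omega> = (if t = \<infinity> then None else Some (\<omega> (real_of_ereal t)))"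

definition natural_filt :: "ereal \<Rightarrow> real \<Rightarrow> (real \<Rightarrow> 'e) measure" where
  "natural_filt s r = sigma paths {Xst (ereal u) -` B \<inter> paths | u B. s \<le> ereal u \<and> u \<le> r}"

definition filt_fin :: "ereal \<Rightarrow> real \<Rightarrow> (real \<Rightarrow> 'e) measure" where
  "filt_fin s t = sigma paths (\<Inter>r\<in>{t<..}. sets (natural_filt s r))"

definition filt_inf :: "ereal \<Rightarrow> (real \<Rightarrow> 'e) measure" where
  "filt_inf s = sigma paths (\<Union>t\<in>{t. s \<le> ereal t}. sets (filt_fin s t))"

definition filt :: "ereal \<Rightarrow> ereal \<Rightarrow> (real \<Rightarrow> 'e) measure" where
  "filt s t = (if t = \<infinity> then filt_inf s else filt_fin s (real_of_ereal t))"

definition evol :: "('e pt \<Rightarrow> (real \<Rightarrow> 'e) measure) \<Rightarrow> real \<Rightarrow> real \<Rightarrow> real^'e \<Rightarrow> real^'e" where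
  "evol P s t f = (\<chi> i. \<integral>\<omega>. f $ (\<omega> t) \<partial>P (ereal s, Some i))"

definition canonical_markov_family ::
  "(real \<Rightarrow> real^'e^'e) \<Rightarrow> ('e pt \<Rightarrow> (real \<Rightarrow> 'e) measure) \<Rightarrow> bool" where
  "canonical_markov_family \<Lambda> P \<longleftrightarrow>
     (\<forall>(s, i)\<in>Xbar_full.
        prob_space (P (s, i)) \<and> sets (P (s, i)) = sets (filt s \<infinity>) \<and>
        measure (P (s, i)) {\<omega>\<in>paths. Xst s \<omega> = i} = 1 \<and>
        (\<forall>t r B. s \<le> t \<and> t \<le> r \<longrightarrow>
           (AE \<omega> in P (s, i).
              real_cond_exp (P (s, i)) (filt s t) (indicator {\<omega>'\<in>paths. Xst r \<omega>' \<in> B}) \<omega> =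
              measure (P (t, Xst t \<omega>)) {\<omega>'\<in>paths. Xst r \<omega>' \<in> B}))) \<and>
     (\<forall>f. continuous_on {(s, t). 0 \<le> s \<and> s \<le> t} (\<lambda>(s, t). evol P s t f)) \<and>
     (\<forall>f. \<forall>s\<ge>0. ((\<lambda>h. (1 / h) *\<^sub>R (evol P s (s + h) f - f)) \<longlongrightarrow> \<Lambda> s *v f) (at_right 0))"

definition phi :: "('e option \<Rightarrow> real) \<Rightarrow> ereal \<Rightarrow> ereal \<Rightarrow> (real \<Rightarrow> 'e) \<Rightarrow> ereal" where
  "phi v s t \<omega> =
     (if t = \<infinity> then \<infinity>
      else ereal (LBINT u:{real_of_ereal s..real_of_ereal t}. v (Xst (ereal u) \<omega>)))"

text \<open>
  The infimum is over \<open>[s, \<infinity>]\<close>; the value \<open>\<infinity>\<close> of \<open>phi\<close> at \<open>t = \<infinity>\<close> enters the set for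
  \<open>Plus\<close> but not for \<open>Minus\<close>, where the set may be empty and \<open>Inf {} = \<infinity>\<close>.
\<close>

primrec tau :: "('e option \<Rightarrow> real) \<Rightarrow> pm \<Rightarrow> real \<Rightarrow> ereal \<Rightarrow> (real \<Rightarrow> 'e) \<Rightarrow> ereal" where
  "tau v Plus l s \<omega> = Inf {t. s \<le> t \<and> phi v s t \<omega> > ereal l}"
| "tau v Minus l s \<omega> = Inf {t. s \<le> t \<and> phi v s t \<omega> < - ereal l}"

definition passage_exp ::
  "('e pt \<Rightarrow> (real \<Rightarrow> 'e) measure) \<Rightarrow> ('e option \<Rightarrow> real) \<Rightarrow> pm \<Rightarrow> real \<Rightarrow> 'e xfun \<Rightarrow> 'e xfun" where
  "passage_exp P v \<sigma> l g p =
     (\<integral>\<omega>. g (tau v \<sigma> l (fst p) \<omega>, Xst (tau v \<sigma> l (fst p) \<omega>) \<omega>) \<partial>P p)"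

definition J_op ::
  "('e pt \<Rightarrow> (real \<Rightarrow> 'e) measure) \<Rightarrow> ('e option \<Rightarrow> real) \<Rightarrow> pm \<Rightarrow> 'e xfun \<Rightarrow> 'e xfun" where
  "J_op P v \<sigma> g p = (if p \<in> Xbar_pm v (opp \<sigma>) then passage_exp P v \<sigma> 0 g p else 0)"

definition P_op ::
  "('e pt \<Rightarrow> (real \<Rightarrow> 'e) measure) \<Rightarrow> ('e option \<Rightarrow> real) \<Rightarrow> pm \<Rightarrow> real \<Rightarrow> 'e xfun \<Rightarrow> 'e xfun" where
  "P_op P v \<sigma> l g p = (if p \<in> Xbar_pm v \<sigma> then passage_exp P v \<sigma> l g p else 0)"

definition G_dom ::
  "('e pt \<Rightarrow> (real \<Rightarrow> 'e) measure) \<Rightarrow> ('e option \<Rightarrow> real) \<Rightarrow> pm \<Rightarrow> 'e xfun set" where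
  "G_dom P v \<sigma> = {g \<in> C0 v \<sigma>. \<forall>p\<in>Xbar_pm v \<sigma>.
      \<exists>L. ((\<lambda>l. (P_op P v \<sigma> l g p - g p) / l) \<longlongrightarrow> L) (at_right 0)}"

definition G_op ::
  "('e pt \<Rightarrow> (real \<Rightarrow> 'e) measure) \<Rightarrow> ('e option \<Rightarrow> real) \<Rightarrow> pm \<Rightarrow> 'e xfun \<Rightarrow> 'e xfun" where
  "G_op P v \<sigma> g p =
     (if p \<in> Xbar_pm v \<sigma> then Lim (at_right 0) (\<lambda>l. (P_op P v \<sigma> l g p - g p) / l) else 0)"

text \<open>The value 0 at \<open>(\<infinity>, None)\<close> reflects the convention that the generator at time \<open>\<infinity>\<close> is zero.\<close>

definition Lambda_op :: "(real \<Rightarrow> real^'e^'e) \<Rightarrow> 'e xfun \<Rightarrow> 'e xfun" where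
  "Lambda_op \<Lambda> g p = (case p of
      (ereal s, Some i) \<Rightarrow> (if 0 \<le> s then (\<Lambda> s *v (\<chi> j. g (ereal s, Some j))) $ i else 0)
    | _ \<Rightarrow> 0)"

text \<open>At the coffin state \<open>v\<close> is zero and \<open>inverse 0 = 0\<close>, so the value at \<open>(\<infinity>, None)\<close> is 0.\<close>

definition V_inv :: "('e option \<Rightarrow> real) \<Rightarrow> 'e xfun \<Rightarrow> 'e xfun" where
  "V_inv v g p = inverse (v (snd p)) * g p"

text \<open>
  The block operator with rows \<open>(I\<^sup>+, S\<^sup>-)\<close> and \<open>(S\<^sup>+, I\<^sup>-)\<close> applied to the column
  \<open>(gp, gm)\<close>, as one function on \<open>Xbar_full\<close>.
\<close>

definition block_op ::
  "('e option \<Rightarrow> real) \<Rightarrow> (pm \<Rightarrow> 'e xfun \<Rightarrow> 'e xfun) \<Rightarrow> 'e xfun \<Rightarrow> 'e xfun \<Rightarrow> 'e xfun" where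
  "block_op v S gp gm p =
     (if p \<in> Xbar_pm v Plus then gp p + S Minus gm p
      else if p \<in> Xbar_pm v Minus then S Plus gp p + gm p
      else 0)"

definition wiener_hopf_eq ::
  "(real \<Rightarrow> real^'e^'e) \<Rightarrow> ('e option \<Rightarrow> real) \<Rightarrow>
   (pm \<Rightarrow> 'e xfun \<Rightarrow> 'e xfun) \<Rightarrow> (pm \<Rightarrow> 'e xfun \<Rightarrow> 'e xfun) \<Rightarrow> bool" where
  "wiener_hopf_eq \<Lambda> v S H \<longleftrightarrow>
     (\<forall>gp\<in>C01 v Plus. \<forall>gm\<in>C01 v Minus. \<forall>p\<in>Xbar_full.
        V_inv v (\<lambda>q. ds (block_op v S gp gm) q + Lambda_op \<Lambda> (block_op v S gp gm) q) p =
        block_op v S (H Plus gp) (\<lambda>q. - H Minus gm q) p)"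

definition cond_a :: "('e option \<Rightarrow> real) \<Rightarrow> pm \<Rightarrow> ('e xfun \<Rightarrow> 'e xfun) \<Rightarrow> bool" where
  "cond_a v \<sigma> T \<longleftrightarrow>
     bounded_op (C0 v \<sigma>) (C0 v (opp \<sigma>)) T \<and>
     (\<forall>g\<in>Cc v \<sigma>. \<forall>\<eta>>0. supp g \<subseteq> {0..\<eta>} \<times> E_pm v \<sigma> \<longrightarrow>
        supp (T g) \<subseteq> {0..\<eta>} \<times> E_pm v (opp \<sigma>)) \<and>
     (\<forall>g\<in>C01 v \<sigma>. T g \<in> C01 v (opp \<sigma>))"

definition cond_b ::
  "('e option \<Rightarrow> real) \<Rightarrow> pm \<Rightarrow> ('e xfun \<Rightarrow> 'e xfun) \<Rightarrow> (real \<Rightarrow> 'e xfun \<Rightarrow> 'e xfun) \<Rightarrow> bool" where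
  "cond_b v \<sigma> A Q \<longleftrightarrow>
     sc_pos_contr_semigroup (C0 v \<sigma>) Q \<and> strong_generator (C0 v \<sigma>) Q A (C01 v \<sigma>)"

end

theory Submission
  imports Defs
begin

text \<open>
  Fix a sign \<open>\<sigma>\<close> and let \<open>w\<close> be \<open>v\<close> or \<open>- v\<close>, so that the half-space of \<open>\<sigma>\<close> consists of the states with \<open>w > 0\<close> and
  the passage times of \<open>\<sigma>\<close> are upward passage times of the clock \<open>\<phi>\<close>, the integral of \<open>w\<close> along the path. Let
  \<open>F g = g + S g\<close> be the extension of \<open>g\<close> to the whole space. With the other component equal to zero, the block
  equation says \<open>(d/ds + \<Lambda>) (F g) = w F (H g)\<close> (lemma \<open>F_deriv\<close>).

  Since \<open>d/dk (Q_k g) = H Q_k g\<close>, the function \<open>u(k, t, j) = F (Q_k g) (t, j)\<close> solves \<open>(d/dt + \<Lambda>) u = w du/dk\<close>. This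
  is the backward equation for \<open>u(\<kappa> - \<phi>, t, X)\<close>: the drift \<open>- w du/dk\<close> from the clock cancels the drift from time and
  jumps, so the process is a martingale while \<open>\<phi> < \<kappa>\<close>. Stop it when \<open>\<phi>\<close> first exceeds a level \<open>l < \<kappa>\<close>. At that time \<open>\<tau>\<close> the
  clock equals \<open>l\<close> and the state has \<open>w > 0\<close>, where \<open>F g = g\<close>. Letting \<open>\<kappa>\<close> decrease to \<open>l\<close> gives, from every starting
  point,
  \<open>F (Q_l g) (s, i) = E (g (\<tau>, X_\<tau>))\<close> (lemma \<open>passage_expectation\<close>).
  In the half-space of \<open>\<sigma>\<close> the left side is \<open>Q_l g\<close>, so \<open>Q = P\<close>; in the opposite half-space, with \<open>l = 0\<close>, it is \<open>S g\<close>,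
  so \<open>S = J\<close>. The claim about generators follows, because \<open>P\<close> and \<open>Q\<close> are the same semigroup.

  Two points need care. Paths that never reach the level must not contribute, although \<open>\<kappa> - \<phi>\<close> may tend to infinity
  on them. This holds for \<open>g\<close> supported in \<open>[0, \<eta>]\<close>, because then all \<open>F (Q_k g)\<close> vanish after \<open>\<eta>\<close> (lemma \<open>U_local\<close>):
  the support condition on \<open>S\<close> makes the equation after \<open>\<eta>\<close> closed, and its characteristics in states with \<open>w > 0\<close> lead to
  level \<open>0\<close> at later times, where \<open>g\<close> vanishes. Such \<open>g\<close> of class C1 are dense.

  The martingale property is obtained from right derivatives alone. For an event \<open>A\<close> observable at time \<open>t\<close> the
  expectation of \<open>u(\<kappa> - \<phi>, t', X)\<close> over \<open>A\<close> is continuous in \<open>t' \<ge> t\<close> and has right derivative zero (lemma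
  \<open>Y_expectation_right_deriv\<close>), by the Markov property, the generator at a fixed time and dominated convergence. A mean
  value inequality for right derivatives makes it constant. The passage time is then approximated from above by grid times.
\<close>

section \<open>One-sided derivatives and dominated convergence\<close>

text \<open>
  A mean value inequality that asks only for right derivatives. The functions of time met below
  are expectations along a Markov process and solutions along characteristics; in both cases the
  increment is only controlled to the right.
\<close>

lemma right_derivative_bound:
  fixes f :: "real \<Rightarrow> real"
  assumes "a \<le> b" and cont: "continuous_on {a..b} f"
    and der: "\<And>x. a \<le> x \<Longrightarrow> x < b \<Longrightarrow>
      \<exists>d. \<bar>d\<bar> \<le> M \<and> ((\<lambda>h. (f (x + h) - f x) / h) \<longlongrightarrow> d) (at_right 0)"
  shows "\<bar>f b - f a\<bar> \<le> M * (b - a)"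
proof -
  have "\<bar>f b - f a\<bar> \<le> (M + e) * (b - a)" if "e > 0" for e
  proof (rule ccontr)
    assume nb: "\<not> ?thesis"
    \<comment> \<open>The left end point of the set where the claimed bound fails satisfies the bound by continuity, and
      the right derivative there carries the bound a little further.\<close>
    define bad where "bad = {x\<in>{a..b}. \<bar>f x - f a\<bar> > (M + e) * (x - a)}"
    define c where "c = Inf bad"
    have bb: "b \<in> bad" using nb \<open>a \<le> b\<close> by (auto simp: bad_def)
    have bdd: "bdd_below bad" by (rule bdd_belowI[of _ a]) (auto simp: bad_def)
    have ac: "a \<le> c" unfolding c_def using bb by (intro cInf_greatest) (auto simp: bad_def)
    have cb: "c \<le> b" unfolding c_def using bb bdd by (intro cInf_lower)
    have cg: "\<bar>f c - f a\<bar> \<le> (M + e) * (c - a)"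
    proof (rule ccontr)
      assume n: "\<not> ?thesis"
      hence "c \<noteq> a" by auto
      with ac have "a < c" by simp
      have "((\<lambda>x. \<bar>f x - f a\<bar> - (M + e) * (x - a)) \<longlongrightarrow> \<bar>f c - f a\<bar> - (M + e) * (c - a)) (at c within {a..b})"
        using cont ac cb unfolding continuous_on_def by (intro tendsto_intros) auto
      hence "eventually (\<lambda>x. \<bar>f x - f a\<bar> - (M + e) * (x - a) > 0) (at c within {a..b})"
        using n by (intro order_tendstoD) auto
      then obtain d where d: "d > 0" "\<And>x. x \<in> {a..b} \<Longrightarrow> x \<noteq> c \<Longrightarrow> dist x c < d \<Longrightarrow> \<bar>f x - f a\<bar> - (M + e) * (x - a) > 0"
        unfolding eventually_at by blast
      define x where "x = max a (c - d/2)"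
      have x: "x \<in> {a..b}" "x < c" "dist x c < d" using d(1) \<open>a < c\<close> cb by (auto simp: x_def dist_real_def)
      hence "x \<in> bad" using d(2)[of x] by (auto simp: bad_def)
      hence "c \<le> x" unfolding c_def using bdd by (intro cInf_lower)
      with x show False by simp
    qed
    have "c \<noteq> b" using cg bb by (auto simp: bad_def)
    hence cb: "c < b" using cb by simp
    obtain d where d: "\<bar>d\<bar> \<le> M" "((\<lambda>h. (f (c + h) - f c) / h) \<longlongrightarrow> d) (at_right 0)"
      using der[OF ac cb] by blast
    have "eventually (\<lambda>h. \<bar>(f (c + h) - f c) / h\<bar> < M + e) (at_right 0)"
      using tendsto_rabs[OF d(2)] d(1) \<open>e > 0\<close> by (intro order_tendstoD) auto
    then obtain r where r: "r > 0" "\<And>h. 0 < h \<Longrightarrow> h < r \<Longrightarrow> \<bar>(f (c + h) - f c) / h\<bar> < M + e"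
      unfolding eventually_at_right_field by auto
    have "c + r \<le> x" if "x \<in> bad" for x
    proof (rule ccontr)
      assume "\<not> c + r \<le> x"
      moreover have "c \<le> x" unfolding c_def using that bdd by (intro cInf_lower)
      moreover have "x \<noteq> c" using that cg by (auto simp: bad_def)
      ultimately have "0 < x - c" "x - c < r" by auto
      from r(2)[OF this] this have "\<bar>f x - f c\<bar> \<le> (M + e) * (x - c)"
        by (simp add: abs_divide divide_simps)
      with cg have "\<bar>f x - f a\<bar> \<le> (M + e) * (x - a)" by (simp add: algebra_simps)
      with that show False by (auto simp: bad_def)
    qed
    hence "c + r \<le> c" unfolding c_def[symmetric] using bb unfolding c_def by (intro cInf_greatest) auto
    with r show False by simp
  qed
  hence "\<bar>f b - f a\<bar> \<le> M * (b - a) + e" if "e > 0" for e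
  proof -
    define e' where "e' = e / (b - a + 1)"
    have "e' > 0" using that \<open>a \<le> b\<close> by (simp add: e'_def)
    from \<open>\<And>e. e > 0 \<Longrightarrow> \<bar>f b - f a\<bar> \<le> (M + e) * (b - a)\<close>[OF this]
    have "\<bar>f b - f a\<bar> \<le> M * (b - a) + e' * (b - a)" by (simp add: algebra_simps)
    also have "e' * (b - a) \<le> e" using that \<open>a \<le> b\<close> by (simp add: e'_def field_simps)
    finally show ?thesis by simp
  qed
  thus ?thesis by (rule field_le_epsilon)
qed

lemma integral_tendsto_at_right:
  fixes f :: "real \<Rightarrow> 'a \<Rightarrow> real"
  assumes "prob_space M"
    and meas: "\<And>h. 0 < h \<Longrightarrow> f h \<in> borel_measurable M" and "g \<in> borel_measurable M"
    and bd: "eventually (\<lambda>h. \<forall>x\<in>space M. \<bar>f h x\<bar> \<le> B) (at_right 0)"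
    and lim: "\<And>x. x \<in> space M \<Longrightarrow> ((\<lambda>h. f h x) \<longlongrightarrow> g x) (at_right 0)"
  shows "((\<lambda>h. \<integral>x. f h x \<partial>M) \<longlongrightarrow> (\<integral>x. g x \<partial>M)) (at_right 0)"
  unfolding tendsto_at_iff_sequentially
proof (intro allI impI)
  interpret prob_space M by fact
  fix X :: "nat \<Rightarrow> real"
  assume X: "\<forall>i. X i \<in> {0<..} - {0}" "X \<longlonglongrightarrow> 0"
  obtain b where b: "b > 0" "\<And>h. 0 < h \<Longrightarrow> h < b \<Longrightarrow> \<forall>x\<in>space M. \<bar>f h x\<bar> \<le> B"
    using bd unfolding eventually_at_right_field by auto
  have "eventually (\<lambda>n. X n < b) sequentially" using X(2) b(1) by (intro order_tendstoD)
  then obtain N where N: "\<And>n. n \<ge> N \<Longrightarrow> X n < b" unfolding eventually_sequentially by auto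
  have "(\<lambda>n. \<integral>x. f (X (n + N)) x \<partial>M) \<longlonglongrightarrow> (\<integral>x. g x \<partial>M)"
  proof (rule integral_dominated_convergence[where w = "\<lambda>_. B"])
    show "f (X (n + N)) \<in> borel_measurable M" for n using X meas by auto
    have "(\<lambda>n. f (X n) x) \<longlonglongrightarrow> g x" if "x \<in> space M" for x
      using lim[OF that] X unfolding tendsto_at_iff_sequentially comp_def by auto
    thus "AE x in M. (\<lambda>n. f (X (n + N)) x) \<longlonglongrightarrow> g x"
      by (intro AE_I2 LIMSEQ_ignore_initial_segment)
    show "AE x in M. norm (f (X (n + N)) x) \<le> B" for n
      using b(2)[of "X (n + N)"] X N[of "n + N"] by (intro AE_I2) auto
  qed (use assms in auto)
  thus "((\<lambda>h. \<integral>x. f h x \<partial>M) \<circ> X) \<longlonglongrightarrow> (\<integral>x. g x \<partial>M)"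
    unfolding comp_def by (rule LIMSEQ_offset)
qed

section \<open>Functions vanishing at infinity\<close>

text \<open>
  Boundedness and Borel measurability are consequences of the fibrewise conditions: a fibre is
  continuous with a limit, and there are finitely many of them.
\<close>

lemma C0_iff:
  fixes v :: "'e::finite option \<Rightarrow> real"
  shows "f \<in> C0 v \<sigma> \<longleftrightarrow> (\<forall>p. p \<notin> X_pm v \<sigma> \<longrightarrow> f p = 0) \<and>
    (\<forall>i\<in>E_pm v \<sigma>. continuous_on {0..} (\<lambda>s. f (ereal s, Some i)) \<and>
      ((\<lambda>s. f (ereal s, Some i)) \<longlongrightarrow> 0) at_top)" (is "_ \<longleftrightarrow> ?R")
proof
  assume R: ?R
  have z: "f p = 0" if "p \<notin> X_pm v \<sigma>" for p using R[THEN conjunct1, THEN spec, THEN mp, OF that] .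
  have bdd1: "\<exists>B. \<forall>s\<ge>0. \<bar>f (ereal s, Some i)\<bar> \<le> B" if i: "i \<in> E_pm v \<sigma>" for i
  proof -
    have "eventually (\<lambda>s. \<bar>f (ereal s, Some i)\<bar> < 1) at_top"
      using R i tendsto_rabs[of "\<lambda>s. f (ereal s, Some i)" 0 at_top] by (intro order_tendstoD) auto
    then obtain T where T: "\<And>s. s \<ge> T \<Longrightarrow> \<bar>f (ereal s, Some i)\<bar> < 1"
      unfolding eventually_at_top_linorder by auto
    have "continuous_on {0..T} (\<lambda>s. f (ereal s, Some i))"
      using R i by (auto intro: continuous_on_subset)
    hence "bounded ((\<lambda>s. f (ereal s, Some i)) ` {0..T})"
      by (intro compact_imp_bounded compact_continuous_image) auto
    then obtain B where B0: "\<forall>x\<in>(\<lambda>s. f (ereal s, Some i)) ` {0..T}. norm x \<le> B"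
      unfolding bounded_iff by (elim exE)
    have B: "\<bar>f (ereal s, Some i)\<bar> \<le> B" if "s \<in> {0..T}" for s
      using B0[rule_format, OF imageI[OF that]] by simp
    have "\<bar>f (ereal s, Some i)\<bar> \<le> max B 1" if "s \<ge> 0" for s
      using B[of s] T[of s] that by (cases "s \<le> T") (auto simp: le_max_iff_disj)
    thus ?thesis by blast
  qed
  then obtain B where B: "\<And>i s. i \<in> E_pm v \<sigma> \<Longrightarrow> s \<ge> 0 \<Longrightarrow> \<bar>f (ereal s, Some i)\<bar> \<le> B i" by metis
  have bdd: "\<bar>f p\<bar> \<le> (\<Sum>i\<in>UNIV. \<bar>B i\<bar>)" for p
  proof (cases "p \<in> X_pm v \<sigma>")
    case True
    then obtain s i where p: "p = (ereal s, Some i)" "s \<ge> 0" "i \<in> E_pm v \<sigma>" by (auto simp: X_pm_def)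
    have "\<bar>f p\<bar> \<le> \<bar>B i\<bar>" using B[of i s] p by auto
    also have "\<dots> \<le> (\<Sum>i\<in>UNIV. \<bar>B i\<bar>)" by (rule member_le_sum) auto
    finally show ?thesis .
  next
    case False
    thus ?thesis by (simp add: sum_nonneg z)
  qed
  have sec: "(\<lambda>x. f (x, j)) \<in> borel_measurable borel" for j
  proof (cases "\<exists>i\<in>E_pm v \<sigma>. j = Some i")
    case True
    then obtain i where i: "j = Some i" "i \<in> E_pm v \<sigma>" by blast
    have c: "(\<lambda>s. indicator {0..} s *\<^sub>R f (ereal s, Some i)) \<in> borel_measurable borel"
      using R i by (intro borel_measurable_continuous_on_indicator) auto
    have "(\<lambda>x. f (x, j)) = (\<lambda>x. if x = \<infinity> \<or> x = -\<infinity> then 0 else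
        (indicator {0..} (real_of_ereal x) *\<^sub>R f (ereal (real_of_ereal x), Some i)))"
    proof
      fix x show "f (x, j) = (if x = \<infinity> \<or> x = -\<infinity> then 0 else
        (indicator {0..} (real_of_ereal x) *\<^sub>R f (ereal (real_of_ereal x), Some i)))"
        using i z[of "(x, j)"] by (cases x) (auto simp: X_pm_def indicator_def)
    qed
    also have "\<dots> \<in> borel_measurable borel"
      by (intro measurable_If measurable_compose[OF _ c] borel_measurable_real_of_ereal) auto
    finally show ?thesis .
  next
    case False
    hence "(x, j) \<notin> X_pm v \<sigma>" for x by (auto simp: X_pm_def)
    hence "(\<lambda>x. f (x, j)) = (\<lambda>x. 0)" by (simp add: z)
    thus ?thesis by simp
  qed
  have "f \<in> borel_measurable (borel \<Otimes>\<^sub>M count_space UNIV)"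
  proof -
    have "(\<lambda>p. (\<lambda>j p. f (fst p, j)) (snd p) p) \<in> borel_measurable (borel \<Otimes>\<^sub>M count_space UNIV)"
      by (rule measurable_compose_countable) (rule measurable_compose[OF measurable_fst sec], rule measurable_snd)
    thus ?thesis by simp
  qed
  moreover have "bounded (range f)" unfolding bounded_iff using bdd by auto
  ultimately show "f \<in> C0 v \<sigma>" using R by (simp add: C0_def Linf_def del: split_paired_All)
next
  assume "f \<in> C0 v \<sigma>"
  thus ?R by (simp add: C0_def Linf_def del: split_paired_All)
qed

lemma C0_zero_off: "f \<in> C0 v \<sigma> \<Longrightarrow> p \<notin> X_pm v \<sigma> \<Longrightarrow> f p = 0"
  by (simp add: C0_def Linf_def del: split_paired_All)

lemma abs_le_sup_norm: "f \<in> C0 v \<sigma> \<Longrightarrow> \<bar>f p\<bar> \<le> sup_norm f"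
proof -
  assume "f \<in> C0 v \<sigma>"
  then obtain B where "\<And>p. \<bar>f p\<bar> \<le> B" unfolding C0_def Linf_def bounded_iff by auto
  thus ?thesis unfolding sup_norm_def by (intro cSUP_upper) (auto intro!: bdd_aboveI2[where M = B])
qed

lemma sup_norm_le: "(\<And>p. \<bar>f p\<bar> \<le> B) \<Longrightarrow> sup_norm f \<le> B"
  unfolding sup_norm_def by (intro cSUP_least) auto

lemma C0_section:
  fixes v :: "'e::finite option \<Rightarrow> real"
  assumes "f \<in> C0 v \<sigma>"
  shows "continuous_on {0..} (\<lambda>s. f (ereal s, Some i))"
    and "((\<lambda>s. f (ereal s, Some i)) \<longlongrightarrow> 0) at_top"
proof -
  have "f (ereal s, Some i) = 0" if "i \<notin> E_pm v \<sigma>" for s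
    using that by (intro C0_zero_off[OF assms]) (auto simp: X_pm_def)
  thus "continuous_on {0..} (\<lambda>s. f (ereal s, Some i))" "((\<lambda>s. f (ereal s, Some i)) \<longlongrightarrow> 0) at_top"
    using assms by (cases "i \<in> E_pm v \<sigma>"; simp add: C0_def)+
qed

lemma C0_lin:
  fixes v :: "'e::finite option \<Rightarrow> real"
  assumes "f \<in> C0 v \<sigma>" "g \<in> C0 v \<sigma>"
  shows "(\<lambda>p. a * f p + b * g p) \<in> C0 v \<sigma>"
  using assms C0_section[OF assms(1)] C0_section[OF assms(2)]
  unfolding C0_iff
  by (auto intro!: continuous_intros tendsto_add_zero tendsto_mult_right_zero)

lemma C0_uniform_limit:
  fixes v :: "'e::finite option \<Rightarrow> real"
  assumes ev: "eventually (\<lambda>l. f l \<in> C0 v \<sigma>) Fl" and u: "uniform_limit UNIV f h Fl" and "Fl \<noteq> bot"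
  shows "h \<in> C0 v \<sigma>"
  unfolding C0_iff
proof (intro conjI allI impI ballI)
  have pt: "((\<lambda>l. f l p) \<longlongrightarrow> h p) Fl" for p by (rule tendsto_uniform_limitI[OF u]) simp
  show "h p = 0" if "p \<notin> X_pm v \<sigma>" for p
  proof -
    have "eventually (\<lambda>l. f l p = 0) Fl" using ev by (rule eventually_mono) (rule C0_zero_off[OF _ that])
    hence "((\<lambda>l. f l p) \<longlongrightarrow> 0) Fl" by (rule tendsto_eventually)
    from tendsto_unique[OF \<open>Fl \<noteq> bot\<close> pt this] show ?thesis .
  qed
  fix i
  have u': "uniform_limit {0..} (\<lambda>l s. f l (ereal s, Some i)) (\<lambda>s. h (ereal s, Some i)) Fl"
    by (rule uniform_limit_compose'[OF u]) simp
  show "continuous_on {0..} (\<lambda>s. h (ereal s, Some i))"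
    by (rule uniform_limit_theorem[OF _ u'])
      (use ev \<open>Fl \<noteq> bot\<close> in \<open>auto elim!: eventually_mono intro: C0_section\<close>)
  show "((\<lambda>s. h (ereal s, Some i)) \<longlongrightarrow> 0) at_top"
  proof (rule tendstoI)
    fix e :: real assume "e > 0"
    hence "eventually (\<lambda>l. \<forall>p\<in>UNIV. dist (f l p) (h p) < e/2) Fl"
      by (intro uniform_limitD[OF u]) simp
    from eventually_happens'[OF \<open>Fl \<noteq> bot\<close> eventually_conj[OF this ev]]
    obtain l where "\<forall>p\<in>UNIV. dist (f l p) (h p) < e/2" and l2: "f l \<in> C0 v \<sigma>"
      by (elim exE conjE)
    hence l1: "dist (f l p) (h p) < e/2" for p by (elim ballE[of _ _ p]) simp_all
    have "eventually (\<lambda>s. dist (f l (ereal s, Some i)) 0 < e/2) at_top"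
      using tendstoD[OF C0_section(2)[OF l2], of "e/2"] \<open>e > 0\<close> by simp
    thus "eventually (\<lambda>s. dist (h (ereal s, Some i)) 0 < e) at_top"
    proof eventually_elim
      case (elim s)
      have "dist (h (ereal s, Some i)) 0 \<le> dist (f l (ereal s, Some i)) (h (ereal s, Some i)) + dist (f l (ereal s, Some i)) 0"
        using dist_triangle3 .
      with elim l1[of "(ereal s, Some i)"] show ?case by linarith
    qed
  qed
qed

section \<open>Differentiable functions and their density\<close>

text \<open>
  The velocity field with the sign for which \<open>E_pm v \<sigma>\<close> is the set of states of positive speed. It makes both
  choices of \<open>\<sigma>\<close> instances of one upward passage problem.
\<close>

definition speed :: "('e option \<Rightarrow> real) \<Rightarrow> pm \<Rightarrow> 'e \<Rightarrow> real" where
  "speed v \<sigma> j = (case \<sigma> of Plus \<Rightarrow> v (Some j) | Minus \<Rightarrow> - v (Some j))"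

lemma E_pm_iff: "i \<in> E_pm v \<sigma> \<longleftrightarrow> speed v \<sigma> i > 0"
  by (cases \<sigma>) (auto simp: speed_def)

lemma speed_opp: "speed v (opp \<sigma>) i = - speed v \<sigma> i"
  by (cases \<sigma>) (auto simp: speed_def)

lemma at_Ici_nontrivial: "(s::real) \<ge> 0 \<Longrightarrow> at s within {0..} \<noteq> bot"
proof -
  assume "s \<ge> 0"
  hence "at_right s \<le> at s within {0..}" by (intro at_le) auto
  thus ?thesis using trivial_limit_at_right_real[of s] by (auto simp: bot_unique)
qed

lemma ds_eqI:
  assumes "((\<lambda>u. f (ereal u, Some i)) has_real_derivative D) (at s within {0..})" "s \<ge> 0"
  shows "ds f (ereal s, Some i) = D"
  using assms vector_derivative_within[OF at_Ici_nontrivial]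
  by (auto simp: ds_def has_real_derivative_iff_has_vector_derivative)

lemma C01_deriv:
  fixes v :: "'e::finite option \<Rightarrow> real"
  assumes "f \<in> C01 v \<sigma>" "s \<ge> 0"
  shows "((\<lambda>u. f (ereal u, Some i)) has_real_derivative ds f (ereal s, Some i)) (at s within {0..})"
proof (cases "i \<in> E_pm v \<sigma>")
  case True
  thus ?thesis using assms
    by (auto simp: C01_def ds_def has_real_derivative_iff_has_vector_derivative vector_derivative_works)
next
  case False
  have "f \<in> C0 v \<sigma>" using assms by (simp add: C01_def)
  hence z: "f (ereal u, Some i) = 0" for u using False by (elim C0_zero_off) (auto simp: X_pm_def)
  hence "((\<lambda>u. f (ereal u, Some i)) has_real_derivative 0) (at s within {0..})" by simp
  with ds_eqI[OF this assms(2)] show ?thesis by simp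
qed

lemma C01I:
  fixes v :: "'e::finite option \<Rightarrow> real"
  assumes "f \<in> C0 v \<sigma>"
    and der: "\<And>i s. i \<in> E_pm v \<sigma> \<Longrightarrow> s \<ge> 0 \<Longrightarrow>
      ((\<lambda>u. f (ereal u, Some i)) has_real_derivative D i s) (at s within {0..})"
    and cont: "\<And>i. i \<in> E_pm v \<sigma> \<Longrightarrow> continuous_on {0..} (D i)"
    and lim: "\<And>i. i \<in> E_pm v \<sigma> \<Longrightarrow> (D i \<longlongrightarrow> 0) at_top"
  shows "f \<in> C01 v \<sigma>"
proof -
  have e: "ds f (ereal s, Some i) = D i s" if "i \<in> E_pm v \<sigma>" "s \<ge> 0" for i s
    using ds_eqI[OF der] that by auto
  have z: "ds f p = 0" if "p \<notin> X_pm v \<sigma>" for p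
  proof (cases "\<exists>s i. p = (ereal s, Some i) \<and> s \<ge> 0")
    case True
    then obtain s i where p: "p = (ereal s, Some i)" "s \<ge> 0" by blast
    with that have i: "i \<notin> E_pm v \<sigma>" by (auto simp: X_pm_def)
    hence "f (ereal u, Some i) = 0" for u using assms(1) by (elim C0_zero_off) (auto simp: X_pm_def)
    hence "((\<lambda>u. f (ereal u, Some i)) has_real_derivative 0) (at s within {0..})" by simp
    from ds_eqI[OF this p(2)] p show ?thesis by simp
  qed (auto simp: ds_def split: prod.splits ereal.splits option.splits)
  have "continuous_on {0..} (\<lambda>s. ds f (ereal s, Some i))" if "i \<in> E_pm v \<sigma>" for i
    using cont[OF that] e[OF that] by (subst continuous_on_cong[OF refl, where g = "D i"]) auto
  moreover have "((\<lambda>s. ds f (ereal s, Some i)) \<longlongrightarrow> 0) at_top" if "i \<in> E_pm v \<sigma>" for i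
    using lim[OF that]
    by (rule Lim_transform_eventually)
       (use eventually_ge_at_top[of 0] in eventually_elim, simp add: e that)
  ultimately have "ds f \<in> C0 v \<sigma>" using z unfolding C0_iff by blast
  moreover have "(\<lambda>u. f (ereal u, Some i)) differentiable at s within {0..}" if "i \<in> E_pm v \<sigma>" "s \<ge> 0" for i s
    using der[OF that] by (auto simp: has_real_derivative_iff_has_vector_derivative differentiableI_vector)
  ultimately show ?thesis using assms(1) by (auto simp: C01_def)
qed

lemma choice3: "(\<And>i. \<exists>a b c. Q i a b c) \<Longrightarrow> \<exists>a b c. \<forall>i. Q i (a i) (b i) (c i)"
  by metis

text \<open>
  Soft thresholding at \<open>e/2\<close> gives a continuous function of bounded support. Averaging
  it forward over \<open>[s, s + d]\<close> makes it continuously differentiable; averaging forward neither enlarges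
  the support to the right nor asks for values at negative times.
\<close>

lemma C1_compact_approx:
  fixes F :: "real \<Rightarrow> real"
  assumes cF: "continuous_on {0..} F" and lim: "(F \<longlongrightarrow> 0) at_top" and "e > 0"
  shows "\<exists>G G' \<eta>. \<eta> > 0 \<and> (\<forall>s\<ge>0. (G has_real_derivative G' s) (at s within {0..})) \<and> continuous_on {0..} G' \<and>
    (\<forall>s\<ge>\<eta>. G s = 0 \<and> G' s = 0) \<and> (\<forall>s\<ge>0. \<bar>F s - G s\<bar> \<le> e)"
proof -
  define F1 where "F1 = (\<lambda>s. F (max 0 s) - max (- (e/2)) (min (e/2) (F (max 0 s))))"
  have c0: "continuous_on UNIV (\<lambda>s. F (max 0 s))"
    by (rule continuous_on_compose2[OF cF]) (auto intro!: continuous_intros)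
  have c1: "continuous_on X F1" for X
    unfolding F1_def by (rule continuous_on_subset[of UNIV]) (auto intro!: continuous_intros c0)
  have "eventually (\<lambda>s. \<bar>F s\<bar> < e/2) at_top"
    using tendsto_rabs[OF lim] \<open>e > 0\<close> by (intro order_tendstoD) auto
  then obtain T0 where T0: "\<And>s. s \<ge> T0 \<Longrightarrow> \<bar>F s\<bar> < e/2" unfolding eventually_at_top_linorder by auto
  define T where "T = max 1 T0"
  have z: "F1 s = 0" if "s \<ge> T" for s
  proof -
    have "s \<ge> T0" "max 0 s = s" using that by (auto simp: T_def)
    with T0[of s] have "max (- (e/2)) (min (e/2) (F (max 0 s))) = F s" by (simp add: abs_less_iff)
    thus ?thesis using \<open>max 0 s = s\<close> by (simp add: F1_def)
  qed
  have near: "\<bar>F s - F1 s\<bar> \<le> e/2" if "s \<ge> 0" for s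
    using that \<open>e > 0\<close> by (auto simp: F1_def)
  have "uniformly_continuous_on {0..T+1} F1" by (intro compact_uniformly_continuous c1) auto
  hence "\<exists>d>0. \<forall>x\<in>{0..T+1}. \<forall>x'\<in>{0..T+1}. dist x' x < d \<longrightarrow> dist (F1 x') (F1 x) < e/2"
    unfolding uniformly_continuous_on_def by (elim allE[of _ "e/2"]) (simp add: \<open>e > 0\<close>)
  then obtain d0 where d0: "d0 > 0" "\<forall>x\<in>{0..T+1}. \<forall>x'\<in>{0..T+1}. dist x' x < d0 \<longrightarrow> dist (F1 x') (F1 x) < e/2"
    by (elim exE conjE)
  define d where "d = min 1 d0"
  have d: "0 < d" "d \<le> 1" "d \<le> d0" using d0 by (auto simp: d_def)
  define A where "A = (\<lambda>s. integral {-1..s} F1)"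
  have dA: "(A has_real_derivative F1 s) (at s)" if "s \<ge> 0" for s
  proof -
    have "(A has_real_derivative F1 s) (at s within {-1..s+1})"
      unfolding A_def using that by (intro integral_has_real_derivative c1) auto
    thus ?thesis using that by (subst (asm) at_within_Icc_at) auto
  qed
  define G where "G = (\<lambda>s. (A (s + d) - A s) / d)"
  have mvt: "\<exists>z. s < z \<and> z < s + d \<and> G s = F1 z" if "s \<ge> 0" for s
  proof -
    have "\<exists>z. s < z \<and> z < s + d \<and> A (s + d) - A s = (s + d - s) * F1 z"
      using that d by (intro MVT2 dA) auto
    thus ?thesis using d by (auto simp: G_def)
  qed
  have dG: "(G has_real_derivative (F1 (s + d) - F1 s) / d) (at s within {0..})" if "s \<ge> 0" for s
  proof -
    have "((\<lambda>s. A (s + d)) has_real_derivative F1 (s + d) * 1) (at s)"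
      using that d by (intro DERIV_chain2[OF dA]) (auto intro!: derivative_eq_intros)
    hence "(G has_real_derivative (F1 (s + d) - F1 s) / d) (at s)"
      unfolding G_def using dA[OF that] d by (auto intro!: derivative_eq_intros)
    thus ?thesis by (rule has_field_derivative_at_within)
  qed
  have c2: "continuous_on {0..} (\<lambda>s. (F1 (s + d) - F1 s) / d)"
  proof -
    have "continuous_on {0..} (\<lambda>s. F1 (s + d))"
      by (rule continuous_on_compose2[OF c1[of UNIV]]) (auto intro!: continuous_intros)
    thus ?thesis using d by (intro continuous_on_divide continuous_on_diff c1 continuous_on_const) auto
  qed
  have z2: "G s = 0 \<and> (F1 (s + d) - F1 s) / d = 0" if "s \<ge> T" for s
  proof -
    have "s \<ge> 0" using that by (simp add: T_def)
    from mvt[OF this] obtain w where "s < w" "G s = F1 w" by blast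
    thus ?thesis using z[of w] z[of s] z[of "s + d"] that d by simp
  qed
  have n2: "\<bar>F s - G s\<bar> \<le> e" if s: "s \<ge> 0" for s
  proof -
    obtain w where w: "s < w" "w < s + d" "G s = F1 w" using mvt[OF s] by auto
    have "\<bar>F1 s - F1 w\<bar> \<le> e/2"
    proof (cases "s \<ge> T")
      case False
      hence "dist (F1 s) (F1 w) < e/2" using w d s by (intro d0(2)[rule_format]) (auto simp: dist_real_def)
      thus ?thesis by (simp add: dist_real_def)
    next
      case True
      thus ?thesis using w(1) z[of s] z[of w] \<open>e > 0\<close> by simp
    qed
    thus ?thesis using near[OF s] w by linarith
  qed
  have T: "T > 0" by (auto simp: T_def)
  show ?thesis
  proof (intro exI conjI allI impI)
    show "T > 0" by (rule T)
    show "(G has_real_derivative (F1 (s + d) - F1 s) / d) (at s within {0..})" if "s \<ge> 0" for s by (rule dG[OF that])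
    show "\<bar>F s - G s\<bar> \<le> e" if "s \<ge> 0" for s by (rule n2[OF that])
    show "G s = 0" "(F1 (s + d) - F1 s) / d = 0" if "T \<le> s" for s
      using z2[OF that] by (rule conjunct1, rule conjunct2)
  qed (rule c2)
qed

lemma C01_bounded_support_dense:
  fixes v :: "'e::finite option \<Rightarrow> real"
  assumes f: "f \<in> C0 v \<sigma>" and "e > 0"
  shows "\<exists>g\<in>C01 v \<sigma>. \<exists>\<eta>>0. (\<forall>t\<ge>\<eta>. \<forall>i. g (ereal t, Some i) = 0) \<and> (\<forall>p. \<bar>f p - g p\<bar> \<le> e)"
proof -
  define Q where "Q = (\<lambda>i G G' (\<eta>::real). \<eta> > 0 \<and> (\<forall>s\<ge>0. (G has_real_derivative G' s) (at s within {0..})) \<and>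
    continuous_on {0..} G' \<and> (\<forall>s\<ge>\<eta>. G s = 0 \<and> G' s = 0) \<and> (\<forall>s\<ge>0. \<bar>f (ereal s, Some i) - G s\<bar> \<le> e))"
  have "\<exists>G G' \<eta>. Q i G G' \<eta>" for i
    unfolding Q_def by (rule C1_compact_approx[OF C0_section[OF f] \<open>e > 0\<close>])
  from choice3[of Q, OF this] obtain G G' \<eta> where G0: "\<forall>i. Q i (G i) (G' i) (\<eta> i)"
    by (elim exE)
  have G: "\<eta> i > 0" "s \<ge> 0 \<Longrightarrow> (G i has_real_derivative G' i s) (at s within {0..})"
    "continuous_on {0..} (G' i)" "s \<ge> \<eta> i \<Longrightarrow> G i s = 0 \<and> G' i s = 0"
    "s \<ge> 0 \<Longrightarrow> \<bar>f (ereal s, Some i) - G i s\<bar> \<le> e" for i s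
    using G0[rule_format, of i] unfolding Q_def by simp_all
  define g :: "'e xfun" where "g = (\<lambda>p. if p \<in> X_pm v \<sigma> then G (the (snd p)) (real_of_ereal (fst p)) else 0)"
  have gs: "g (ereal s, Some i) = G i s" if "i \<in> E_pm v \<sigma>" "s \<ge> 0" for s i
    using that by (auto simp: g_def X_pm_def)
  have lim: "((\<lambda>s. G i s) \<longlongrightarrow> 0) at_top" "((\<lambda>s. G' i s) \<longlongrightarrow> 0) at_top" for i
    by (rule tendsto_eventually, rule eventually_mono[OF eventually_ge_at_top[of "\<eta> i"]], simp add: G)+
  have cG: "continuous_on {0..} (G i)" for i
    by (rule DERIV_continuous_on[where D = "G' i"]) (rule G(2), simp)
  have "g \<in> C0 v \<sigma>" unfolding C0_iff
  proof (intro conjI allI impI ballI)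
    fix i assume i: "i \<in> E_pm v \<sigma>"
    show "continuous_on {0..} (\<lambda>s. g (ereal s, Some i))"
      using cG[of i] by (subst continuous_on_cong[OF refl, where g = "G i"]) (auto simp: gs i)
    show "((\<lambda>s. g (ereal s, Some i)) \<longlongrightarrow> 0) at_top" using lim(1)[of i]
      by (rule Lim_transform_eventually)
         (use eventually_ge_at_top[of 0] in eventually_elim, simp add: gs i)
  qed (auto simp: g_def)
  hence g01: "g \<in> C01 v \<sigma>"
  proof (rule C01I[where D = G'])
    fix i s assume i: "i \<in> E_pm v \<sigma>" and s: "(s::real) \<ge> 0"
    show "((\<lambda>u. g (ereal u, Some i)) has_real_derivative G' i s) (at s within {0..})"
      by (rule has_field_derivative_transform_within[OF G(2)[OF s] zero_less_one])
         (simp_all add: s gs[OF i])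
  qed (rule G(3), rule lim(2))
  define \<eta>' where "\<eta>' = Max (range \<eta>)"
  have \<eta>': "\<eta>' \<ge> \<eta> i" for i unfolding \<eta>'_def by (intro Max_ge) auto
  have p: "\<eta>' > 0" using less_le_trans[OF G(1) \<eta>'] .
  have z: "g (ereal t, Some i) = 0" if "t \<ge> \<eta>'" for t i
    using G(4)[OF order_trans[OF \<eta>' that]] by (simp add: g_def)
  have n: "\<bar>f p - g p\<bar> \<le> e" for p
  proof (cases "p \<in> X_pm v \<sigma>")
    case True
    then obtain s i where p: "p = (ereal s, Some i)" "s \<ge> 0" "i \<in> E_pm v \<sigma>" unfolding X_pm_def by blast
    show ?thesis unfolding p(1) gs[OF p(3,2)] by (rule G(5)[OF p(2)])
  next
    case False
    thus ?thesis using C0_zero_off[OF f False] \<open>e > 0\<close> by (simp add: g_def)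
  qed
  show ?thesis using p z n by (intro bexI[OF _ g01] exI[of _ \<eta>'] conjI allI impI)
qed

section \<open>The semigroups and their generators\<close>

lemma uniform_limit_diagonal:
  fixes f :: "'a \<Rightarrow> 'b \<Rightarrow> real"
  assumes "uniform_limit UNIV f g F"
  shows "((\<lambda>h. f h (x h) - g (x h)) \<longlongrightarrow> 0) F"
proof (rule tendstoI)
  fix e :: real assume "e > 0"
  from uniform_limitD[OF assms this]
  show "eventually (\<lambda>h. dist (f h (x h) - g (x h)) 0 < e) F"
    by (rule eventually_mono) (auto simp: dist_real_def)
qed

text \<open>
  Uniform limits are stated with \<open>\<le>\<close> because the norm estimates for the operators below are not strict.
\<close>

lemma uniform_limit_abs_le:
  fixes f :: "'a \<Rightarrow> 'b \<Rightarrow> real"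
  assumes "\<And>e. e > 0 \<Longrightarrow> eventually (\<lambda>h. \<forall>p. \<bar>f h p - g p\<bar> \<le> e) F"
  shows "uniform_limit UNIV f g F"
proof (rule uniform_limitI)
  fix e :: real assume "e > 0"
  hence "eventually (\<lambda>h. \<forall>p. \<bar>f h p - g p\<bar> \<le> e/2) F" by (intro assms) simp
  thus "eventually (\<lambda>h. \<forall>p\<in>UNIV. dist (f h p) (g p) < e) F"
  proof (rule eventually_mono, intro ballI)
    fix h p assume "\<forall>p. \<bar>f h p - g p\<bar> \<le> e/2"
    hence "\<bar>f h p - g p\<bar> \<le> e/2" by (rule spec)
    thus "dist (f h p) (g p) < e" using \<open>e > 0\<close> by (simp add: dist_real_def)
  qed
qed

lemma uniform_limit_abs_leD:
  fixes f :: "'a \<Rightarrow> 'b \<Rightarrow> real"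
  assumes "uniform_limit UNIV f g F" "e > 0"
  shows "eventually (\<lambda>h. \<forall>p. \<bar>f h p - g p\<bar> \<le> e) F"
  using uniform_limitD[OF assms] by (rule eventually_mono) (simp add: dist_real_def less_imp_le del: split_paired_All)

locale wiener_hopf =
  fixes \<Lambda> :: "real \<Rightarrow> real^'e::finite^'e"
    and v :: "'e option \<Rightarrow> real"
    and S H :: "pm \<Rightarrow> 'e xfun \<Rightarrow> 'e xfun"
    and Q :: "pm \<Rightarrow> real \<Rightarrow> 'e xfun \<Rightarrow> 'e xfun"
  assumes gen: "generator_family \<Lambda>"
    and v_nz: "v (Some i) \<noteq> 0"
    and wh: "wiener_hopf_eq \<Lambda> v S H"
    and cond_a: "cond_a v \<sigma> (S \<sigma>)"
    and cond_b: "cond_b v \<sigma> (H \<sigma>) (Q \<sigma>)"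
begin

text \<open>
  The column of the block operator that belongs to the sign \<open>\<sigma>\<close>: it extends \<open>g\<close> from the half-space of \<open>\<sigma>\<close>
  to the whole space by \<open>S \<sigma> g\<close>. Both summands vanish off their own half-space, so a sum is an extension.
\<close>

definition F :: "pm \<Rightarrow> 'e xfun \<Rightarrow> 'e xfun" where
  "F \<sigma> g p = g p + S \<sigma> g p"

lemma S_C0: "g \<in> C0 v \<sigma> \<Longrightarrow> S \<sigma> g \<in> C0 v (opp \<sigma>)"
  and S_C01: "g \<in> C01 v \<sigma> \<Longrightarrow> S \<sigma> g \<in> C01 v (opp \<sigma>)"
  using cond_a[of \<sigma>] by (auto simp: cond_a_def bounded_op_def linear_op_def)

lemma linear_comb:
  assumes T: "linear_op (C0 v \<sigma>) D T" and f: "f \<in> C0 v \<sigma>" and g: "g \<in> C0 v \<sigma>"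
  shows "T (\<lambda>p. a * f p + b * g p) = (\<lambda>p. a * T f p + b * T g p)"
proof -
  have "(\<lambda>p. a * f p) \<in> C0 v \<sigma>" "(\<lambda>p. b * g p) \<in> C0 v \<sigma>"
    using C0_lin[OF f f, of a 0] C0_lin[OF g g, of b 0] by simp_all
  thus ?thesis using T f g unfolding linear_op_def by simp
qed

lemma S_lin: "f \<in> C0 v \<sigma> \<Longrightarrow> g \<in> C0 v \<sigma> \<Longrightarrow> S \<sigma> (\<lambda>p. a * f p + b * g p) = (\<lambda>p. a * S \<sigma> f p + b * S \<sigma> g p)"
  using cond_a[of \<sigma>] by (intro linear_comb) (auto simp: cond_a_def bounded_op_def)

lemma F_lin: "f \<in> C0 v \<sigma> \<Longrightarrow> g \<in> C0 v \<sigma> \<Longrightarrow> F \<sigma> (\<lambda>p. a * f p + b * g p) p = a * F \<sigma> f p + b * F \<sigma> g p"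
  by (simp add: F_def S_lin algebra_simps)

lemma S_bound: "\<exists>B\<ge>1. \<forall>g\<in>C0 v \<sigma>. \<forall>e. (\<forall>p. \<bar>g p\<bar> \<le> e) \<longrightarrow> (\<forall>p. \<bar>S \<sigma> g p\<bar> \<le> B * e)"
proof -
  obtain B where B: "\<forall>g\<in>C0 v \<sigma>. sup_norm (S \<sigma> g) \<le> B * sup_norm g"
    using cond_a[of \<sigma>] by (auto simp: cond_a_def bounded_op_def)
  have "\<bar>S \<sigma> g p\<bar> \<le> max 1 B * e" if g: "g \<in> C0 v \<sigma>" and e: "\<forall>p. \<bar>g p\<bar> \<le> e" for g e p
  proof -
    have "0 \<le> \<bar>g p\<bar>" by simp
    also have "\<bar>g p\<bar> \<le> sup_norm g" by (rule abs_le_sup_norm[OF g])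
    finally have n: "0 \<le> sup_norm g" .
    have "\<bar>S \<sigma> g p\<bar> \<le> sup_norm (S \<sigma> g)" by (rule abs_le_sup_norm[OF S_C0[OF g]])
    also have "\<dots> \<le> B * sup_norm g" using B g by blast
    also have "\<dots> \<le> max 1 B * sup_norm g" using n by (intro mult_right_mono) auto
    also have "\<dots> \<le> max 1 B * e" using e by (intro mult_left_mono sup_norm_le) auto
    finally show ?thesis .
  qed
  thus ?thesis by (intro exI[of _ "max 1 B"]) (simp del: split_paired_All)
qed

text \<open>
  A bound for the operator norm of \<open>F \<sigma>\<close>. The summand \<open>CF \<sigma> - 1\<close> bounds \<open>S \<sigma>\<close> and is at least \<open>1\<close>, which
  keeps \<open>CF \<sigma>\<close> away from \<open>0\<close>.
\<close>

definition CF :: "pm \<Rightarrow> real" where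
  "CF \<sigma> = 1 + (SOME B. B \<ge> 1 \<and> (\<forall>g\<in>C0 v \<sigma>. \<forall>e. (\<forall>p. \<bar>g p\<bar> \<le> e) \<longrightarrow> (\<forall>p. \<bar>S \<sigma> g p\<bar> \<le> B * e)))"

lemma CF_props:
  shows CF_ge: "CF \<sigma> \<ge> 2"
    and S_le: "g \<in> C0 v \<sigma> \<Longrightarrow> (\<And>p. \<bar>g p\<bar> \<le> e) \<Longrightarrow> \<bar>S \<sigma> g p\<bar> \<le> (CF \<sigma> - 1) * e"
    and F_le: "g \<in> C0 v \<sigma> \<Longrightarrow> (\<And>p. \<bar>g p\<bar> \<le> e) \<Longrightarrow> \<bar>F \<sigma> g p\<bar> \<le> CF \<sigma> * e"
proof -
  from someI_ex[OF S_bound[of \<sigma>]]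
  have 1: "CF \<sigma> - 1 \<ge> 1" and 2: "\<forall>g\<in>C0 v \<sigma>. \<forall>e. (\<forall>p. \<bar>g p\<bar> \<le> e) \<longrightarrow> (\<forall>p. \<bar>S \<sigma> g p\<bar> \<le> (CF \<sigma> - 1) * e)"
    unfolding CF_def by (simp_all del: split_paired_All)
  show "CF \<sigma> \<ge> 2" using 1 by simp
  show 3: "\<bar>S \<sigma> g p\<bar> \<le> (CF \<sigma> - 1) * e" if "g \<in> C0 v \<sigma>" "\<And>p. \<bar>g p\<bar> \<le> e" for g e p
    using 2[rule_format, OF that(1), of e p] that(2) by simp
  show "\<bar>F \<sigma> g p\<bar> \<le> CF \<sigma> * e" if g: "g \<in> C0 v \<sigma>" "\<And>p. \<bar>g p\<bar> \<le> e" for g e p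
  proof -
    have "\<bar>F \<sigma> g p\<bar> \<le> \<bar>g p\<bar> + \<bar>S \<sigma> g p\<bar>" by (simp add: F_def abs_triangle_ineq)
    also have "\<dots> \<le> e + (CF \<sigma> - 1) * e" by (intro add_mono g(2) 3[OF g])
    finally show ?thesis by (simp add: algebra_simps)
  qed
qed

lemma F_section_continuous: "g \<in> C0 v \<sigma> \<Longrightarrow> continuous_on {0..} (\<lambda>s. F \<sigma> g (ereal s, Some i))"
  unfolding F_def by (intro continuous_intros C0_section(1)[of g] C0_section(1)[OF S_C0])

lemma Q_facts:
  assumes "l \<ge> 0" "f \<in> C0 v \<sigma>"
  shows Q_C0: "Q \<sigma> l f \<in> C0 v \<sigma>"
    and Q_0: "Q \<sigma> 0 f = f"
    and Q_add: "k \<ge> 0 \<Longrightarrow> Q \<sigma> (k + l) f = Q \<sigma> k (Q \<sigma> l f)"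
    and Q_sc: "uniform_limit UNIV (\<lambda>l. Q \<sigma> l f) f (at_right 0)"
    and Q_lin: "g \<in> C0 v \<sigma> \<Longrightarrow> Q \<sigma> l (\<lambda>p. a * f p + b * g p) = (\<lambda>p. a * Q \<sigma> l f p + b * Q \<sigma> l g p)"
  using assms cond_b[of \<sigma>] linear_comb[of \<sigma> "C0 v \<sigma>" "Q \<sigma> l" f g a b]
  unfolding cond_b_def sc_pos_contr_semigroup_def linear_op_def[of _ _ "Q \<sigma> l" for l]
  by simp_all

lemma Q_le:
  assumes "l \<ge> 0" "f \<in> C0 v \<sigma>" "\<And>p. \<bar>f p\<bar> \<le> e"
  shows "\<bar>Q \<sigma> l f p\<bar> \<le> e"
proof -
  have "\<bar>Q \<sigma> l f p\<bar> \<le> sup_norm (Q \<sigma> l f)" by (rule abs_le_sup_norm[OF Q_C0[OF assms(1,2)]])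
  also have "\<dots> \<le> sup_norm f"
    using cond_b[of \<sigma>] assms unfolding cond_b_def sc_pos_contr_semigroup_def by blast
  also have "\<dots> \<le> e" by (rule sup_norm_le) (rule assms)
  finally show ?thesis .
qed

lemma C01_C0: "g \<in> C01 v \<sigma> \<Longrightarrow> g \<in> C0 v \<sigma>" by (simp add: C01_def)

lemma H_limit: "g \<in> C01 v \<sigma> \<Longrightarrow> uniform_limit UNIV (\<lambda>l p. (Q \<sigma> l g p - g p) / l) (H \<sigma> g) (at_right 0)"
  using cond_b[of \<sigma>] unfolding cond_b_def strong_generator_def by blast

lemma C01_from_limit:
  assumes "g \<in> C0 v \<sigma>" "uniform_limit UNIV (\<lambda>l p. (Q \<sigma> l g p - g p) / l) h (at_right 0)"
  shows "g \<in> C01 v \<sigma>" "H \<sigma> g = h"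
proof -
  have "C01 v \<sigma> = {g \<in> C0 v \<sigma>. \<exists>h. uniform_limit UNIV (\<lambda>l p. (Q \<sigma> l g p - g p) / l) h (at_right 0)}"
    using cond_b[of \<sigma>] unfolding cond_b_def strong_generator_def by blast
  thus g: "g \<in> C01 v \<sigma>" using assms by blast
  show "H \<sigma> g = h"
  proof
    fix p show "H \<sigma> g p = h p"
      by (rule tendsto_unique[OF _ tendsto_uniform_limitI[OF H_limit[OF g]] tendsto_uniform_limitI[OF assms(2)]])
        simp_all
  qed
qed

lemma C0_diff_quot:
  assumes "f \<in> C0 v \<sigma>" "g \<in> C0 v \<sigma>" shows "(\<lambda>p. (f p - g p) / l) \<in> C0 v \<sigma>"
  using C0_lin[OF assms, of "1/l" "-1/l"] by (simp add: diff_divide_distrib)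

lemma H_C0: assumes g: "g \<in> C01 v \<sigma>" shows "H \<sigma> g \<in> C0 v \<sigma>"
proof (rule C0_uniform_limit[OF _ H_limit[OF g]])
  show "eventually (\<lambda>l. (\<lambda>p. (Q \<sigma> l g p - g p) / l) \<in> C0 v \<sigma>) (at_right 0)"
    using eventually_at_right_less[of 0]
    by (rule eventually_mono) (intro C0_diff_quot Q_C0 C01_C0 g less_imp_le)
qed simp

text \<open>
  The difference quotient at \<open>k\<close> is the image under the contraction \<open>Q \<sigma> k\<close> of the quotient at \<open>0\<close>.
\<close>

lemma Q_right_deriv:
  assumes g: "g \<in> C01 v \<sigma>" and k: "k \<ge> 0"
  shows "uniform_limit UNIV (\<lambda>l p. (Q \<sigma> (k + l) g p - Q \<sigma> k g p) / l) (Q \<sigma> k (H \<sigma> g)) (at_right 0)"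
proof (rule uniform_limit_abs_le)
  fix e :: real assume "e > 0"
  show "eventually (\<lambda>l. \<forall>p. \<bar>(Q \<sigma> (k + l) g p - Q \<sigma> k g p) / l - Q \<sigma> k (H \<sigma> g) p\<bar> \<le> e) (at_right 0)"
    using uniform_limit_abs_leD[OF H_limit[OF g] \<open>e > 0\<close>] eventually_at_right_less[of 0]
  proof eventually_elim
    case (elim l)
    have Ql: "Q \<sigma> l g \<in> C0 v \<sigma>" and g0: "g \<in> C0 v \<sigma>" using elim g by (auto intro: Q_C0 C01_C0)
    have e: "(Q \<sigma> (k + l) g p - Q \<sigma> k g p) / l - Q \<sigma> k (H \<sigma> g) p
       = Q \<sigma> k (\<lambda>p. 1 * ((Q \<sigma> l g p - g p) / l) + (-1) * H \<sigma> g p) p" for p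
    proof -
      have "Q \<sigma> k (\<lambda>p. (Q \<sigma> l g p - g p) / l) = (\<lambda>p. (Q \<sigma> k (Q \<sigma> l g) p - Q \<sigma> k g p) / l)"
        using Q_lin[OF k Ql g0, of "1/l" "-1/l"] by (simp add: diff_divide_distrib)
      thus ?thesis unfolding Q_lin[OF k C0_diff_quot[OF Ql g0] H_C0[OF g]]
        using Q_add[OF _ g0 k, of l] elim by simp
    qed
    show ?case unfolding e
      by (intro allI Q_le k C0_lin C0_diff_quot Ql g0 H_C0 g) (use elim in \<open>simp del: split_paired_All\<close>)
  qed
qed

lemma Q_C01: assumes g: "g \<in> C01 v \<sigma>" and k: "k \<ge> 0"
  shows "Q \<sigma> k g \<in> C01 v \<sigma>" "H \<sigma> (Q \<sigma> k g) = Q \<sigma> k (H \<sigma> g)"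
proof -
  have "uniform_limit UNIV (\<lambda>l p. (Q \<sigma> l (Q \<sigma> k g) p - Q \<sigma> k g p) / l) (Q \<sigma> k (H \<sigma> g)) (at_right 0)"
  proof (rule uniform_limit_abs_le)
    fix e :: real assume "e > 0"
    show "eventually (\<lambda>l. \<forall>p. \<bar>(Q \<sigma> l (Q \<sigma> k g) p - Q \<sigma> k g p) / l - Q \<sigma> k (H \<sigma> g) p\<bar> \<le> e) (at_right 0)"
      using uniform_limit_abs_leD[OF Q_right_deriv[OF g k] \<open>e > 0\<close>] eventually_at_right_less[of 0]
    proof eventually_elim
      case (elim l)
      thus ?case using Q_add[OF k C01_C0[OF g], of l] by (simp add: add.commute del: split_paired_All)
    qed
  qed
  from C01_from_limit[OF Q_C0[OF k C01_C0[OF g]] this]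
  show "Q \<sigma> k g \<in> C01 v \<sigma>" "H \<sigma> (Q \<sigma> k g) = Q \<sigma> k (H \<sigma> g)" by auto
qed

text \<open>
  Here the quotient is the image under \<open>Q \<sigma> (k - l)\<close>, which moves with \<open>l\<close>; strong continuity, applied to
  \<open>H \<sigma> g\<close>, replaces \<open>Q \<sigma> (k - l) (H \<sigma> g)\<close> by \<open>Q \<sigma> k (H \<sigma> g)\<close>.
\<close>

lemma Q_left_deriv:
  assumes g: "g \<in> C01 v \<sigma>" and k: "k > 0"
  shows "uniform_limit UNIV (\<lambda>l p. (Q \<sigma> (k - l) g p - Q \<sigma> k g p) / l) (\<lambda>p. - Q \<sigma> k (H \<sigma> g) p) (at_right 0)"
proof (rule uniform_limit_abs_le)
  fix e :: real assume "e > 0"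
  hence e2: "e/2 > 0" by simp
  have g0: "g \<in> C0 v \<sigma>" and Hg: "H \<sigma> g \<in> C0 v \<sigma>" using g by (auto intro: C01_C0 H_C0)
  show "eventually (\<lambda>l. \<forall>p. \<bar>(Q \<sigma> (k - l) g p - Q \<sigma> k g p) / l - - Q \<sigma> k (H \<sigma> g) p\<bar> \<le> e) (at_right 0)"
    using uniform_limit_abs_leD[OF H_limit[OF g] e2] eventually_at_right_less[of 0]
      uniform_limit_abs_leD[OF Q_sc[OF order_refl Hg] e2] eventually_at_right_real[OF k]
  proof eventually_elim
    case (elim l)
    hence l: "0 < l" "l < k" "k - l \<ge> 0" by auto
    have Ql: "Q \<sigma> l f \<in> C0 v \<sigma>" "Q \<sigma> (k - l) (Q \<sigma> l f) = Q \<sigma> k f" if "f \<in> C0 v \<sigma>" for f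
      using l Q_C0[of l f \<sigma>] Q_add[of l f \<sigma> "k - l"] that by auto
    have e: "(Q \<sigma> (k - l) g p - Q \<sigma> k g p) / l - - Q \<sigma> k (H \<sigma> g) p
       = Q \<sigma> (k - l) (\<lambda>p. (-1) * ((Q \<sigma> l g p - g p) / l) + 1 * Q \<sigma> l (H \<sigma> g) p) p" for p
    proof -
      have "Q \<sigma> (k - l) (\<lambda>p. (Q \<sigma> l g p - g p) / l) = (\<lambda>p. (Q \<sigma> k g p - Q \<sigma> (k - l) g p) / l)"
        using Q_lin[OF l(3) Ql(1)[OF g0] g0, of "1/l" "-1/l"] Ql(2)[OF g0] by (simp add: diff_divide_distrib)
      thus ?thesis unfolding Q_lin[OF l(3) C0_diff_quot[OF Ql(1)[OF g0] g0] Ql(1)[OF Hg]]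
        using Ql(2)[OF Hg] l by (simp add: field_simps)
    qed
    have b: "\<bar>(-1) * ((Q \<sigma> l g p - g p) / l) + 1 * Q \<sigma> l (H \<sigma> g) p\<bar> \<le> e" for p
    proof -
      have "\<bar>(Q \<sigma> l g p - g p) / l - H \<sigma> g p\<bar> \<le> e/2" "\<bar>Q \<sigma> l (H \<sigma> g) p - H \<sigma> g p\<bar> \<le> e/2"
        by (rule spec[OF elim(1)], rule spec[OF elim(3)])
      thus ?thesis by linarith
    qed
    show ?case unfolding e
      by (intro allI Q_le l C0_lin C0_diff_quot Ql g0 Hg b)
  qed
qed

text \<open>
  Along a path in state \<open>j\<close> the level parameter changes at rate \<open>- w\<close>, of either sign, so both one-sided
  derivatives are needed.
\<close>

lemma Q_direction_deriv:
  assumes g: "g \<in> C01 v \<sigma>" and k: "k > 0" and w: "w \<noteq> 0"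
  shows "uniform_limit UNIV (\<lambda>h p. (Q \<sigma> (k - h * w) g p - Q \<sigma> k g p) / h) (\<lambda>p. - w * Q \<sigma> k (H \<sigma> g) p) (at_right 0)"
proof (rule uniform_limit_abs_le)
  fix e :: real assume "e > 0"
  hence e2: "e / \<bar>w\<bar> > 0" using w by simp
  have fl: "filterlim (\<lambda>h. h * \<bar>w\<bar>) (at_right 0) (at_right (0::real))"
    using w by (auto simp: filterlim_at intro!: tendsto_eq_intros eventually_mono[OF eventually_at_right_less[of 0]])
  show "eventually (\<lambda>h. \<forall>p. \<bar>(Q \<sigma> (k - h * w) g p - Q \<sigma> k g p) / h - - w * Q \<sigma> k (H \<sigma> g) p\<bar> \<le> e) (at_right 0)"
  proof (cases "w > 0")
    case True
    show ?thesis
      using eventually_compose_filterlim[OF uniform_limit_abs_leD[OF Q_left_deriv[OF g k] e2] fl] eventually_at_right_less[of 0]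
    proof eventually_elim
      case (elim h)
      show ?case
      proof
        fix p
        have a: "\<bar>(Q \<sigma> (k - h * \<bar>w\<bar>) g p - Q \<sigma> k g p) / (h * \<bar>w\<bar>) - - Q \<sigma> k (H \<sigma> g) p\<bar> \<le> e / \<bar>w\<bar>"
          using elim(1) by (rule spec)
        have "(Q \<sigma> (k - h * w) g p - Q \<sigma> k g p) / h - - w * Q \<sigma> k (H \<sigma> g) p
          = w * ((Q \<sigma> (k - h * \<bar>w\<bar>) g p - Q \<sigma> k g p) / (h * \<bar>w\<bar>) - - Q \<sigma> k (H \<sigma> g) p)"
          using True elim by (simp add: field_simps)
        hence "\<bar>(Q \<sigma> (k - h * w) g p - Q \<sigma> k g p) / h - - w * Q \<sigma> k (H \<sigma> g) p\<bar> \<le> \<bar>w\<bar> * (e / \<bar>w\<bar>)"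
          using a by (simp only: abs_mult mult_left_mono abs_ge_zero)
        thus "\<bar>(Q \<sigma> (k - h * w) g p - Q \<sigma> k g p) / h - - w * Q \<sigma> k (H \<sigma> g) p\<bar> \<le> e" using w by simp
      qed
    qed
  next
    case False
    show ?thesis
      using eventually_compose_filterlim[OF uniform_limit_abs_leD[OF Q_right_deriv[OF g less_imp_le[OF k]] e2] fl] eventually_at_right_less[of 0]
    proof eventually_elim
      case (elim h)
      show ?case
      proof
        fix p
        have a: "\<bar>(Q \<sigma> (k + h * \<bar>w\<bar>) g p - Q \<sigma> k g p) / (h * \<bar>w\<bar>) - Q \<sigma> k (H \<sigma> g) p\<bar> \<le> e / \<bar>w\<bar>"
          using elim(1) by (rule spec)
        have "(Q \<sigma> (k - h * w) g p - Q \<sigma> k g p) / h - - w * Q \<sigma> k (H \<sigma> g) p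
          = \<bar>w\<bar> * ((Q \<sigma> (k + h * \<bar>w\<bar>) g p - Q \<sigma> k g p) / (h * \<bar>w\<bar>) - Q \<sigma> k (H \<sigma> g) p)"
          using False w elim by (simp add: field_simps)
        hence "\<bar>(Q \<sigma> (k - h * w) g p - Q \<sigma> k g p) / h - - w * Q \<sigma> k (H \<sigma> g) p\<bar> \<le> \<bar>w\<bar> * (e / \<bar>w\<bar>)"
          using a by (simp only: abs_mult mult_left_mono abs_ge_zero abs_abs)
        thus "\<bar>(Q \<sigma> (k - h * w) g p - Q \<sigma> k g p) / h - - w * Q \<sigma> k (H \<sigma> g) p\<bar> \<le> e" using w by simp
      qed
    qed
  qed
qed

section \<open>The space-time function along characteristics\<close>

lemma zero_C01: "(\<lambda>p. 0) \<in> C01 v \<sigma>"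
  by (rule C01I[where D = "\<lambda>_ _. 0"]) (auto simp: C0_iff)

lemma S_zero: "S \<sigma> (\<lambda>p. 0) = (\<lambda>p. 0)"
  using S_lin[OF C01_C0[OF zero_C01] C01_C0[OF zero_C01], where a = 0 and b = 0 and \<sigma> = \<sigma>] by simp

lemma Q_zero: "l \<ge> 0 \<Longrightarrow> Q \<sigma> l (\<lambda>p. 0) = (\<lambda>p. 0)"
  using Q_lin[OF _ C01_C0[OF zero_C01] C01_C0[OF zero_C01], where a = 0 and b = 0 and \<sigma> = \<sigma>] by simp

lemma H_zero: "H \<sigma> (\<lambda>p. 0) = (\<lambda>p. 0)"
proof (rule C01_from_limit)
  show "uniform_limit UNIV (\<lambda>l p. (Q \<sigma> l (\<lambda>p. 0) p - 0) / l) (\<lambda>p. 0) (at_right 0)"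
    by (rule uniform_limit_abs_le, rule eventually_mono[OF eventually_at_right_less[of 0]])
      (simp add: Q_zero)
qed (rule C01_C0[OF zero_C01])

text \<open>
  With one of the two components equal to zero the block equation decouples into an equation for \<open>F \<sigma>\<close>
  alone.
\<close>

lemma block_op_F:
  assumes f: "f \<in> C0 v \<sigma>"
  shows "block_op v S (if \<sigma> = Plus then f else (\<lambda>p. 0)) (if \<sigma> = Minus then f else (\<lambda>p. 0)) = F \<sigma> f"
proof
  fix p
  have nf: "p \<notin> X_pm v \<sigma> \<Longrightarrow> f p = 0" by (rule C0_zero_off[OF f])
  have nS: "p \<notin> X_pm v (opp \<sigma>) \<Longrightarrow> S \<sigma> f p = 0" by (rule C0_zero_off[OF S_C0[OF f]])
  have disj: "p \<in> X_pm v Plus \<Longrightarrow> p \<notin> X_pm v Minus" by (auto simp: X_pm_def)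
  show "block_op v S (if \<sigma> = Plus then f else (\<lambda>p. 0)) (if \<sigma> = Minus then f else (\<lambda>p. 0)) p = F \<sigma> f p"
  proof (cases \<sigma>)
    case Plus
    thus ?thesis using nf nS disj by (auto simp: block_op_def F_def S_zero Xbar_pm_def X_pm_def)
  next
    case Minus
    thus ?thesis using nf nS disj by (auto simp: block_op_def F_def S_zero Xbar_pm_def X_pm_def)
  qed
qed

text \<open>
  The decoupled equation \<open>(d/ds + \<Lambda>) (F g) = w F (H g)\<close>, solved for the time derivative. For \<open>Minus\<close> the sign in
  front of \<open>H\<close> in the block equation is absorbed by the sign in \<open>speed\<close>.
\<close>

lemma F_deriv:
  assumes g: "g \<in> C01 v \<sigma>" and t: "t \<ge> 0"
  shows "((\<lambda>u. F \<sigma> g (ereal u, Some j)) has_real_derivative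
      speed v \<sigma> j * F \<sigma> (H \<sigma> g) (ereal t, Some j) - (\<Sum>i\<in>UNIV. \<Lambda> t $ j $ i * F \<sigma> g (ereal t, Some i)))
      (at t within {0..})"
proof -
  define p where "p = (ereal t, Some j)"
  define D where "D = ds g p + ds (S \<sigma> g) p"
  have der: "((\<lambda>u. F \<sigma> g (ereal u, Some j)) has_real_derivative D) (at t within {0..})"
    unfolding F_def D_def p_def by (intro DERIV_add C01_deriv[OF g t] C01_deriv[OF S_C01[OF g] t])
  have D: "ds (F \<sigma> g) p = D" unfolding p_def by (rule ds_eqI[OF der t])
  have pX: "p \<in> Xbar_full" using t by (auto simp: p_def Xbar_full_def X_full_def)
  define gp where "gp = (if \<sigma> = Plus then g else (\<lambda>p. 0))"
  define gm where "gm = (if \<sigma> = Minus then g else (\<lambda>p. 0))"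
  have gpm: "gp \<in> C01 v Plus" "gm \<in> C01 v Minus" using g zero_C01 by (auto simp: gp_def gm_def)
  have bl: "block_op v S gp gm = F \<sigma> g" unfolding gp_def gm_def by (rule block_op_F[OF C01_C0[OF g]])
  have Hg: "H \<sigma> g \<in> C0 v \<sigma>" by (rule H_C0[OF g])
  define s :: real where "s = (if \<sigma> = Plus then 1 else -1)"
  have "block_op v S (H Plus gp) (\<lambda>q. - H Minus gm q) = F \<sigma> (\<lambda>p. s * H \<sigma> g p + 0 * H \<sigma> g p)"
  proof (cases \<sigma>)
    case Plus
    thus ?thesis using block_op_F[of "H \<sigma> g" \<sigma>] Hg by (simp add: gp_def gm_def H_zero s_def)
  next
    case Minus
    have "(\<lambda>p. - H \<sigma> g p) \<in> C0 v \<sigma>" using C0_lin[OF Hg Hg, of "-1" 0] by simp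
    from block_op_F[OF this] Minus show ?thesis by (simp add: gp_def gm_def H_zero s_def)
  qed
  hence br: "block_op v S (H Plus gp) (\<lambda>q. - H Minus gm q) p = s * F \<sigma> (H \<sigma> g) p"
    using F_lin[OF Hg Hg, of s 0 p] by simp
  have "V_inv v (\<lambda>q. ds (block_op v S gp gm) q + Lambda_op \<Lambda> (block_op v S gp gm) q) p =
        block_op v S (H Plus gp) (\<lambda>q. - H Minus gm q) p"
    by (rule wh[unfolded wiener_hopf_eq_def, THEN bspec, OF gpm(1), THEN bspec, OF gpm(2), THEN bspec, OF pX])
  hence "inverse (v (Some j)) * (D + Lambda_op \<Lambda> (F \<sigma> g) p) = s * F \<sigma> (H \<sigma> g) p"
    unfolding bl br V_inv_def D by (simp add: p_def)
  hence "D + Lambda_op \<Lambda> (F \<sigma> g) p = speed v \<sigma> j * F \<sigma> (H \<sigma> g) p"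
    using v_nz[of j] by (cases \<sigma>) (auto simp: field_simps s_def speed_def)
  moreover have "Lambda_op \<Lambda> (F \<sigma> g) p = (\<Sum>i\<in>UNIV. \<Lambda> t $ j $ i * F \<sigma> g (ereal t, Some i))"
    using t by (simp add: Lambda_op_def p_def matrix_vector_mult_def)
  ultimately have "D = speed v \<sigma> j * F \<sigma> (H \<sigma> g) (ereal t, Some j) - (\<Sum>i\<in>UNIV. \<Lambda> t $ j $ i * F \<sigma> g (ereal t, Some i))"
    by (simp add: p_def)
  with der show ?thesis by simp
qed

text \<open>
  The function \<open>u(k, t, j)\<close> whose value along \<open>(\<kappa> - \<phi>, t, X)\<close> is a martingale. Its constant
  continuation to \<open>k < 0\<close> makes it Lipschitz on the whole line.
\<close>

definition U :: "pm \<Rightarrow> 'e xfun \<Rightarrow> real \<Rightarrow> real \<Rightarrow> 'e \<Rightarrow> real" where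
  "U \<sigma> g k t j = F \<sigma> (Q \<sigma> (max 0 k) g) (ereal t, Some j)"

lemma U_bounded:
  assumes g: "g \<in> C0 v \<sigma>"
  shows "\<bar>U \<sigma> g k t j\<bar> \<le> CF \<sigma> * sup_norm g"
  unfolding U_def by (intro F_le Q_C0 Q_le abs_le_sup_norm[OF g] g) simp_all

lemma speed_nz: "speed v \<sigma> j \<noteq> 0"
  using v_nz by (cases \<sigma>) (auto simp: speed_def)

text \<open>
  For small \<open>l\<close> the quotient is close to \<open>H \<sigma> g\<close>; for \<open>l \<ge> d\<close> the crude bound \<open>2 \<parallel>g\<parallel> \<le> (2 \<parallel>g\<parallel> / d) l\<close> suffices.
\<close>

lemma Q_lipschitz:
  assumes g: "g \<in> C01 v \<sigma>"
  shows "\<exists>L\<ge>0. \<forall>k\<ge>0. \<forall>l\<ge>0. \<forall>p. \<bar>Q \<sigma> (k + l) g p - Q \<sigma> k g p\<bar> \<le> L * l"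
proof -
  have g0: "g \<in> C0 v \<sigma>" by (rule C01_C0[OF g])
  define N where "N = sup_norm (H \<sigma> g) + 1"
  have HN: "\<bar>H \<sigma> g p\<bar> \<le> N - 1" for p unfolding N_def using abs_le_sup_norm[OF H_C0[OF g]] by simp
  have N: "N \<ge> 1" using HN[of undefined] by simp
  have gn: "\<bar>g p\<bar> \<le> sup_norm g" for p by (rule abs_le_sup_norm[OF g0])
  have gn0: "sup_norm g \<ge> 0" using gn[of undefined] by simp
  obtain d where "d > 0" and d': "\<forall>l>0. l < d \<longrightarrow> (\<forall>p. \<bar>(Q \<sigma> l g p - g p) / l - H \<sigma> g p\<bar> \<le> 1)"
    using uniform_limit_abs_leD[OF H_limit[OF g] zero_less_one]
    unfolding eventually_at_right_field by (elim exE conjE)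
  note d = \<open>d > 0\<close> d'[rule_format]
  define L where "L = N + 2 * sup_norm g / d"
  have Ql: "\<bar>Q \<sigma> l g p - g p\<bar> \<le> L * l" if "l \<ge> 0" for l p
  proof -
    consider "l = 0" | "0 < l" "l < d" | "l \<ge> d" using \<open>l \<ge> 0\<close> by linarith
    thus ?thesis
    proof cases
      case 1 thus ?thesis using Q_0[OF order_refl g0] by simp
    next
      case 2
      have "\<bar>(Q \<sigma> l g p - g p) / l\<bar> \<le> N" using d(2)[OF 2, where p = p] HN[of p] by linarith
      hence "\<bar>Q \<sigma> l g p - g p\<bar> \<le> N * l" using 2 by (simp add: abs_divide divide_le_eq)
      also have "\<dots> \<le> L * l" using 2 d gn0 by (intro mult_right_mono) (auto simp: L_def)
      finally show ?thesis .
    next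
      case 3
      have "\<bar>Q \<sigma> l g p - g p\<bar> \<le> \<bar>Q \<sigma> l g p\<bar> + \<bar>g p\<bar>" by (rule abs_triangle_ineq4)
      also have "\<dots> \<le> sup_norm g + sup_norm g" by (intro add_mono Q_le g0 that gn)
      also have "\<dots> = 2 * sup_norm g / d * d" using d by simp
      also have "\<dots> \<le> L * l" using 3 d N gn0 by (intro mult_mono) (auto simp: L_def)
      finally show ?thesis .
    qed
  qed
  have "\<bar>Q \<sigma> (k + l) g p - Q \<sigma> k g p\<bar> \<le> L * l" if k: "k \<ge> 0" and l: "l \<ge> 0" for k l p
  proof -
    have "Q \<sigma> (k + l) g p - Q \<sigma> k g p = Q \<sigma> k (\<lambda>p. 1 * Q \<sigma> l g p + (-1) * g p) p"
      unfolding Q_lin[OF k Q_C0[OF l g0] g0] using Q_add[OF l g0 k] by simp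
    also have "\<bar>\<dots>\<bar> \<le> L * l"
      using Ql[OF l] by (intro Q_le k C0_lin Q_C0 l g0) simp
    finally show ?thesis .
  qed
  moreover have "L \<ge> 0" using N gn0 d by (simp add: L_def)
  ultimately show ?thesis by (intro exI[of _ L]) (simp del: split_paired_All)
qed

lemma \<Lambda>_bound: "\<exists>K>0. \<forall>t\<ge>0. \<forall>b\<ge>0. \<forall>u j. (\<forall>i. \<bar>u i\<bar> \<le> b) \<longrightarrow> \<bar>\<Sum>i\<in>UNIV. \<Lambda> t $ j $ i * u i\<bar> \<le> K * b"
proof -
  obtain K where K: "K > 0" "\<forall>s\<ge>0. \<forall>i j. \<bar>\<Lambda> s $ i $ j\<bar> \<le> K"
    using gen unfolding generator_family_def by (elim conjE exE)
  have "\<bar>\<Sum>i\<in>UNIV. \<Lambda> t $ j $ i * u i\<bar> \<le> (real CARD('e) * K) * b" if "t \<ge> 0" "\<forall>i. \<bar>u i\<bar> \<le> b" "b \<ge> 0" for t b u j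
  proof -
    have "\<bar>\<Sum>i\<in>UNIV. \<Lambda> t $ j $ i * u i\<bar> \<le> (\<Sum>i\<in>(UNIV::'e set). K * b)"
      by (rule order_trans[OF sum_abs sum_mono]) (use that K in \<open>auto simp: abs_mult intro!: mult_mono\<close>)
    thus ?thesis by simp
  qed
  thus ?thesis using K by (intro exI[of _ "real CARD('e) * K"]) simp
qed

text \<open>
  In the time variable the derivative is read off from the equation, which bounds it by \<open>H\<close> and \<open>\<Lambda>\<close>
  uniformly in the level.
\<close>

lemma U_lipschitz:
  assumes g: "g \<in> C01 v \<sigma>"
  shows "\<exists>L\<ge>0. \<forall>k k' t t' j. t \<ge> 0 \<longrightarrow> t' \<ge> 0 \<longrightarrow> \<bar>U \<sigma> g k t j - U \<sigma> g k' t' j\<bar> \<le> L * (\<bar>k - k'\<bar> + \<bar>t - t'\<bar>)"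
proof -
  have g0: "g \<in> C0 v \<sigma>" by (rule C01_C0[OF g])
  obtain L where L: "L \<ge> 0" "\<And>k l p. k \<ge> 0 \<Longrightarrow> l \<ge> 0 \<Longrightarrow> \<bar>Q \<sigma> (k + l) g p - Q \<sigma> k g p\<bar> \<le> L * l"
    using Q_lipschitz[OF g] by (elim exE conjE) (erule that, simp del: split_paired_All)
  have a: "\<bar>F \<sigma> (Q \<sigma> (k + l) g) p - F \<sigma> (Q \<sigma> k g) p\<bar> \<le> CF \<sigma> * (L * l)" if k: "k \<ge> 0" and l: "l \<ge> 0" for k l p
  proof -
    have kl: "k + l \<ge> 0" using that by simp
    have "F \<sigma> (Q \<sigma> (k + l) g) p - F \<sigma> (Q \<sigma> k g) p = F \<sigma> (\<lambda>p. 1 * Q \<sigma> (k + l) g p + (-1) * Q \<sigma> k g p) p"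
      unfolding F_lin[OF Q_C0[OF kl g0] Q_C0[OF k g0]] by simp
    also have "\<bar>\<dots>\<bar> \<le> CF \<sigma> * (L * l)"
      using L(2)[OF k l] by (intro F_le C0_lin Q_C0 kl k g0) simp
    finally show ?thesis .
  qed
  have 1: "\<bar>U \<sigma> g k t j - U \<sigma> g k' t j\<bar> \<le> CF \<sigma> * L * \<bar>k - k'\<bar>" for k k' t j
  proof -
    define m where "m = min (max 0 k) (max 0 k')"
    define l where "l = \<bar>max 0 k - max 0 k'\<bar>"
    have ml: "m \<ge> 0" "l \<ge> 0" by (auto simp: m_def l_def)
    have "(m + l = max 0 k \<and> m = max 0 k') \<or> (m + l = max 0 k' \<and> m = max 0 k)" unfolding m_def l_def by linarith
    hence "\<bar>U \<sigma> g k t j - U \<sigma> g k' t j\<bar> \<le> CF \<sigma> * (L * l)"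
      using a[OF ml, of "(ereal t, Some j)"] unfolding U_def by (auto simp: abs_minus_commute)
    also have "\<dots> \<le> CF \<sigma> * (L * \<bar>k - k'\<bar>)"
      using CF_ge[of \<sigma>] L(1) by (intro mult_left_mono) (auto simp: l_def)
    finally show ?thesis by (simp add: mult.assoc)
  qed
  obtain K where K: "K > 0" "\<And>t b u j. t \<ge> 0 \<Longrightarrow> b \<ge> 0 \<Longrightarrow> (\<forall>i. \<bar>u i\<bar> \<le> b) \<Longrightarrow> \<bar>\<Sum>i\<in>UNIV. \<Lambda> t $ j $ i * u i\<bar> \<le> K * b"
    using \<Lambda>_bound by (elim exE conjE) (erule that, simp)
  define W where "W = (\<Sum>j\<in>UNIV. \<bar>speed v \<sigma> j\<bar>)"
  have W: "\<bar>speed v \<sigma> j\<bar> \<le> W" for j unfolding W_def by (rule member_le_sum) auto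
  define b where "b = CF \<sigma> * sup_norm g"
  define b' where "b' = CF \<sigma> * sup_norm (H \<sigma> g)"
  have b: "\<bar>F \<sigma> (Q \<sigma> k g) p\<bar> \<le> b" if "k \<ge> 0" for k p
    unfolding b_def by (intro F_le Q_C0 Q_le abs_le_sup_norm[OF g0] g0 that)
  have b': "\<bar>F \<sigma> (H \<sigma> (Q \<sigma> k g)) p\<bar> \<le> b'" if "k \<ge> 0" for k p
    unfolding b'_def Q_C01(2)[OF g that] by (intro F_le Q_C0 Q_le abs_le_sup_norm[OF H_C0[OF g]] H_C0 g that)
  have b0: "b \<ge> 0" using b[of 0 undefined] by linarith
  have 2: "\<bar>U \<sigma> g k t j - U \<sigma> g k t' j\<bar> \<le> (W * b' + K * b) * \<bar>t - t'\<bar>" if t: "t \<ge> 0" "t' \<ge> 0" for k t t' j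
  proof -
    define q where "q = Q \<sigma> (max 0 k) g"
    have q: "q \<in> C01 v \<sigma>" unfolding q_def by (rule Q_C01(1)[OF g]) simp
    have "norm (F \<sigma> q (ereal t, Some j) - F \<sigma> q (ereal t', Some j)) \<le> (W * b' + K * b) * norm (t - t')"
    proof (rule field_differentiable_bound[where S = "{0..}"])
      fix z :: real assume "z \<in> {0..}"
      hence z: "z \<ge> 0" by simp
      show "((\<lambda>u. F \<sigma> q (ereal u, Some j)) has_field_derivative speed v \<sigma> j * F \<sigma> (H \<sigma> q) (ereal z, Some j) - (\<Sum>i\<in>UNIV. \<Lambda> z $ j $ i * F \<sigma> q (ereal z, Some i)))
      (at z within {0..})" by (rule F_deriv[OF q z])
      have "\<bar>speed v \<sigma> j * F \<sigma> (H \<sigma> q) (ereal z, Some j)\<bar> \<le> W * b'"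
        unfolding abs_mult q_def by (intro mult_mono W b' order_trans[OF abs_ge_zero W]) auto
      moreover have "\<bar>\<Sum>i\<in>UNIV. \<Lambda> z $ j $ i * F \<sigma> q (ereal z, Some i)\<bar> \<le> K * b"
        unfolding q_def by (intro K(2) z b0 allI b) simp
      ultimately show "norm (speed v \<sigma> j * F \<sigma> (H \<sigma> q) (ereal z, Some j) - (\<Sum>i\<in>UNIV. \<Lambda> z $ j $ i * F \<sigma> q (ereal z, Some i))) \<le> W * b' + K * b"
        unfolding real_norm_def by linarith
    qed (use t in auto)
    thus ?thesis by (simp add: U_def q_def)
  qed
  define L' where "L' = max (CF \<sigma> * L) (W * b' + K * b)"
  have "\<bar>U \<sigma> g k t j - U \<sigma> g k' t' j\<bar> \<le> L' * (\<bar>k - k'\<bar> + \<bar>t - t'\<bar>)" if t: "t \<ge> 0" "t' \<ge> 0" for k k' t t' j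
  proof -
    have "\<bar>U \<sigma> g k t j - U \<sigma> g k' t' j\<bar> \<le> \<bar>U \<sigma> g k t j - U \<sigma> g k' t j\<bar> + \<bar>U \<sigma> g k' t j - U \<sigma> g k' t' j\<bar>" by linarith
    also have "\<dots> \<le> CF \<sigma> * L * \<bar>k - k'\<bar> + (W * b' + K * b) * \<bar>t - t'\<bar>" by (intro add_mono 1 2 t)
    also have "\<dots> \<le> L' * \<bar>k - k'\<bar> + L' * \<bar>t - t'\<bar>" unfolding L'_def by (intro add_mono mult_right_mono) auto
    finally show ?thesis by (simp add: distrib_left)
  qed
  moreover have "L' \<ge> 0" using L(1) CF_ge[of \<sigma>] by (auto simp: L'_def le_max_iff_disj)
  ultimately show ?thesis by blast
qed

text \<open>
  The heart of the analytic part. In the direction \<open>(- w, 1)\<close> of the motion of \<open>(k, t)\<close> while the process sits in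
  \<open>j\<close>, the two terms \<open>w F (H Q g)\<close> cancel and only the jump term is left. That term is what the Markov
  process compensates.
\<close>

lemma U_characteristic_deriv:
  assumes g: "g \<in> C01 v \<sigma>" and k: "k > 0" and t: "t \<ge> 0"
  shows "((\<lambda>h. (U \<sigma> g (k - h * speed v \<sigma> j) (t + h) j - U \<sigma> g k t j) / h) \<longlongrightarrow>
     - (\<Sum>i\<in>UNIV. \<Lambda> t $ j $ i * U \<sigma> g k t i)) (at_right 0)"
proof -
  define w where "w = speed v \<sigma> j"
  have w: "w \<noteq> 0" unfolding w_def by (rule speed_nz)
  define q where "q = Q \<sigma> k g"
  define Hq where "Hq = Q \<sigma> k (H \<sigma> g)"
  have q: "q \<in> C01 v \<sigma>" "H \<sigma> q = Hq" unfolding q_def Hq_def using Q_C01[OF g less_imp_le[OF k]] by auto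
  have q0: "q \<in> C0 v \<sigma>" by (rule C01_C0[OF q(1)])
  have Hq0: "Hq \<in> C0 v \<sigma>" using H_C0[OF q(1)] q(2) by simp
  let ?a = "\<lambda>h p. (F \<sigma> (Q \<sigma> (k - h * w) g) p - F \<sigma> q p) / h"
  have small: "eventually (\<lambda>h. k - h * w > 0) (at_right 0)"
  proof -
    have "((\<lambda>h. k - h * w) \<longlongrightarrow> k - 0 * w) (at_right 0)" by (intro tendsto_intros)
    thus ?thesis using k by (intro order_tendstoD) auto
  qed
  have ul: "uniform_limit UNIV ?a (\<lambda>p. - w * F \<sigma> Hq p) (at_right 0)"
  proof (rule uniform_limit_abs_le)
    fix e :: real assume "e > 0"
    define e' where "e' = e / CF \<sigma>"
    have e': "e' > 0" "CF \<sigma> * e' = e" using \<open>e > 0\<close> CF_ge[of \<sigma>] by (auto simp: e'_def)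
    show "eventually (\<lambda>h. \<forall>p. \<bar>?a h p - - w * F \<sigma> Hq p\<bar> \<le> e) (at_right 0)"
      using uniform_limit_abs_leD[OF Q_direction_deriv[OF g k w] e'(1)] small
    proof eventually_elim
      case (elim h)
      have Qh: "Q \<sigma> (k - h * w) g \<in> C0 v \<sigma>" using elim(2) by (intro Q_C0 C01_C0 g) simp
      have e: "?a h p - - w * F \<sigma> Hq p
        = F \<sigma> (\<lambda>p. 1 * ((Q \<sigma> (k - h * w) g p - q p) / h) + w * Hq p) p" for p
      proof -
        have "F \<sigma> (\<lambda>p. (Q \<sigma> (k - h * w) g p - q p) / h) p = ?a h p"
          using F_lin[OF Qh q0, of "1/h" "-1/h"] by (simp add: diff_divide_distrib)
        thus ?thesis unfolding F_lin[OF C0_diff_quot[OF Qh q0] Hq0] by simp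
      qed
      have "\<bar>1 * ((Q \<sigma> (k - h * w) g p - q p) / h) + w * Hq p\<bar> \<le> e'" for p
        using spec[OF elim(1), of p] by (simp add: q_def Hq_def)
      hence "\<bar>F \<sigma> (\<lambda>p. 1 * ((Q \<sigma> (k - h * w) g p - q p) / h) + w * Hq p) p\<bar> \<le> CF \<sigma> * e'" for p
        by (intro F_le C0_lin C0_diff_quot Qh q0 Hq0)
      thus ?case unfolding e e'(2) by (intro allI)
    qed
  qed
  have lim_at: "filterlim (\<lambda>h. t + h) (at t within {0..}) (at_right 0)"
    unfolding filterlim_at using t
    by (auto intro!: tendsto_eq_intros eventually_mono[OF eventually_at_right_less[of 0]])
  have 1: "((\<lambda>h. ?a h (ereal (t + h), Some j)) \<longlongrightarrow> - w * F \<sigma> Hq (ereal t, Some j)) (at_right 0)"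
  proof -
    have "((\<lambda>u. F \<sigma> Hq (ereal u, Some j)) \<longlongrightarrow> F \<sigma> Hq (ereal t, Some j)) (at t within {0..})"
      using F_section_continuous[OF Hq0] t by (simp add: continuous_on_def)
    from filterlim_compose[OF this lim_at]
    have "((\<lambda>h. (?a h (ereal (t + h), Some j) - (- w * F \<sigma> Hq (ereal (t + h), Some j))) + - w * F \<sigma> Hq (ereal (t + h), Some j))
        \<longlongrightarrow> 0 + - w * F \<sigma> Hq (ereal t, Some j)) (at_right 0)"
      by (intro tendsto_add uniform_limit_diagonal[OF ul] tendsto_mult tendsto_const)
    thus ?thesis by simp
  qed
  have 2: "((\<lambda>h. (F \<sigma> q (ereal (t + h), Some j) - F \<sigma> q (ereal t, Some j)) / h) \<longlongrightarrow>
      w * F \<sigma> Hq (ereal t, Some j) - (\<Sum>i\<in>UNIV. \<Lambda> t $ j $ i * F \<sigma> q (ereal t, Some i))) (at_right 0)"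
    using filterlim_compose[OF F_deriv[OF q(1) t, of j, unfolded has_field_derivative_iff q(2)] lim_at]
    by (simp add: w_def)
  have "((\<lambda>h. ?a h (ereal (t + h), Some j) + (F \<sigma> q (ereal (t + h), Some j) - F \<sigma> q (ereal t, Some j)) / h) \<longlongrightarrow>
      - (\<Sum>i\<in>UNIV. \<Lambda> t $ j $ i * F \<sigma> q (ereal t, Some i))) (at_right 0)"
    using tendsto_add[OF 1 2] by simp
  moreover have "eventually (\<lambda>h. ?a h (ereal (t + h), Some j) + (F \<sigma> q (ereal (t + h), Some j) - F \<sigma> q (ereal t, Some j)) / h
      = (U \<sigma> g (k - h * w) (t + h) j - U \<sigma> g k t j) / h) (at_right 0)"
    using small
  proof eventually_elim
    case (elim h)
    hence "U \<sigma> g (k - h * w) (t + h) j = F \<sigma> (Q \<sigma> (k - h * w) g) (ereal (t + h), Some j)"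
      "U \<sigma> g k t j = F \<sigma> q (ereal t, Some j)" using k by (simp_all add: U_def q_def)
    thus ?case by (simp add: diff_divide_distrib)
  qed
  ultimately have "((\<lambda>h. (U \<sigma> g (k - h * w) (t + h) j - U \<sigma> g k t j) / h) \<longlongrightarrow>
      - (\<Sum>i\<in>UNIV. \<Lambda> t $ j $ i * F \<sigma> q (ereal t, Some i))) (at_right 0)"
    by (rule Lim_transform_eventually)
  thus ?thesis using k by (simp add: w_def U_def q_def)
qed

section \<open>Propagation of supports\<close>

text \<open>
  The support condition on \<open>S\<close> gives vanishing beyond \<open>\<eta>\<close>; at \<open>\<eta>\<close> itself it follows by continuity.
\<close>

lemma S_local:
  assumes f: "f \<in> C0 v \<sigma>" and \<eta>: "\<eta> > 0"
    and z: "\<And>t i. t \<ge> \<eta> \<Longrightarrow> f (ereal t, Some i) = 0" and t: "t \<ge> \<eta>"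
  shows "S \<sigma> f (ereal t, Some j) = 0"
proof -
  have sub: "{u. f (ereal u, Some i) \<noteq> 0} \<subseteq> {0..\<eta>}" for i
  proof
    fix u assume "u \<in> {u. f (ereal u, Some i) \<noteq> 0}"
    hence nz: "f (ereal u, Some i) \<noteq> 0" by simp
    hence "(ereal u, Some i) \<in> X_pm v \<sigma>" using C0_zero_off[OF f] by blast
    hence "u \<ge> 0" by (auto simp: X_pm_def)
    moreover have "u < \<eta>" using nz z[of u i] by (meson not_le)
    ultimately show "u \<in> {0..\<eta>}" by simp
  qed
  have cl: "closure {u. f (ereal u, Some i) \<noteq> 0} \<subseteq> {0..\<eta>}" for i
    by (rule closure_minimal[OF sub]) simp
  have supp: "supp f \<subseteq> {0..\<eta>} \<times> E_pm v \<sigma>"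
  proof (rule subsetI, clarify)
    fix s i assume "(s, i) \<in> supp f"
    hence s: "s \<in> closure {u. f (ereal u, Some i) \<noteq> 0}" by (simp add: supp_def)
    hence "{u. f (ereal u, Some i) \<noteq> 0} \<noteq> {}" by (auto simp del: Collect_empty_eq)
    then obtain u where "f (ereal u, Some i) \<noteq> 0" by blast
    hence "(ereal u, Some i) \<in> X_pm v \<sigma>" using C0_zero_off[OF f] by blast
    thus "s \<in> {0..\<eta>} \<and> i \<in> E_pm v \<sigma>" using s cl[of i] by (auto simp: X_pm_def)
  qed
  have "f \<in> Cc v \<sigma>"
  proof -
    have "compact {s. (s, i) \<in> supp f}" for i
      using compact_closure[of "{u. f (ereal u, Some i) \<noteq> 0}"] bounded_subset[OF bounded_closed_interval[of 0 \<eta>] sub[of i]]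
      by (simp add: supp_def)
    thus ?thesis using f by (simp add: C0_def Cc_def)
  qed
  hence S: "supp (S \<sigma> f) \<subseteq> {0..\<eta>} \<times> E_pm v (opp \<sigma>)"
    using cond_a[of \<sigma>] supp \<eta> unfolding cond_a_def by blast
  have out: "S \<sigma> f (ereal u, Some j) = 0" if "u > \<eta>" for u
  proof (rule ccontr)
    assume "S \<sigma> f (ereal u, Some j) \<noteq> 0"
    hence "(u, j) \<in> supp (S \<sigma> f)" using closure_subset[of "{u. S \<sigma> f (ereal u, Some j) \<noteq> 0}"] by (auto simp: supp_def)
    hence "u \<le> \<eta>" using S by auto
    with that show False by simp
  qed
  show ?thesis
  proof (cases "t = \<eta>")
    case False
    thus ?thesis using t out by simp
  next
    case True
    have "((\<lambda>u. S \<sigma> f (ereal u, Some j)) \<longlongrightarrow> S \<sigma> f (ereal t, Some j)) (at t within {0..})"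
      using C0_section(1)[OF S_C0[OF f], of j] t \<eta> by (simp add: continuous_on_def)
    hence "((\<lambda>u. S \<sigma> f (ereal u, Some j)) \<longlongrightarrow> S \<sigma> f (ereal t, Some j)) (at_right t)"
      by (rule tendsto_within_subset) (use t \<eta> in auto)
    moreover have "((\<lambda>u. S \<sigma> f (ereal u, Some j)) \<longlongrightarrow> 0) (at_right t)"
      by (rule tendsto_eventually, rule eventually_mono[OF eventually_at_right_less]) (use True out in auto)
    ultimately show ?thesis using tendsto_unique[OF trivial_limit_at_right_real] by blast
  qed
qed

text \<open>
  By the support condition the values of \<open>S \<sigma> f\<close> after \<open>\<eta>\<close> depend only on those of \<open>f\<close> after \<open>\<eta>\<close>. So \<open>f\<close> may be
  replaced by the function that is frozen at its value at \<open>\<eta>\<close> before \<open>\<eta>\<close>, and the norm bound applies to the latter.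
\<close>

lemma F_local_bound:
  assumes f: "f \<in> C0 v \<sigma>" and \<eta>: "\<eta> > 0"
    and b: "\<And>t i. t \<ge> \<eta> \<Longrightarrow> \<bar>f (ereal t, Some i)\<bar> \<le> b" and t: "t \<ge> \<eta>"
  shows "\<bar>F \<sigma> f (ereal t, Some j)\<bar> \<le> CF \<sigma> * b"
proof -
  define f' :: "'e xfun" where "f' = (\<lambda>(s, i). if s \<ge> 0 then f (max s (ereal \<eta>), i) else 0)"
  have f's: "f' (ereal s, Some i) = f (ereal (max s \<eta>), Some i)" if "s \<ge> 0" for s i
    using that by (simp add: f'_def flip: ereal_max)
  have b0: "b \<ge> 0" using b[OF order_refl, of undefined] by linarith
  have off: "f' p = 0" if "p \<notin> X_pm v \<sigma>" for p
  proof -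
    obtain s i where p: "p = (s, i)" by (cases p)
    show ?thesis
    proof (cases "s \<ge> 0")
      case True
      hence "(max s (ereal \<eta>), i) \<notin> X_pm v \<sigma>"
        using that p by (cases s) (auto simp: X_pm_def max_def split: if_splits)
      thus ?thesis using True C0_zero_off[OF f] by (simp add: p f'_def)
    qed (simp add: p f'_def)
  qed
  have f'0: "f' \<in> C0 v \<sigma>" unfolding C0_iff
  proof (intro conjI allI impI ballI off)
    fix i
    have "continuous_on {0..} (\<lambda>s. f (ereal (max s \<eta>), Some i))"
      by (rule continuous_on_compose2[OF C0_section(1)[OF f, of i]]) (auto intro!: continuous_intros)
    thus "continuous_on {0..} (\<lambda>s. f' (ereal s, Some i))"
      by (subst continuous_on_cong[OF refl f's]) auto
    show "((\<lambda>s. f' (ereal s, Some i)) \<longlongrightarrow> 0) at_top"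
    proof (rule Lim_transform_eventually[OF C0_section(2)[OF f, of i]])
      show "eventually (\<lambda>s. f (ereal s, Some i) = f' (ereal s, Some i)) at_top"
        using eventually_ge_at_top[of \<eta>] by eventually_elim (use \<eta> f's in \<open>simp add: max_absorb1\<close>)
    qed
  qed
  have f'b: "\<bar>f' p\<bar> \<le> b" for p
  proof (cases "p \<in> X_pm v \<sigma>")
    case True
    then obtain s i where p: "p = (ereal s, Some i)" "s \<ge> 0" unfolding X_pm_def by blast
    show ?thesis unfolding p f's[OF p(2)] by (rule b) simp
  qed (simp add: off b0)
  have d: "(\<lambda>p. 1 * f p + (-1) * f' p) \<in> C0 v \<sigma>" by (rule C0_lin[OF f f'0])
  have zero: "1 * f (ereal u, Some i) + (-1) * f' (ereal u, Some i) = 0" if "u \<ge> \<eta>" for u i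
    using f's[of u i] that \<eta> by (simp add: max_absorb1)
  have "S \<sigma> (\<lambda>p. 1 * f p + (-1) * f' p) (ereal t, Some j) = 0"
    by (rule S_local[OF d \<eta> zero t])
  hence "S \<sigma> f (ereal t, Some j) = S \<sigma> f' (ereal t, Some j)" unfolding S_lin[OF f f'0] by simp
  moreover have "\<bar>S \<sigma> f' (ereal t, Some j)\<bar> \<le> (CF \<sigma> - 1) * b" by (rule S_le[OF f'0 f'b])
  moreover have "\<bar>f (ereal t, Some j)\<bar> \<le> b" by (rule b[OF t])
  ultimately have "\<bar>F \<sigma> f (ereal t, Some j)\<bar> \<le> b + (CF \<sigma> - 1) * b" unfolding F_def by linarith
  thus ?thesis by (simp add: algebra_simps)
qed

text \<open>
  In a state of positive speed \<open>w\<close> the characteristic from level \<open>k\<close> at time \<open>t\<close> reaches level \<open>0\<close> at the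
  later time \<open>t + k / w\<close>, where \<open>g\<close> vanishes. Along it \<open>U\<close> changes only through the jump term, which is of the
  order of \<open>k\<close> times the supremum of \<open>U\<close> after \<open>\<eta>\<close>. For small \<open>k\<close> this supremum is therefore at most half of itself.
\<close>

lemma Q_local_short:
  assumes \<eta>: "\<eta> > 0"
  shows "\<exists>d>0. \<forall>g\<in>C01 v \<sigma>. (\<forall>t\<ge>\<eta>. \<forall>i. g (ereal t, Some i) = 0) \<longrightarrow>
     (\<forall>k\<in>{0..d}. \<forall>t\<ge>\<eta>. \<forall>i. Q \<sigma> k g (ereal t, Some i) = 0)"
proof -
  obtain K where K: "K > 0" "\<And>t b u j. t \<ge> 0 \<Longrightarrow> b \<ge> 0 \<Longrightarrow> (\<forall>i. \<bar>u i\<bar> \<le> b) \<Longrightarrow> \<bar>\<Sum>i\<in>UNIV. \<Lambda> t $ j $ i * u i\<bar> \<le> K * b"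
    using \<Lambda>_bound by (elim exE conjE) (erule that, simp)
  define m where "m = Min (range (\<lambda>i. \<bar>speed v \<sigma> i\<bar>))"
  have m: "m \<le> \<bar>speed v \<sigma> i\<bar>" for i unfolding m_def by (intro Min_le) auto
  have m0: "m > 0" unfolding m_def by (subst Min_gr_iff) (auto simp: speed_nz)
  \<comment> \<open>The length for which the factor \<open>K * CF \<sigma> * (k / w)\<close> is at most one half.\<close>
  define d where "d = m / (2 * K * CF \<sigma>)"
  have d: "d > 0" using m0 K CF_ge[of \<sigma>] by (auto simp: d_def intro!: divide_pos_pos mult_pos_pos)
  have "Q \<sigma> k g (ereal t, Some i) = 0"
    if g: "g \<in> C01 v \<sigma>" and z: "\<And>t i. t \<ge> \<eta> \<Longrightarrow> g (ereal t, Some i) = 0"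
      and k: "k \<in> {0..d}" and t: "t \<ge> \<eta>" for g k t i
  proof -
    have g0: "g \<in> C0 v \<sigma>" by (rule C01_C0[OF g])
    define B where "B = sup_norm g"
    have B: "\<bar>g p\<bar> \<le> B" for p unfolding B_def by (rule abs_le_sup_norm[OF g0])
    have B0: "B \<ge> 0" using B[of undefined] by linarith
    have step: "\<forall>k\<in>{0..d}. \<forall>t\<ge>\<eta>. \<forall>i. \<bar>Q \<sigma> k g (ereal t, Some i)\<bar> \<le> b / 2"
      if b: "b \<ge> 0" and IH: "\<forall>k\<in>{0..d}. \<forall>t\<ge>\<eta>. \<forall>i. \<bar>Q \<sigma> k g (ereal t, Some i)\<bar> \<le> b" for b
    proof (intro ballI allI impI)
      fix k t i assume k: "k \<in> {0..d}" and t: "\<eta> \<le> t"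
      have Ub: "\<bar>U \<sigma> g k' t' j\<bar> \<le> CF \<sigma> * b" if "k' \<in> {0..d}" "t' \<ge> \<eta>" for k' t' j
      proof -
        have "\<bar>F \<sigma> (Q \<sigma> k' g) (ereal t', Some j)\<bar> \<le> CF \<sigma> * b"
          by (rule F_local_bound[OF Q_C0[OF _ g0] \<eta> _ that(2)]) (use that IH in auto)
        thus ?thesis using that by (simp add: U_def max_absorb2)
      qed
      show "\<bar>Q \<sigma> k g (ereal t, Some i)\<bar> \<le> b / 2"
      proof (cases "i \<in> E_pm v \<sigma>")
        case False
        have "Q \<sigma> k g (ereal t, Some i) = 0"
          using False k by (intro C0_zero_off[OF Q_C0[OF _ g0]]) (auto simp: X_pm_def)
        thus ?thesis using b by simp
      next
        case True
        define w where "w = speed v \<sigma> i"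
        have w: "w > 0" using True by (simp add: w_def E_pm_iff)
        obtain L where L: "L \<ge> 0" "\<And>k k' t t' j. t \<ge> 0 \<Longrightarrow> t' \<ge> 0 \<Longrightarrow> \<bar>U \<sigma> g k t j - U \<sigma> g k' t' j\<bar> \<le> L * (\<bar>k - k'\<bar> + \<bar>t - t'\<bar>)"
          using U_lipschitz[OF g] by (elim exE conjE) (erule that, simp)
        define x where "x = (\<lambda>h. U \<sigma> g (k - h * w) (t + h) i)"
        have tt: "t + h \<ge> 0" if "h \<ge> 0" for h using that t \<eta> by linarith
        have cont: "continuous_on {0..k/w} x"
        proof (rule continuous_on_subset[of "{0..}"], rule lipschitz_on_continuous_on[of "L * (w + 1)"], rule lipschitz_onI)
          fix h h' :: real assume "h \<in> {0..}" "h' \<in> {0..}"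
          hence "dist (x h) (x h') \<le> L * (\<bar>k - h * w - (k - h' * w)\<bar> + \<bar>t + h - (t + h')\<bar>)"
            unfolding x_def dist_real_def using tt by (intro L) auto
          also have "k - h * w - (k - h' * w) = - (w * (h - h'))" by (simp add: algebra_simps)
          also have "\<bar>- (w * (h - h'))\<bar> = w * dist h h'" using w by (simp add: dist_real_def abs_mult)
          also have "\<bar>t + h - (t + h')\<bar> = dist h h'" by (simp add: dist_real_def)
          also have "L * (w * dist h h' + dist h h') = L * (w + 1) * dist h h'" by (simp add: algebra_simps)
          finally show "dist (x h) (x h') \<le> L * (w + 1) * dist h h'" .
        qed (use L w in auto)
        have "\<bar>x (k / w) - x 0\<bar> \<le> K * (CF \<sigma> * b) * (k / w - 0)"
        proof (rule right_derivative_bound[OF _ cont])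
          show "0 \<le> k / w" using k w by simp
          fix h assume h: "0 \<le> h" "h < k / w"
          have kk: "k - h * w > 0" using h w by (simp add: pos_less_divide_eq)
          have "((\<lambda>h'. (U \<sigma> g (k - h * w - h' * w) (t + h + h') i - U \<sigma> g (k - h * w) (t + h) i) / h') \<longlongrightarrow>
              - (\<Sum>j\<in>UNIV. \<Lambda> (t + h) $ i $ j * U \<sigma> g (k - h * w) (t + h) j)) (at_right 0)"
            unfolding w_def by (rule U_characteristic_deriv[OF g kk[unfolded w_def] tt[OF h(1)]])
          hence "((\<lambda>h'. (x (h + h') - x h) / h') \<longlongrightarrow>
              - (\<Sum>j\<in>UNIV. \<Lambda> (t + h) $ i $ j * U \<sigma> g (k - h * w) (t + h) j)) (at_right 0)"
            by (simp add: x_def algebra_simps)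
          moreover have "\<bar>- (\<Sum>j\<in>UNIV. \<Lambda> (t + h) $ i $ j * U \<sigma> g (k - h * w) (t + h) j)\<bar> \<le> K * (CF \<sigma> * b)"
          proof -
            have "k - h * w \<le> d" using k h w by (auto intro: order_trans[of _ k])
            hence "\<forall>j. \<bar>U \<sigma> g (k - h * w) (t + h) j\<bar> \<le> CF \<sigma> * b"
              using kk t h by (intro allI Ub) auto
            thus ?thesis unfolding abs_minus_cancel
              using CF_ge[of \<sigma>] b by (intro K(2) tt h) auto
          qed
          ultimately show "\<exists>D. \<bar>D\<bar> \<le> K * (CF \<sigma> * b) \<and> ((\<lambda>h'. (x (h + h') - x h) / h') \<longlongrightarrow> D) (at_right 0)"
            by blast
        qed
        moreover have "x (k / w) = 0"
        proof -
          have tk: "t + k / w \<ge> \<eta>" using t k w by (simp add: add_increasing2)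
          have "x (k / w) = F \<sigma> g (ereal (t + k / w), Some i)"
            using w Q_0[OF order_refl g0] by (simp add: x_def U_def)
          moreover have "\<bar>F \<sigma> g (ereal (t + k / w), Some i)\<bar> \<le> CF \<sigma> * 0"
            by (rule F_local_bound[OF g0 \<eta> _ tk]) (simp add: z)
          ultimately show ?thesis by simp
        qed
        moreover have "x 0 = Q \<sigma> k g (ereal t, Some i)"
        proof -
          have "S \<sigma> (Q \<sigma> k g) (ereal t, Some i) = 0"
            using True k by (intro C0_zero_off[OF S_C0[OF Q_C0[OF _ g0]]]) (auto simp: X_pm_def E_pm_iff speed_opp)
          thus ?thesis using k by (simp add: x_def U_def F_def max_absorb2)
        qed
        ultimately have "\<bar>Q \<sigma> k g (ereal t, Some i)\<bar> \<le> K * (CF \<sigma> * b) * (k / w)" by simp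
        also have "\<dots> \<le> K * (CF \<sigma> * b) * (d / m)"
          using k w m[of i] m0 K(1) CF_ge[of \<sigma>] b by (intro mult_left_mono frac_le) (auto simp: w_def)
        also have "\<dots> = b / 2" using m0 K(1) CF_ge[of \<sigma>] by (simp add: d_def)
        finally show ?thesis .
      qed
    qed
    have all: "\<forall>k\<in>{0..d}. \<forall>t\<ge>\<eta>. \<forall>i. \<bar>Q \<sigma> k g (ereal t, Some i)\<bar> \<le> B / 2 ^ n" for n
    proof (induction n)
      case 0
      show ?case using Q_le[OF _ g0 B] by simp
    next
      case (Suc n)
      from step[OF _ Suc] show ?case using B0 by (simp add: field_simps)
    qed
    have "(\<lambda>n. B / 2 ^ n) \<longlonglongrightarrow> 0"
      using tendsto_mult_right_zero[OF LIMSEQ_power_zero[of "1/2::real"], of B] by (simp add: power_divide)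
    hence "\<bar>Q \<sigma> k g (ereal t, Some i)\<bar> \<le> 0"
      by (rule LIMSEQ_le_const) (use all k t in blast)
    thus ?thesis by simp
  qed
  thus ?thesis using d by (intro exI[of _ d]) simp
qed

text \<open>
  The semigroup law iterates the short-time statement. This is what removes the paths that never reach
  the level.
\<close>

lemma U_local:
  assumes \<eta>: "\<eta> > 0" and g: "g \<in> C01 v \<sigma>" and z: "\<And>t i. t \<ge> \<eta> \<Longrightarrow> g (ereal t, Some i) = 0" and t: "t \<ge> \<eta>"
  shows "U \<sigma> g k t j = 0"
proof -
  obtain d where d: "d > 0" "\<And>g k t i. g \<in> C01 v \<sigma> \<Longrightarrow> (\<forall>t\<ge>\<eta>. \<forall>i. g (ereal t, Some i) = 0) \<Longrightarrow>
     k \<in> {0..d} \<Longrightarrow> t \<ge> \<eta> \<Longrightarrow> Q \<sigma> k g (ereal t, Some i) = 0"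
    using Q_local_short[OF \<eta>, of \<sigma>] by (elim exE conjE) (erule that, simp)
  have "\<forall>t\<ge>\<eta>. \<forall>i. Q \<sigma> k g (ereal t, Some i) = 0" if "k \<in> {0..real n * d}" for n k
    using that
  proof (induction n arbitrary: k)
    case 0
    thus ?case using z Q_0[OF order_refl C01_C0[OF g]] by simp
  next
    case (Suc n)
    define k' where "k' = min k (real n * d)"
    have k': "k' \<in> {0..real n * d}" "k - k' \<in> {0..d}" "k' \<ge> 0" using Suc.prems d by (auto simp: k'_def min_def algebra_simps)
    have "Q \<sigma> (k - k' + k') g = Q \<sigma> (k - k') (Q \<sigma> k' g)"
      by (rule Q_add) (use k' in \<open>auto intro: C01_C0[OF g]\<close>)
    thus ?case using d(2)[OF Q_C01(1)[OF g k'(3)] Suc.IH[OF k'(1)] k'(2)] by simp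
  qed
  moreover obtain n where "real n * d \<ge> max 0 k" using reals_Archimedean3[OF d(1)] by (meson less_imp_le)
  ultimately have "\<forall>t\<ge>\<eta>. \<forall>i. Q \<sigma> (max 0 k) g (ereal t, Some i) = 0" by simp
  hence "\<bar>F \<sigma> (Q \<sigma> (max 0 k) g) (ereal t, Some j)\<bar> \<le> CF \<sigma> * 0"
    by (intro F_local_bound[OF _ \<eta> _ t] Q_C0 C01_C0 g) auto
  thus ?thesis by (simp add: U_def)
qed

end

section \<open>Paths, the clock and passage times\<close>

lemma paths_right: "\<omega> \<in> paths \<Longrightarrow> t \<ge> 0 \<Longrightarrow> eventually (\<lambda>u. \<omega> u = \<omega> t) (at_right t)"
  by (auto simp: paths_def)

lemma space_filt_fin [simp]: "space (filt_fin s t) = paths"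
  and space_natural_filt [simp]: "space (natural_filt s t) = paths"
  and space_filt_inf [simp]: "space (filt_inf s) = paths"
  by (simp_all add: filt_fin_def natural_filt_def filt_inf_def space_measure_of_conv)

lemma sets_natural_filt_le: "A \<in> sets (natural_filt s t) \<Longrightarrow> A \<subseteq> paths"
  using sets.sets_into_space by fastforce

lemma sets_filt_fin_le: "A \<in> sets (filt_fin s t) \<Longrightarrow> A \<subseteq> paths"
  using sets.sets_into_space by fastforce

lemma filt_fin_in_filt_inf:
  assumes "s \<le> ereal t" shows "sets (filt_fin s t) \<subseteq> sets (filt_inf s)"
proof
  fix A assume A: "A \<in> sets (filt_fin s t)"
  have "(\<Union>t\<in>{t. s \<le> ereal t}. sets (filt_fin s t)) \<subseteq> Pow paths" using sets_filt_fin_le by blast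
  thus "A \<in> sets (filt_inf s)" unfolding filt_inf_def using A assms by (auto simp: sets_measure_of)
qed

text \<open>
  An event determined by the state at \<open>u \<le> t\<close> lies in the natural filtration at every \<open>r > t\<close>, hence in its
  right-continuous version at \<open>t\<close>.
\<close>

lemma measurable_eval:
  assumes "s \<le> u" "u \<le> t"
  shows "(\<lambda>\<omega>. \<omega> u) \<in> filt_fin (ereal s) t \<rightarrow>\<^sub>M count_space UNIV"
proof (rule measurableI)
  fix A :: "'e set" assume "A \<in> sets (count_space UNIV)"
  have "(\<lambda>\<omega>. \<omega> u) -` A \<inter> paths = Xst (ereal u) -` (Some ` A) \<inter> paths" by (auto simp: Xst_def)
  moreover have "\<dots> \<in> sets (natural_filt (ereal s) r)" if "r > t" for r
  proof -
    have "{Xst (ereal u) -` B \<inter> paths | u B. ereal s \<le> ereal u \<and> u \<le> r} \<subseteq> Pow paths" by auto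
    moreover have "Xst (ereal u) -` (Some ` A) \<inter> paths \<in> {Xst (ereal u) -` B \<inter> paths | u B. ereal s \<le> ereal u \<and> u \<le> r}"
      using assms that by (intro CollectI exI[of _ u] exI[of _ "Some ` A"]) auto
    ultimately show ?thesis unfolding natural_filt_def by (auto simp: sets_measure_of)
  qed
  ultimately have "(\<lambda>\<omega>. \<omega> u) -` A \<inter> paths \<in> (\<Inter>r\<in>{t<..}. sets (natural_filt (ereal s) r))" by simp
  moreover have "(\<Inter>r\<in>{t<..}. sets (natural_filt (ereal s) r)) \<subseteq> Pow paths"
  proof
    fix B assume "B \<in> (\<Inter>r\<in>{t<..}. sets (natural_filt (ereal s) r))"
    hence "B \<in> sets (natural_filt (ereal s) (t + 1))" by auto
    thus "B \<in> Pow paths" using sets_natural_filt_le by blast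
  qed
  ultimately show "(\<lambda>\<omega>. \<omega> u) -` A \<inter> space (filt_fin (ereal s) t) \<in> sets (filt_fin (ereal s) t)"
    unfolding space_filt_fin unfolding filt_fin_def by (auto simp: sets_measure_of)
qed simp

text \<open>
  The next grid point strictly after \<open>u\<close>, capped at \<open>t\<close>. The floor plus one makes it strictly later than \<open>u\<close>, so right
  continuity applies, and the cap keeps it observable at time \<open>t\<close>.
\<close>

lemma right_grid_limit:
  assumes "\<omega> \<in> paths" "0 \<le> s" "s \<le> u" "u \<le> t"
  shows "eventually (\<lambda>n. \<omega> (max s (min t ((of_int \<lfloor>u * real (Suc n)\<rfloor> + 1) / real (Suc n)))) = \<omega> u) sequentially"
proof -
  obtain b where b: "b > u" "\<And>y. u < y \<Longrightarrow> y < b \<Longrightarrow> \<omega> y = \<omega> u"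
    using paths_right[of \<omega> u] assms unfolding eventually_at_right_field by auto
  have "eventually (\<lambda>n. inverse (real (Suc n)) < b - u) sequentially"
    by (rule order_tendstoD(2)[OF LIMSEQ_inverse_real_of_nat]) (use b in simp)
  thus ?thesis
  proof eventually_elim
    case (elim n)
    define N where "N = real (Suc n)"
    have N: "N > 0" by (simp add: N_def)
    define y where "y = (of_int \<lfloor>u * N\<rfloor> + 1) / N"
    have "u * N < of_int \<lfloor>u * N\<rfloor> + 1" "of_int \<lfloor>u * N\<rfloor> + 1 \<le> u * N + 1" by linarith+
    hence y: "u < y" "y \<le> u + inverse N" using N by (auto simp: y_def field_simps)
    hence yb: "y < b" using elim by (simp add: N_def)
    have "max s (min t y) = y \<or> (max s (min t y) = t \<and> t < b)" using y yb assms by (auto simp: max_def min_def)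
    moreover have "t = u \<or> (t < b \<longrightarrow> \<omega> t = \<omega> u)" using b(2)[of t] assms by (cases "t = u") auto
    ultimately have "\<omega> (max s (min t y)) = \<omega> u" using b(2)[of y] y yb by auto
    thus ?case by (simp add: y_def N_def)
  qed
qed

text \<open>
  Progressive measurability: the path is a pointwise limit of step functions that look only at countably
  many times in \<open>[s, r]\<close>.
\<close>

lemma measurable_path_section:
  fixes w :: "'e \<Rightarrow> real"
  assumes "0 \<le> s" "s \<le> r" "r \<le> t"
  shows "(\<lambda>(\<omega>, u). indicator {s..r} u *\<^sub>R w (\<omega> u)) \<in> borel_measurable (filt_fin (ereal s) t \<Otimes>\<^sub>M lborel)"
proof (rule borel_measurable_LIMSEQ_real)
  let ?f = "\<lambda>n x. indicator {s..r} (snd x) *\<^sub>R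
    w (fst x (max s (min r ((of_int \<lfloor>snd x * real (Suc n)\<rfloor> + 1) / real (Suc n)))))"
  show "?f n \<in> borel_measurable (filt_fin (ereal s) t \<Otimes>\<^sub>M lborel)" for n
  proof -
    have "(\<lambda>x. (\<lambda>m x. w (fst x (max s (min r ((of_int m + 1) / real (Suc n)))))) (\<lfloor>snd x * real (Suc n)\<rfloor>) x)
        \<in> borel_measurable (filt_fin (ereal s) t \<Otimes>\<^sub>M lborel)"
    proof (rule measurable_compose_countable[where g = "\<lambda>x. \<lfloor>snd x * real (Suc n)\<rfloor>" and
          f = "\<lambda>m x. w (fst x (max s (min r ((of_int m + 1) / real (Suc n)))))"])
      fix m :: int
      have "(\<lambda>\<omega>. w (\<omega> (max s (min r ((of_int m + 1) / real (Suc n)))))) \<in> borel_measurable (filt_fin (ereal s) t)"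
        by (rule measurable_compose[OF measurable_eval]) (use assms in auto)
      from measurable_compose[OF measurable_fst this]
      show "(\<lambda>x. w (fst x (max s (min r ((of_int m + 1) / real (Suc n)))))) \<in> borel_measurable (filt_fin (ereal s) t \<Otimes>\<^sub>M lborel)" .
    next
      have "(\<lambda>u::real. \<lfloor>u * real (Suc n)\<rfloor>) \<in> borel \<rightarrow>\<^sub>M count_space UNIV" by measurable
      hence "(\<lambda>u::real. \<lfloor>u * real (Suc n)\<rfloor>) \<in> lborel \<rightarrow>\<^sub>M count_space UNIV" by simp
      from measurable_compose[OF measurable_snd this]
      show "(\<lambda>x. \<lfloor>snd x * real (Suc n)\<rfloor>) \<in> filt_fin (ereal s) t \<Otimes>\<^sub>M lborel \<rightarrow>\<^sub>M count_space UNIV" .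
    qed
    moreover have "(\<lambda>x. indicator {s..r} (snd x) :: real) \<in> borel_measurable (filt_fin (ereal s) t \<Otimes>\<^sub>M lborel)"
      by measurable
    ultimately show ?thesis by (intro borel_measurable_scaleR) simp_all
  qed
  fix x :: "(real \<Rightarrow> 'e) \<times> real" assume "x \<in> space (filt_fin (ereal s) t \<Otimes>\<^sub>M lborel)"
  then obtain \<omega> u where x: "x = (\<omega>, u)" "\<omega> \<in> paths" by (auto simp: space_pair_measure)
  show "(\<lambda>n. ?f n x) \<longlonglongrightarrow> (case x of (\<omega>, u) \<Rightarrow> indicator {s..r} u *\<^sub>R w (\<omega> u))"
  proof (cases "u \<in> {s..r}")
    case True
    show ?thesis
      by (rule tendsto_eventually, rule eventually_mono[OF right_grid_limit[of \<omega> s u r]])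
         (use True x assms in auto)
  qed (simp add: x)
qed

text \<open>
  The additive functional \<open>\<phi>\<close> at real times, for an arbitrary integrand; with \<open>w = speed v \<sigma>\<close> it is \<open>\<phi>\<close> or \<open>- \<phi>\<close>.
\<close>

definition clock :: "('e \<Rightarrow> real) \<Rightarrow> real \<Rightarrow> real \<Rightarrow> (real \<Rightarrow> 'e) \<Rightarrow> real" where
  "clock w s t \<omega> = (LBINT u:{s..t}. w (\<omega> u))"

lemma clock_measurable:
  assumes "0 \<le> s" "s \<le> r" "r \<le> t"
  shows "clock w s r \<in> borel_measurable (filt_fin (ereal s) t)"
  using lborel.borel_measurable_lebesgue_integral[OF measurable_path_section[OF assms, of w]]
  unfolding clock_def set_lebesgue_integral_def .

lemma path_integrable:
  fixes w :: "'e \<Rightarrow> real"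
  assumes \<omega>: "\<omega> \<in> paths" and "0 \<le> s" and c: "\<And>j. \<bar>w j\<bar> \<le> c"
  shows "set_integrable lborel {s..t} (\<lambda>u. w (\<omega> u))"
proof (cases "s \<le> t")
  case True
  have "(\<lambda>(\<omega>, u). indicator {s..t} u *\<^sub>R w (\<omega> u)) \<in> borel_measurable (filt_fin (ereal s) t \<Otimes>\<^sub>M lborel)"
    by (rule measurable_path_section) (use assms True in auto)
  from measurable_Pair2[OF this, of \<omega>] have m: "(\<lambda>u. indicator {s..t} u *\<^sub>R w (\<omega> u)) \<in> borel_measurable lborel"
    using \<omega> by simp
  have "integrable lborel (\<lambda>u. c * indicator {s..t} u)"
    by (intro integrable_mult_right integrable_real_indicator) (auto simp: emeasure_lborel_Icc[OF True])
  thus ?thesis unfolding set_integrable_def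
    by (rule Bochner_Integration.integrable_bound[OF _ m]) (rule AE_I2, use c order_trans[OF c abs_ge_self] in \<open>simp add: indicator_def\<close>)
qed (simp add: set_integrable_def)

lemma clock_split:
  fixes w :: "'e \<Rightarrow> real"
  assumes \<omega>: "\<omega> \<in> paths" and s: "0 \<le> s" "s \<le> t" "t \<le> t'" and c: "\<And>j. \<bar>w j\<bar> \<le> c"
  shows "clock w s t' \<omega> = clock w s t \<omega> + (LBINT u:{t<..t'}. w (\<omega> u))"
proof -
  have i: "set_integrable lborel {s..t'} (\<lambda>u. w (\<omega> u))" by (rule path_integrable[OF \<omega> s(1) c])
  have "{s..t'} = {s..t} \<union> {t<..t'}" using s by auto
  moreover have "set_integrable lborel {s..t} (\<lambda>u. w (\<omega> u))" "set_integrable lborel {t<..t'} (\<lambda>u. w (\<omega> u))"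
    by (rule set_integrable_subset[OF i]; use s in auto)+
  ultimately show ?thesis unfolding clock_def by (simp only:, subst set_integral_Un) auto
qed

lemma clock_lipschitz:
  fixes w :: "'e \<Rightarrow> real"
  assumes \<omega>: "\<omega> \<in> paths" and s: "0 \<le> s" "s \<le> t" "t \<le> t'" and c: "\<And>j. \<bar>w j\<bar> \<le> c"
  shows "\<bar>clock w s t' \<omega> - clock w s t \<omega>\<bar> \<le> c * (t' - t)"
proof -
  have i: "set_integrable lborel {t<..t'} (\<lambda>u. w (\<omega> u))"
    by (rule set_integrable_subset[OF path_integrable[OF \<omega> s(1) c, of t']]) (use s in auto)
  have "\<bar>LBINT u:{t<..t'}. w (\<omega> u)\<bar> \<le> (LBINT u:{t<..t'}. \<bar>w (\<omega> u)\<bar>)"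
    using set_integral_norm_bound[OF i] by simp
  also have "\<dots> \<le> (LBINT u:{t<..t'}. c)"
  proof (rule set_integral_mono)
    show "set_integrable lborel {t<..t'} (\<lambda>u. \<bar>w (\<omega> u)\<bar>)" by (rule set_integrable_abs[OF i])
    show "set_integrable lborel {t<..t'} (\<lambda>u. c)" unfolding set_integrable_def
      by (rule integrable_scaleR_left, rule integrable_real_indicator) (use s in auto)
  qed (rule c)
  also have "\<dots> = c * (t' - t)" using s by (simp add: set_lebesgue_integral_def)
  finally show ?thesis unfolding clock_split[OF assms] by simp
qed

lemma clock_linear:
  fixes w :: "'e \<Rightarrow> real"
  assumes \<omega>: "\<omega> \<in> paths" and s: "0 \<le> s" "s \<le> t" "t \<le> t'" and c: "\<And>j. \<bar>w j\<bar> \<le> c"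
    and const: "\<And>u. t < u \<Longrightarrow> u \<le> t' \<Longrightarrow> \<omega> u = j"
  shows "clock w s t' \<omega> = clock w s t \<omega> + (t' - t) * w j"
proof -
  have "(LBINT u:{t<..t'}. w (\<omega> u)) = (LBINT u:{t<..t'}. w j)"
    by (rule set_lebesgue_integral_cong) (use const in auto)
  also have "\<dots> = (t' - t) * w j" using s by (simp add: set_lebesgue_integral_def)
  finally show ?thesis unfolding clock_split[OF \<omega> s c] by simp
qed

text \<open>
  A path stays in its state for a positive time, so the clock is linear just to the right of every time.
\<close>

lemma clock_right_linear:
  fixes w :: "'e \<Rightarrow> real"
  assumes \<omega>: "\<omega> \<in> paths" and s: "0 \<le> s" "s \<le> t" and c: "\<And>j. \<bar>w j\<bar> \<le> c"
  shows "\<exists>d>0. \<forall>h\<in>{0..d}. clock w s (t + h) \<omega> = clock w s t \<omega> + h * w (\<omega> t)"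
proof -
  obtain b where b: "b > t" "\<And>y. t < y \<Longrightarrow> y < b \<Longrightarrow> \<omega> y = \<omega> t"
    using paths_right[OF \<omega>, of t] s unfolding eventually_at_right_field by auto
  have "clock w s (t + h) \<omega> = clock w s t \<omega> + h * w (\<omega> t)" if "h \<in> {0..(b - t) / 2}" for h
    using clock_linear[OF \<omega> s, of "t + h" w c "\<omega> t"] c b that by (auto simp: field_simps)
  thus ?thesis using b(1) by (intro exI[of _ "(b - t) / 2"]) auto
qed

lemma clock_continuous:
  fixes w :: "'e \<Rightarrow> real"
  assumes \<omega>: "\<omega> \<in> paths" and s: "0 \<le> s" and c: "\<And>j. \<bar>w j\<bar> \<le> c"
  shows "continuous_on {s..} (\<lambda>t. clock w s t \<omega>)"
proof (rule lipschitz_on_continuous_on, rule lipschitz_onI)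
  show "0 \<le> c" using c[of undefined] by linarith
  fix a b assume "a \<in> {s..}" "b \<in> {s..}"
  thus "dist (clock w s a \<omega>) (clock w s b \<omega>) \<le> c * dist a b"
    using clock_lipschitz[OF \<omega> s, of a b w c] clock_lipschitz[OF \<omega> s, of b a w c] c
    by (cases "a \<le> b") (auto simp: dist_real_def abs_minus_commute)
qed

lemma clock_start [simp]: "clock w s s \<omega> = 0"
proof -
  have "AE u in lborel. indicator {s} u *\<^sub>R w (\<omega> u) = 0"
    using AE_lborel_singleton[of s] by eventually_elim simp
  from integral_eq_zero_AE[OF this] show ?thesis by (simp add: clock_def set_lebesgue_integral_def)
qed

text \<open>
  The two conventions for the value at \<open>\<infinity>\<close> agree: the point \<open>\<infinity>\<close> does not change an infimum.
\<close>

lemma tau_eq_Inf: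
  "tau v \<sigma> l (ereal s) \<omega> = Inf (ereal ` {t. s \<le> t \<and> clock (speed v \<sigma>) s t \<omega> > l})"
proof (cases \<sigma>)
  case Plus
  have "{t. ereal s \<le> t \<and> phi v (ereal s) t \<omega> > ereal l} = insert \<infinity> (ereal ` {t. s \<le> t \<and> clock (speed v \<sigma>) s t \<omega> > l})"
  proof (rule set_eqI)
    fix t show "t \<in> {t. ereal s \<le> t \<and> phi v (ereal s) t \<omega> > ereal l} \<longleftrightarrow>
      t \<in> insert \<infinity> (ereal ` {t. s \<le> t \<and> clock (speed v \<sigma>) s t \<omega> > l})"
      by (cases t) (auto simp: phi_def clock_def speed_def Plus Xst_def)
  qed
  thus ?thesis by (simp add: Plus)
next
  case Minus
  have "{t. ereal s \<le> t \<and> phi v (ereal s) t \<omega> < - ereal l} = ereal ` {t. s \<le> t \<and> clock (speed v \<sigma>) s t \<omega> > l}"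
  proof (rule set_eqI)
    fix t show "t \<in> {t. ereal s \<le> t \<and> phi v (ereal s) t \<omega> < - ereal l} \<longleftrightarrow>
      t \<in> ereal ` {t. s \<le> t \<and> clock (speed v \<sigma>) s t \<omega> > l}"
      by (cases t) (auto simp: phi_def clock_def speed_def Minus Xst_def set_lebesgue_integral_def)
  qed
  thus ?thesis by (simp add: Minus)
qed

text \<open>
  Continuity of the clock enters from right to left: if it exceeds \<open>l\<close> at \<open>r\<close>, it already exceeds \<open>l\<close>
  slightly earlier, so the passage happens strictly before \<open>r\<close>. The event on the left is thereby
  observable at time \<open>t\<close>.
\<close>

lemma le_tau_iff:
  fixes v :: "'e::finite option \<Rightarrow> real"
  assumes \<omega>: "\<omega> \<in> paths" and s: "0 \<le> s" and l: "l \<ge> 0"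
  shows "ereal t \<le> tau v \<sigma> l (ereal s) \<omega> \<longleftrightarrow> (\<forall>r. s \<le> r \<longrightarrow> r \<le> t \<longrightarrow> clock (speed v \<sigma>) s r \<omega> \<le> l)"
proof
  assume R: "\<forall>r. s \<le> r \<longrightarrow> r \<le> t \<longrightarrow> clock (speed v \<sigma>) s r \<omega> \<le> l"
  show "ereal t \<le> tau v \<sigma> l (ereal s) \<omega>" unfolding tau_eq_Inf
    by (rule Inf_greatest) (use R in \<open>force simp: not_le[symmetric]\<close>)
next
  assume L: "ereal t \<le> tau v \<sigma> l (ereal s) \<omega>"
  define c where "c = Max (range (\<lambda>j. \<bar>speed v \<sigma> j\<bar>))"
  have c: "\<bar>speed v \<sigma> j\<bar> \<le> c" for j unfolding c_def by (intro Max_ge) auto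
  show "\<forall>r. s \<le> r \<longrightarrow> r \<le> t \<longrightarrow> clock (speed v \<sigma>) s r \<omega> \<le> l"
  proof (intro allI impI, rule ccontr)
    fix r assume r: "s \<le> r" "r \<le> t" "\<not> clock (speed v \<sigma>) s r \<omega> \<le> l"
    define y where "y = (l + clock (speed v \<sigma>) s r \<omega>) / 2"
    have "\<exists>x\<ge>s. x \<le> r \<and> clock (speed v \<sigma>) s x \<omega> = y"
      by (rule IVT') (use r l in \<open>auto simp: y_def intro!: continuous_on_subset[OF clock_continuous[OF \<omega> s c]]\<close>)
    then obtain x where x: "s \<le> x" "x \<le> r" "clock (speed v \<sigma>) s x \<omega> = y" by blast
    hence "x < r" "clock (speed v \<sigma>) s x \<omega> > l" using r by (auto simp: y_def less_le)
    hence "tau v \<sigma> l (ereal s) \<omega> \<le> ereal x" unfolding tau_eq_Inf using x by (intro Inf_lower) auto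
    with L have "ereal t \<le> ereal x" by (rule order_trans)
    with \<open>x < r\<close> r show False by simp
  qed
qed

lemma tau_ge_start: "ereal s \<le> tau v \<sigma> l (ereal s) \<omega>"
  unfolding tau_eq_Inf by (rule Inf_greatest) auto

text \<open>
  If the clock were below \<open>l\<close> at \<open>r\<close>, or at \<open>l\<close> with negative speed, it would stay at most \<open>l\<close> for a while after \<open>r\<close>, so
  \<open>r\<close> would not be the passage time.
\<close>

lemma at_tau:
  fixes v :: "'e::finite option \<Rightarrow> real"
  assumes \<omega>: "\<omega> \<in> paths" and s: "0 \<le> s" and l: "l \<ge> 0" and r: "tau v \<sigma> l (ereal s) \<omega> = ereal r"
  shows "s \<le> r" "clock (speed v \<sigma>) s r \<omega> = l" "speed v \<sigma> (\<omega> r) > 0"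
proof -
  define c where "c = Max (range (\<lambda>j. \<bar>speed v \<sigma> j\<bar>))"
  have c: "\<bar>speed v \<sigma> j\<bar> \<le> c" for j unfolding c_def by (intro Max_ge) auto
  have c0: "c \<ge> 0" using c[of undefined] by linarith
  let ?f = "\<lambda>t. clock (speed v \<sigma>) s t \<omega>"
  show sr: "s \<le> r" using tau_ge_start[of s v \<sigma> l \<omega>] r by simp
  have below: "\<And>q. s \<le> q \<Longrightarrow> q \<le> r \<Longrightarrow> ?f q \<le> l" using le_tau_iff[OF \<omega> s l, of r v \<sigma>] r by simp
  have no: False if "d > 0" "\<And>h. 0 \<le> h \<Longrightarrow> h \<le> d \<Longrightarrow> ?f (r + h) \<le> l" for d
  proof -
    have "?f q \<le> l" if "s \<le> q" "q \<le> r + d" for q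
      using below[of q] \<open>\<And>h. 0 \<le> h \<Longrightarrow> h \<le> d \<Longrightarrow> ?f (r + h) \<le> l\<close>[of "q - r"] that by (cases "q \<le> r") auto
    hence "ereal (r + d) \<le> ereal r" using le_tau_iff[OF \<omega> s l, of "r + d" v \<sigma>] r by simp
    thus False using \<open>d > 0\<close> by simp
  qed
  show fr: "?f r = l"
  proof (rule ccontr)
    assume "?f r \<noteq> l"
    hence lt: "?f r < l" using below[OF sr order_refl] by simp
    show False
    proof (rule no)
      show "(l - ?f r) / (c + 1) > 0" using lt c0 by simp
      fix h assume h: "0 \<le> h" "h \<le> (l - ?f r) / (c + 1)"
      have "\<bar>?f (r + h) - ?f r\<bar> \<le> c * (r + h - r)" by (rule clock_lipschitz[OF \<omega> s sr _ c]) (use h in simp)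
      moreover have "h * (c + 1) \<le> l - ?f r" using h c0 by (simp add: pos_le_divide_eq)
      ultimately show "?f (r + h) \<le> l" using h by (simp add: algebra_simps)
    qed
  qed
  show "speed v \<sigma> (\<omega> r) > 0"
  proof (rule ccontr)
    assume n: "\<not> speed v \<sigma> (\<omega> r) > 0"
    obtain d where d: "d > 0" "\<forall>h\<in>{0..d}. ?f (r + h) = ?f r + h * speed v \<sigma> (\<omega> r)"
      using clock_right_linear[where w = "speed v \<sigma>", OF \<omega> s sr c] by blast
    show False
    proof (rule no[OF d(1)])
      fix h assume "0 \<le> h" "h \<le> d"
      thus "?f (r + h) \<le> l" using d(2) n fr by (auto simp: mult_nonneg_nonpos)
    qed
  qed
qed

section \<open>Transition probabilities\<close>

locale markov_start =
  fixes \<Lambda> :: "real \<Rightarrow> real^'e::finite^'e"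
    and P :: "'e pt \<Rightarrow> (real \<Rightarrow> 'e) measure" and s :: real and i :: 'e
  assumes fam: "canonical_markov_family \<Lambda> P" and s: "0 \<le> s"
begin

abbreviation M :: "(real \<Rightarrow> 'e) measure" where "M \<equiv> P (ereal s, Some i)"

definition trans_prob :: "real \<Rightarrow> real \<Rightarrow> 'e \<Rightarrow> 'e \<Rightarrow> real" where
  "trans_prob t r k j = measure (P (ereal t, Some k)) {\<omega>\<in>paths. \<omega> r = j}"

lemma family_props:
  assumes t: "t \<ge> 0"
  shows P_prob: "prob_space (P (ereal t, Some k))"
    and P_sets: "sets (P (ereal t, Some k)) = sets (filt_inf (ereal t))"
    and P_start: "measure (P (ereal t, Some k)) {\<omega>\<in>paths. \<omega> t = k} = 1"
    and P_markov: "\<And>u r B. t \<le> u \<Longrightarrow> u \<le> r \<Longrightarrow>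
         AE \<omega> in P (ereal t, Some k).
            real_cond_exp (P (ereal t, Some k)) (filt_fin (ereal t) u) (indicator {\<omega>'\<in>paths. Xst (ereal r) \<omega>' \<in> B}) \<omega> =
            measure (P (ereal u, Xst (ereal u) \<omega>)) {\<omega>'\<in>paths. Xst (ereal r) \<omega>' \<in> B}"
proof -
  have x: "(ereal t, Some k) \<in> Xbar_full" using t by (auto simp: Xbar_full_def X_full_def)
  note f = fam[unfolded canonical_markov_family_def, THEN conjunct1, THEN bspec, OF x, simplified prod.case]
  show "prob_space (P (ereal t, Some k))" using f by blast
  show "sets (P (ereal t, Some k)) = sets (filt_inf (ereal t))" using f by (simp add: filt_def)
  show "measure (P (ereal t, Some k)) {\<omega>\<in>paths. \<omega> t = k} = 1" using f by (simp add: Xst_def)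
  fix u r B assume "t \<le> u" "u \<le> r"
  thus "AE \<omega> in P (ereal t, Some k).
            real_cond_exp (P (ereal t, Some k)) (filt_fin (ereal t) u) (indicator {\<omega>'\<in>paths. Xst (ereal r) \<omega>' \<in> B}) \<omega> =
            measure (P (ereal u, Xst (ereal u) \<omega>)) {\<omega>'\<in>paths. Xst (ereal r) \<omega>' \<in> B}"
    using f[THEN conjunct2, THEN conjunct2, THEN conjunct2, THEN spec[of _ "ereal u"], THEN spec[of _ "ereal r"], THEN spec[of _ B]]
    by (simp add: filt_def)
qed

lemma P_space: "t \<ge> 0 \<Longrightarrow> space (P (ereal t, Some k)) = paths"
  using sets_eq_imp_space_eq[OF P_sets] by simp

sublocale prob_space M by (rule P_prob[OF s])

lemma space_M [simp]: "space M = paths" by (rule P_space[OF s])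

lemma filt_subalgebra: "s \<le> t \<Longrightarrow> subalgebra M (filt_fin (ereal s) t)"
  unfolding subalgebra_def using filt_fin_in_filt_inf[of "ereal s" t] by (simp add: P_sets[OF s])

lemma meas_M: "s \<le> t \<Longrightarrow> f \<in> measurable (filt_fin (ereal s) t) N \<Longrightarrow> f \<in> measurable M N"
  by (rule measurable_from_subalg[OF filt_subalgebra])

lemma filt_fin_mono: assumes "t \<le> u" shows "sets (filt_fin (ereal s) t) \<subseteq> sets (filt_fin (ereal s) u)"
proof -
  have sub: "(\<Inter>r\<in>{x<..}. sets (natural_filt (ereal s) r)) \<subseteq> Pow paths" for x
  proof
    fix B assume "B \<in> (\<Inter>r\<in>{x<..}. sets (natural_filt (ereal s) r))"
    hence "B \<in> sets (natural_filt (ereal s) (x + 1))" by auto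
    thus "B \<in> Pow paths" using sets_natural_filt_le by blast
  qed
  have "(\<Inter>r\<in>{t<..}. sets (natural_filt (ereal s) r)) \<subseteq> (\<Inter>r\<in>{u<..}. sets (natural_filt (ereal s) r))"
    using assms by auto
  thus ?thesis unfolding filt_fin_def sets_measure_of[OF sub] by (rule sigma_sets_mono')
qed

lemma integrable_bd:
  fixes f :: "(real \<Rightarrow> 'e) \<Rightarrow> real"
  assumes "f \<in> borel_measurable M" "\<And>\<omega>. \<omega> \<in> paths \<Longrightarrow> \<bar>f \<omega>\<bar> \<le> b"
  shows "integrable M f"
  by (rule integrable_const_bound[where B = b, OF _ assms(1)]) (auto simp: assms(2))

lemma state_event: "s \<le> u \<Longrightarrow> u \<le> t \<Longrightarrow> {\<omega>\<in>paths. \<omega> u = j} \<in> sets (filt_fin (ereal s) t)"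
  using measurable_sets[OF measurable_eval[where s = s and u = u and t = t], of "{j}"] by (simp add: vimage_def Int_def conj_commute)

lemma trans_prob_le1: "t \<ge> 0 \<Longrightarrow> trans_prob t r k j \<le> 1" and trans_prob_ge0: "trans_prob t r k j \<ge> 0"
  unfolding trans_prob_def by (auto intro: prob_space.prob_le_1[OF P_prob])

lemma trans_prob_refl:
  assumes t: "t \<ge> 0" shows "trans_prob t t k j = (if j = k then 1 else 0)"
proof (cases "j = k")
  case False
  interpret T: markov_start \<Lambda> P t k by unfold_locales (use fam t in auto)
  have "{\<omega>\<in>paths. \<omega> t = j} \<in> sets T.M" "{\<omega>\<in>paths. \<omega> t = k} \<in> sets T.M"
    using subsetD[OF conjunct2[OF T.filt_subalgebra[OF order_refl, unfolded subalgebra_def]] T.state_event[OF order_refl order_refl]]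
    by blast+
  hence "measure T.M ({\<omega>\<in>paths. \<omega> t = j} \<union> {\<omega>\<in>paths. \<omega> t = k}) = trans_prob t t k j + 1"
    using False by (subst T.finite_measure_Union) (auto simp: trans_prob_def P_start[OF t])
  hence "trans_prob t t k j \<le> 0" using T.prob_le_1[of "{\<omega>\<in>paths. \<omega> t = j} \<union> {\<omega>\<in>paths. \<omega> t = k}"] by simp
  thus ?thesis using False trans_prob_ge0[of t t k j] by simp
qed (simp add: trans_prob_def P_start[OF t])

lemma evol_tp: "t \<ge> 0 \<Longrightarrow> evol P t r (axis j 1) $ k = trans_prob t r k j"
proof -
  assume t: "t \<ge> 0"
  have "evol P t r (axis j 1) $ k = (\<integral>\<omega>. axis j 1 $ (\<omega> r) \<partial>P (ereal t, Some k))" by (simp add: evol_def)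
  also have "\<dots> = (\<integral>\<omega>. indicator {\<omega>\<in>paths. \<omega> r = j} \<omega> \<partial>P (ereal t, Some k))"
    by (rule Bochner_Integration.integral_cong) (auto simp: P_space[OF t] axis_def)
  also have "\<dots> = trans_prob t r k j" by (simp add: trans_prob_def P_space[OF t] Int_absorb2 Collect_mono_iff flip: Collect_conj_eq)
  finally show ?thesis .
qed

lemma trans_prob_continuous: "continuous_on {(t, r). 0 \<le> t \<and> t \<le> r} (\<lambda>(t, r). trans_prob t r k j)"
proof -
  have "continuous_on {(t, r). 0 \<le> t \<and> t \<le> r} (\<lambda>(t, r). evol P t r (axis j 1))"
    using fam by (simp add: canonical_markov_family_def)
  hence "continuous_on {(t, r). 0 \<le> t \<and> t \<le> r} (\<lambda>x. (case x of (t, r) \<Rightarrow> evol P t r (axis j 1)) $ k)"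
    by (intro continuous_intros)
  thus ?thesis by (rule continuous_on_cong[THEN iffD1, rotated 2]) (auto simp: evol_tp)
qed

text \<open>
  The generator property of the evolution system, applied to the indicator of one state.
\<close>

lemma trans_prob_deriv:
  assumes t: "t \<ge> 0"
  shows "((\<lambda>h. (trans_prob t (t + h) k j - (if j = k then 1 else 0)) / h) \<longlongrightarrow> \<Lambda> t $ k $ j) (at_right 0)"
proof -
  have "((\<lambda>h. (1 / h) *\<^sub>R (evol P t (t + h) (axis j 1) - axis j 1)) \<longlongrightarrow> \<Lambda> t *v axis j 1) (at_right 0)"
    using fam t by (simp add: canonical_markov_family_def)
  from tendsto_vec_nth[OF this, of k]
  have "((\<lambda>h. (trans_prob t (t + h) k j - axis j 1 $ k) / h) \<longlongrightarrow> \<Lambda> t $ k $ j) (at_right 0)"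
    using t by (simp add: evol_tp matrix_vector_mult_basis column_def)
  thus ?thesis by (simp add: axis_def eq_commute[of k j])
qed

text \<open>
  The Markov property in the only form used: a weight known at time \<open>t\<close> turns the indicator of a later
  state into its transition probability.
\<close>

lemma markov_expectation:
  assumes tr: "s \<le> t" "t \<le> r" and Z: "Z \<in> borel_measurable (filt_fin (ereal s) t)"
    and b: "\<And>\<omega>. \<omega> \<in> paths \<Longrightarrow> \<bar>Z \<omega>\<bar> \<le> b"
  shows "(\<integral>\<omega>. Z \<omega> * indicator {\<omega>\<in>paths. \<omega> r = j} \<omega> \<partial>M) = (\<integral>\<omega>. Z \<omega> * trans_prob t r (\<omega> t) j \<partial>M)"
proof -
  interpret finite_measure_subalgebra M "filt_fin (ereal s) t" by unfold_locales (rule filt_subalgebra[OF tr(1)])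
  have ZM: "Z \<in> borel_measurable M" by (rule meas_M[OF tr(1) Z])
  have "{\<omega>\<in>paths. \<omega> r = j} \<in> sets M"
    using state_event[of r r j] filt_subalgebra[of r] tr by (auto simp: subalgebra_def)
  hence I: "(indicator {\<omega>\<in>paths. \<omega> r = j} :: _ \<Rightarrow> real) \<in> borel_measurable M" by measurable
  have ti: "(\<lambda>\<omega>. trans_prob t r (\<omega> t) j) \<in> borel_measurable M"
    by (rule measurable_compose[OF meas_M[OF tr(1) measurable_eval]]) (use tr in auto)
  have int: "integrable M (\<lambda>\<omega>. Z \<omega> * indicator {\<omega>\<in>paths. \<omega> r = j} \<omega>)"
    by (rule integrable_bd[of _ b], rule borel_measurable_times[OF ZM I])
      (use b in \<open>auto simp: indicator_def intro: order_trans[OF abs_ge_zero]\<close>)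
  have eq: "{\<omega>'\<in>paths. Xst (ereal r) \<omega>' \<in> {Some j}} = {\<omega>\<in>paths. \<omega> r = j}" by (auto simp: Xst_def)
  have ae: "AE \<omega> in M. real_cond_exp M (filt_fin (ereal s) t) (indicator {\<omega>\<in>paths. \<omega> r = j}) \<omega> = trans_prob t r (\<omega> t) j"
    using P_markov[OF s tr, where k = i and B = "{Some j}", unfolded eq] by (simp add: trans_prob_def Xst_def)
  have "(\<integral>\<omega>. Z \<omega> * trans_prob t r (\<omega> t) j \<partial>M) =
      (\<integral>\<omega>. Z \<omega> * real_cond_exp M (filt_fin (ereal s) t) (indicator {\<omega>\<in>paths. \<omega> r = j}) \<omega> \<partial>M)"
    by (rule integral_cong_AE) (use ZM ti ae in auto)
  also have "\<dots> = (\<integral>\<omega>. Z \<omega> * indicator {\<omega>\<in>paths. \<omega> r = j} \<omega> \<partial>M)"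
    by (rule real_cond_exp_intg(2)[OF int Z I])
  finally show ?thesis by simp
qed

definition jump_sum :: "real \<Rightarrow> real \<Rightarrow> real" where
  "jump_sum a b = (\<Sum>k\<in>UNIV. 1 - trans_prob a b k k)"

text \<open>
  The sum on the right is continuous in \<open>(a, b)\<close> and zero on the diagonal, so a jump at a fixed time has
  probability zero. Right continuity of paths alone would not give the continuity from the left that is
  needed below.
\<close>

lemma jump_probability_le:
  assumes ab: "s \<le> a" "a \<le> b"
  shows "(\<integral>\<omega>. indicator {\<omega>\<in>paths. \<omega> a \<noteq> \<omega> b} \<omega> \<partial>M) \<le> jump_sum a b"
proof -
  have a0: "a \<ge> 0" using s ab by simp
  have sb: "s \<le> b" using ab by simp
  let ?I = "\<lambda>u k. (indicator {\<omega>\<in>paths. \<omega> u = k} :: _ \<Rightarrow> real)"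
  have Ia: "?I a k \<in> borel_measurable (filt_fin (ereal s) a)" for k
    using state_event[OF ab(1) order_refl, of k] by measurable
  have IaM: "?I a k \<in> borel_measurable M" for k by (rule meas_M[OF ab(1) Ia])
  have IbM: "?I b k \<in> borel_measurable M" for k
    by (rule meas_M[OF sb]) (use state_event[OF sb order_refl, of k] in measurable)
  have int: "integrable M (\<lambda>\<omega>. ?I a k \<omega> * ?I b k \<omega>)" for k
    by (rule integrable_bd[of _ 1], rule borel_measurable_times[OF IaM IbM]) (simp add: indicator_def)
  have inta: "integrable M (?I a k)" for k
    by (rule integrable_bd[of _ 1]) (use IaM in \<open>auto simp: indicator_def\<close>)
  have "(\<integral>\<omega>. indicator {\<omega>\<in>paths. \<omega> a \<noteq> \<omega> b} \<omega> \<partial>M) = (\<integral>\<omega>. (\<Sum>k\<in>UNIV. ?I a k \<omega> - ?I a k \<omega> * ?I b k \<omega>) \<partial>M)"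
  proof (rule Bochner_Integration.integral_cong[OF refl])
    fix \<omega> assume "\<omega> \<in> space M"
    hence \<omega>: "\<omega> \<in> paths" by simp
    have "(\<Sum>k\<in>UNIV. ?I a k \<omega> - ?I a k \<omega> * ?I b k \<omega>) = (\<Sum>k\<in>UNIV. if k = \<omega> a then 1 - ?I b k \<omega> else 0)"
      by (rule sum.cong) (use \<omega> in \<open>auto simp: indicator_def\<close>)
    also have "\<dots> = 1 - ?I b (\<omega> a) \<omega>" by (simp add: sum.delta)
    finally show "indicator {\<omega>\<in>paths. \<omega> a \<noteq> \<omega> b} \<omega> = (\<Sum>k\<in>UNIV. ?I a k \<omega> - ?I a k \<omega> * ?I b k \<omega>)"
      using \<omega> by (auto simp: indicator_def)
  qed
  also have "\<dots> = (\<Sum>k\<in>UNIV. (\<integral>\<omega>. ?I a k \<omega> \<partial>M) - (\<integral>\<omega>. ?I a k \<omega> * ?I b k \<omega> \<partial>M))"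
    using int inta by simp
  also have "\<dots> \<le> jump_sum a b" unfolding jump_sum_def
  proof (rule sum_mono)
    fix k
    have "(\<integral>\<omega>. ?I a k \<omega> * ?I b k \<omega> \<partial>M) = (\<integral>\<omega>. ?I a k \<omega> * trans_prob a b (\<omega> a) k \<partial>M)"
      by (rule markov_expectation[OF ab Ia, where b = 1 and j = k]) (simp add: indicator_def)
    also have "\<dots> = (\<integral>\<omega>. ?I a k \<omega> * trans_prob a b k k \<partial>M)"
      by (rule Bochner_Integration.integral_cong) (auto simp: indicator_def)
    also have "\<dots> = (\<integral>\<omega>. ?I a k \<omega> \<partial>M) * trans_prob a b k k" by simp
    finally have e: "(\<integral>\<omega>. ?I a k \<omega> \<partial>M) - (\<integral>\<omega>. ?I a k \<omega> * ?I b k \<omega> \<partial>M) = (\<integral>\<omega>. ?I a k \<omega> \<partial>M) * (1 - trans_prob a b k k)"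
      by (simp add: algebra_simps)
    have "(\<integral>\<omega>. ?I a k \<omega> \<partial>M) \<le> 1" by (simp add: prob_le_1)
    hence "(\<integral>\<omega>. ?I a k \<omega> \<partial>M) * (1 - trans_prob a b k k) \<le> 1 * (1 - trans_prob a b k k)"
      using trans_prob_le1[OF a0, of b k k] by (intro mult_right_mono) auto
    thus "(\<integral>\<omega>. ?I a k \<omega> \<partial>M) - (\<integral>\<omega>. ?I a k \<omega> * ?I b k \<omega> \<partial>M) \<le> 1 - trans_prob a b k k" using e by simp
  qed
  finally show ?thesis .
qed

end

section \<open>The martingale driven by the clock\<close>

text \<open>
  A bounded Lipschitz function whose derivative along the motion in each state is minus the jump term, so
  that its values along \<open>(\<kappa> - clock, time, state)\<close> have no drift.
\<close>

locale additive_dynkin = markov_start +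
  fixes w :: "'a \<Rightarrow> real" and c :: real and U :: "real \<Rightarrow> real \<Rightarrow> 'a \<Rightarrow> real" and B L :: real
  assumes w_le: "\<bar>w j\<bar> \<le> c"
    and U_le: "\<bar>U k t j\<bar> \<le> B"
    and L_nonneg: "L \<ge> 0"
    and U_lip: "t \<ge> 0 \<Longrightarrow> t' \<ge> 0 \<Longrightarrow> \<bar>U k t j - U k' t' j\<bar> \<le> L * (\<bar>k - k'\<bar> + \<bar>t - t'\<bar>)"
    and U_dir: "k > 0 \<Longrightarrow> t \<ge> 0 \<Longrightarrow>
      ((\<lambda>h. (U (k - h * w j) (t + h) j - U k t j) / h) \<longlongrightarrow> - (\<Sum>j'\<in>UNIV. \<Lambda> t $ j $ j' * U k t j')) (at_right 0)"
begin

lemma c_nonneg: "c \<ge> 0" using w_le[of undefined] by linarith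
lemma B_nonneg: "B \<ge> 0" using U_le[of undefined] by (meson abs_ge_zero order_trans)

definition Y :: "real \<Rightarrow> real \<Rightarrow> (real \<Rightarrow> 'a) \<Rightarrow> real" where
  "Y \<kappa> u \<omega> = U (\<kappa> - clock w s u \<omega>) u (\<omega> u)"

lemma U_measurable:
  assumes f: "f \<in> borel_measurable N" and t: "t \<ge> 0" and g: "g \<in> N \<rightarrow>\<^sub>M count_space UNIV"
  shows "(\<lambda>\<omega>. U (f \<omega>) t (g \<omega>)) \<in> borel_measurable N"
proof (rule measurable_compose_countable[where f = "\<lambda>j \<omega>. U (f \<omega>) t j", OF _ g])
  fix j
  have "continuous_on UNIV (\<lambda>k. U k t j)"
    by (rule lipschitz_on_continuous_on[of L], rule lipschitz_onI)
       (use U_lip[OF t t] L_nonneg in \<open>auto simp: dist_real_def\<close>)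
  hence "(\<lambda>k. U k t j) \<in> borel_measurable borel" by (rule borel_measurable_continuous_onI)
  thus "(\<lambda>\<omega>. U (f \<omega>) t j) \<in> borel_measurable N" by (rule measurable_compose[OF f])
qed

lemma Y_measurable: "s \<le> u \<Longrightarrow> u \<le> t \<Longrightarrow> Y \<kappa> u \<in> borel_measurable (filt_fin (ereal s) t)"
  unfolding Y_def using s
  by (intro U_measurable borel_measurable_diff borel_measurable_const clock_measurable measurable_eval) auto

lemma Y_measurable_M: "s \<le> u \<Longrightarrow> Y \<kappa> u \<in> borel_measurable M"
  by (rule meas_M[OF _ Y_measurable]) auto

lemma Y_le: "\<bar>Y \<kappa> u \<omega>\<bar> \<le> B" unfolding Y_def by (rule U_le)

lemma Y_increment:
  assumes ab: "s \<le> a" "a \<le> b" and A: "A \<in> sets M"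
  shows "\<bar>(\<integral>\<omega>. indicator A \<omega> * Y \<kappa> b \<omega> \<partial>M) - (\<integral>\<omega>. indicator A \<omega> * Y \<kappa> a \<omega> \<partial>M)\<bar>
    \<le> L * (c + 1) * (b - a) + 2 * B * jump_sum a b"
proof -
  let ?Ia = "(\<integral>\<omega>. indicator A \<omega> * Y \<kappa> a \<omega> \<partial>M)" and ?Ib = "(\<integral>\<omega>. indicator A \<omega> * Y \<kappa> b \<omega> \<partial>M)"
  have sb: "s \<le> b" using ab by simp
  let ?J = "\<lambda>\<omega>. indicator {\<omega>\<in>paths. \<omega> a \<noteq> \<omega> b} \<omega> :: real"
  have IA: "(indicator A :: _ \<Rightarrow> real) \<in> borel_measurable M" using A by (rule borel_measurable_indicator)
  have int: "integrable M (\<lambda>\<omega>. indicator A \<omega> * Y \<kappa> u \<omega>)" if "s \<le> u" for u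
    by (rule integrable_bd[of _ B], rule borel_measurable_times[OF IA Y_measurable_M[OF that]])
       (use Y_le B_nonneg in \<open>auto simp: indicator_def\<close>)
  have e: "s \<le> u \<Longrightarrow> (\<lambda>\<omega>. \<omega> u) \<in> M \<rightarrow>\<^sub>M count_space UNIV" for u
    by (rule meas_M[OF _ measurable_eval]) auto
  have "(\<lambda>\<omega>. (\<omega> a, \<omega> b)) \<in> M \<rightarrow>\<^sub>M count_space UNIV"
    using measurable_Pair[OF e[OF ab(1)] e[OF sb]] by (simp add: pair_measure_countable countable_finite)
  from measurable_sets[OF this, of "{x. fst x \<noteq> snd x}"]
  have J: "{\<omega>\<in>paths. \<omega> a \<noteq> \<omega> b} \<in> sets M" by (simp add: vimage_def Int_def conj_commute)
  have intJ: "integrable M ?J" by (rule integrable_bd[of _ 1], rule borel_measurable_indicator[OF J]) (simp add: indicator_def)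
  have pt: "\<bar>indicator A \<omega> * Y \<kappa> b \<omega> - indicator A \<omega> * Y \<kappa> a \<omega>\<bar> \<le> L * (c + 1) * (b - a) + 2 * B * ?J \<omega>"
    if \<omega>: "\<omega> \<in> paths" for \<omega>
  proof -
    have "\<bar>Y \<kappa> b \<omega> - Y \<kappa> a \<omega>\<bar> \<le> L * (c + 1) * (b - a) + 2 * B * ?J \<omega>"
    proof (cases "\<omega> a = \<omega> b")
      case True
      have "\<bar>Y \<kappa> b \<omega> - Y \<kappa> a \<omega>\<bar> \<le> L * (\<bar>(\<kappa> - clock w s b \<omega>) - (\<kappa> - clock w s a \<omega>)\<bar> + \<bar>b - a\<bar>)"
        unfolding Y_def True by (rule U_lip) (use s ab in auto)
      also have "\<dots> \<le> L * (c * (b - a) + (b - a))"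
        using clock_lipschitz[OF \<omega> s ab, of w c] w_le ab
        by (intro mult_left_mono L_nonneg add_mono) (auto simp: abs_minus_commute)
      finally show ?thesis using B_nonneg by (simp add: algebra_simps indicator_def)
    next
      case False
      have "\<bar>Y \<kappa> b \<omega> - Y \<kappa> a \<omega>\<bar> \<le> B + B"
        by (rule order_trans[OF abs_triangle_ineq4 add_mono[OF Y_le Y_le]])
      moreover have "L * (c + 1) * (b - a) \<ge> 0" using L_nonneg c_nonneg ab by simp
      ultimately show ?thesis using False \<omega> by (simp add: indicator_def)
    qed
    moreover have "0 \<le> \<bar>Y \<kappa> b \<omega> - Y \<kappa> a \<omega>\<bar>" by simp
    ultimately show ?thesis by (cases "\<omega> \<in> A") (auto intro: order_trans)
  qed
  have "\<bar>?Ib - ?Ia\<bar>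
     = \<bar>\<integral>\<omega>. indicator A \<omega> * Y \<kappa> b \<omega> - indicator A \<omega> * Y \<kappa> a \<omega> \<partial>M\<bar>"
    using int[OF ab(1)] int[OF sb] by simp
  also have "\<dots> \<le> (\<integral>\<omega>. \<bar>indicator A \<omega> * Y \<kappa> b \<omega> - indicator A \<omega> * Y \<kappa> a \<omega>\<bar> \<partial>M)" by (rule integral_abs_bound)
  also have "\<dots> \<le> (\<integral>\<omega>. L * (c + 1) * (b - a) + 2 * B * ?J \<omega> \<partial>M)"
    by (rule integral_mono)
       (use pt int[OF ab(1)] int[OF sb] intJ in \<open>auto intro!: integrable_abs Bochner_Integration.integrable_diff Bochner_Integration.integrable_add integrable_mult_right\<close>)
  also have "\<dots> = L * (c + 1) * (b - a) + 2 * B * (\<integral>\<omega>. ?J \<omega> \<partial>M)"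
    using intJ by (subst Bochner_Integration.integral_add) (auto simp: prob_space[unfolded space_M])
  also have "\<dots> \<le> L * (c + 1) * (b - a) + 2 * B * jump_sum a b"
    using jump_probability_le[OF ab] B_nonneg by (intro add_left_mono mult_left_mono) auto
  finally show ?thesis .
qed

lemma jump_sum_small:
  assumes "u \<ge> 0"
  shows "((\<lambda>x. jump_sum (min x u) (max x u)) \<longlongrightarrow> 0) (at u within {0..})"
proof -
  have "((\<lambda>x. trans_prob (min x u) (max x u) k k) \<longlongrightarrow> trans_prob (min u u) (max u u) k k) (at u within {0..})" for k
  proof -
    have "continuous_on {0..} (\<lambda>x. case (min x u, max x u) of (t, r) \<Rightarrow> trans_prob t r k k)"
      by (rule continuous_on_compose2[OF trans_prob_continuous]) (use assms in \<open>auto intro!: continuous_intros\<close>)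
    from this[unfolded continuous_on_def, THEN bspec, of u] assms
    show ?thesis by (simp only: prod.case atLeast_iff)
  qed
  hence "((\<lambda>x. jump_sum (min x u) (max x u)) \<longlongrightarrow> jump_sum (min u u) (max u u)) (at u within {0..})"
    unfolding jump_sum_def by (intro tendsto_sum tendsto_diff tendsto_const)
  thus ?thesis using assms by (simp add: jump_sum_def trans_prob_refl)
qed

lemma Y_expectation_continuous:
  assumes A: "A \<in> sets M" and t: "s \<le> t"
  shows "continuous_on {t..t'} (\<lambda>u. \<integral>\<omega>. indicator A \<omega> * Y \<kappa> u \<omega> \<partial>M)"
  unfolding continuous_on_def
proof
  let ?D = "\<lambda>u. \<integral>\<omega>. indicator A \<omega> * Y \<kappa> u \<omega> \<partial>M"
  fix u assume u: "u \<in> {t..t'}"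
  have u0: "u \<ge> 0" using u t s by simp
  let ?g = "\<lambda>x. L * (c + 1) * \<bar>x - u\<bar> + 2 * B * jump_sum (min x u) (max x u)"
  have "((\<lambda>x. jump_sum (min x u) (max x u)) \<longlongrightarrow> 0) (at u within {t..t'})"
    by (rule tendsto_within_subset[OF jump_sum_small[OF u0]]) (use t s in auto)
  hence g: "(?g \<longlongrightarrow> L * (c + 1) * \<bar>u - u\<bar> + 2 * B * 0) (at u within {t..t'})" by (intro tendsto_intros)
  have "((\<lambda>x. ?D x - ?D u) \<longlongrightarrow> 0) (at u within {t..t'})"
  proof (rule Lim_null_comparison)
    show "eventually (\<lambda>x. norm (?D x - ?D u) \<le> ?g x) (at u within {t..t'})"
      unfolding eventually_at_filter
    proof (intro always_eventually allI impI)
      fix x assume "x \<in> {t..t'}"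
      hence x: "s \<le> x" and su: "s \<le> u" using t u by auto
      show "norm (?D x - ?D u) \<le> ?g x"
      proof (cases "x \<le> u")
        case True
        thus ?thesis using Y_increment[OF x True A, of \<kappa>] by (simp add: abs_minus_commute)
      next
        case False
        thus ?thesis using Y_increment[OF su _ A, of x \<kappa>] by simp
      qed
    qed
  qed (use g in simp)
  thus "(?D \<longlongrightarrow> ?D u) (at u within {t..t'})" by (rule LIM_zero_cancel)
qed

text \<open>
  The increment is split at an intermediate value \<open>V\<close>: the clock is moved by its linear part \<open>h w\<close> only, and the
  state is the one at time \<open>u + h\<close>. The first part \<open>T1\<close> vanishes for small \<open>h\<close> on each path, because the
  clock is linear there. In the second part \<open>T2\<close> everything but the state at \<open>u + h\<close> is known at time \<open>u\<close>, so
  the Markov property replaces the state by transition probabilities, and the pointwise limit is the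
  derivative along the characteristic plus the jump term, which is zero.
\<close>

lemma Y_expectation_right_deriv:
  assumes A: "A \<in> sets (filt_fin (ereal s) u)" and u: "s \<le> u"
    and pos: "\<And>\<omega>. \<omega> \<in> A \<Longrightarrow> clock w s u \<omega> < \<kappa>"
  shows "((\<lambda>h. ((\<integral>\<omega>. indicator A \<omega> * Y \<kappa> (u + h) \<omega> \<partial>M) - (\<integral>\<omega>. indicator A \<omega> * Y \<kappa> u \<omega> \<partial>M)) / h) \<longlongrightarrow> 0) (at_right 0)"
proof -
  have u0: "u \<ge> 0" using u s by simp
  let ?I = "indicator A :: _ \<Rightarrow> real"
  let ?k = "\<lambda>\<omega>. \<kappa> - clock w s u \<omega>"
  define V where "V = (\<lambda>h j \<omega>. U (?k \<omega> - h * w (\<omega> u)) (u + h) j)"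
  define T1 where "T1 = (\<lambda>h \<omega>. ?I \<omega> * (Y \<kappa> (u + h) \<omega> - V h (\<omega> (u + h)) \<omega>) / h)"
  define T2 where "T2 = (\<lambda>h \<omega>. ?I \<omega> * ((\<Sum>j\<in>UNIV. V h j \<omega> * trans_prob u (u + h) (\<omega> u) j) - Y \<kappa> u \<omega>) / h)"
  have Afu: "?I \<in> borel_measurable (filt_fin (ereal s) u)" using A by (rule borel_measurable_indicator)
  have IM: "?I \<in> borel_measurable M" by (rule meas_M[OF u Afu])
  have ev: "(\<lambda>\<omega>. \<omega> r) \<in> filt_fin (ereal s) r' \<rightarrow>\<^sub>M count_space UNIV" if "s \<le> r" "r \<le> r'" for r r'
    by (rule measurable_eval[OF that])
  have evM: "(\<lambda>\<omega>. \<omega> r) \<in> M \<rightarrow>\<^sub>M count_space UNIV" if "s \<le> r" for r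
    by (rule meas_M[OF that ev[OF that order_refl]])
  have wm: "(\<lambda>\<omega>. w (\<omega> u)) \<in> borel_measurable (filt_fin (ereal s) u)"
    by (rule measurable_compose[OF ev[OF u order_refl]]) simp
  have km: "(\<lambda>\<omega>. ?k \<omega> - h * w (\<omega> u)) \<in> borel_measurable (filt_fin (ereal s) u)" for h
    by (intro borel_measurable_diff borel_measurable_times borel_measurable_const wm clock_measurable) (use s u in auto)
  have Vm: "V h j \<in> borel_measurable (filt_fin (ereal s) u)" if "h > 0" for h j
    unfolding V_def by (rule U_measurable[OF km]) (use u0 that in auto)
  have VMj: "(\<lambda>\<omega>. V h (\<omega> (u + h)) \<omega>) \<in> borel_measurable M" if "h > 0" for h
    unfolding V_def by (rule U_measurable[OF meas_M[OF u km]]) (use u u0 that in \<open>auto intro!: evM\<close>)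
  have tpm: "(\<lambda>\<omega>. trans_prob u r (\<omega> u) j) \<in> borel_measurable M" for r j
    by (rule measurable_compose[OF evM[OF u]]) simp
  have Vle: "\<bar>V h j \<omega>\<bar> \<le> B" for h j \<omega> unfolding V_def by (rule U_le)
  have Ile: "\<bar>?I \<omega> * x\<bar> \<le> \<bar>x\<bar>" for \<omega> x by (simp add: indicator_def)
  have T1m: "T1 h \<in> borel_measurable M" if "h > 0" for h
    unfolding T1_def using that u
    by (intro borel_measurable_divide borel_measurable_times borel_measurable_diff IM Y_measurable_M VMj borel_measurable_const) auto
  have T2m: "T2 h \<in> borel_measurable M" if "h > 0" for h
    unfolding T2_def using u
    by (intro borel_measurable_divide borel_measurable_times borel_measurable_diff borel_measurable_sum IM Y_measurable_M meas_M[OF u Vm[OF that]] tpm borel_measurable_const)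
  have split: "((\<integral>\<omega>. ?I \<omega> * Y \<kappa> (u + h) \<omega> \<partial>M) - (\<integral>\<omega>. ?I \<omega> * Y \<kappa> u \<omega> \<partial>M)) / h
      = (\<integral>\<omega>. T1 h \<omega> \<partial>M) + (\<integral>\<omega>. T2 h \<omega> \<partial>M)" if h: "h > 0" for h
  proof -
    let ?Y0 = "(\<integral>\<omega>. ?I \<omega> * Y \<kappa> u \<omega> \<partial>M)" and ?Y1 = "(\<integral>\<omega>. ?I \<omega> * Y \<kappa> (u + h) \<omega> \<partial>M)"
      and ?V1 = "(\<integral>\<omega>. ?I \<omega> * V h (\<omega> (u + h)) \<omega> \<partial>M)"
    have iY: "integrable M (\<lambda>\<omega>. ?I \<omega> * Y \<kappa> r \<omega>)" if "s \<le> r" for r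
      by (rule integrable_bd[of _ B], rule borel_measurable_times[OF IM Y_measurable_M[OF that]])
         (rule order_trans[OF Ile Y_le])
    have iV: "integrable M (\<lambda>\<omega>. ?I \<omega> * V h (\<omega> (u + h)) \<omega>)"
      by (rule integrable_bd[of _ B], rule borel_measurable_times[OF IM VMj[OF h]]) (rule order_trans[OF Ile Vle])
    have IVm: "(\<lambda>\<omega>. ?I \<omega> * V h j \<omega>) \<in> borel_measurable (filt_fin (ereal s) u)" for j
      by (rule borel_measurable_times[OF Afu Vm[OF h]])
    let ?J = "\<lambda>j. (indicator {\<omega>\<in>paths. \<omega> (u + h) = j} :: _ \<Rightarrow> real)"
    have Jm: "?J j \<in> borel_measurable M" for j
      by (rule meas_M[of "u + h"]) (use u h state_event[of "u + h" "u + h" j] in \<open>auto intro!: borel_measurable_indicator\<close>)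
    have iVJ: "integrable M (\<lambda>\<omega>. ?I \<omega> * V h j \<omega> * ?J j \<omega>)" for j
      by (rule integrable_bd[of _ B], rule borel_measurable_times[OF meas_M[OF u IVm] Jm])
         (use Vle B_nonneg in \<open>simp add: indicator_def\<close>)
    have iVt: "integrable M (\<lambda>\<omega>. ?I \<omega> * V h j \<omega> * trans_prob u (u + h) (\<omega> u) j)" for j
    proof (rule integrable_bd[of _ B], rule borel_measurable_times[OF meas_M[OF u IVm] tpm])
      fix \<omega>
      have "\<bar>?I \<omega> * V h j \<omega> * trans_prob u (u + h) (\<omega> u) j\<bar> = \<bar>?I \<omega> * V h j \<omega>\<bar> * \<bar>trans_prob u (u + h) (\<omega> u) j\<bar>" by (simp add: abs_mult)
      also have "\<dots> \<le> B * 1"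
        by (intro mult_mono order_trans[OF Ile Vle]) (use trans_prob_le1[OF u0] trans_prob_ge0 B_nonneg in auto)
      finally show "\<bar>?I \<omega> * V h j \<omega> * trans_prob u (u + h) (\<omega> u) j\<bar> \<le> B" by simp
    qed
    have "?V1 = (\<integral>\<omega>. (\<Sum>j\<in>UNIV. ?I \<omega> * V h j \<omega> * ?J j \<omega>) \<partial>M)"
    proof (rule Bochner_Integration.integral_cong[OF refl])
      fix \<omega> assume "\<omega> \<in> space M"
      hence "(\<Sum>j\<in>UNIV. ?I \<omega> * V h j \<omega> * ?J j \<omega>) = (\<Sum>j\<in>UNIV. if j = \<omega> (u + h) then ?I \<omega> * V h j \<omega> else 0)"
        by (intro sum.cong refl) (auto simp: indicator_def)
      also have "\<dots> = ?I \<omega> * V h (\<omega> (u + h)) \<omega>" by (simp add: sum.delta)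
      finally show "?I \<omega> * V h (\<omega> (u + h)) \<omega> = (\<Sum>j\<in>UNIV. ?I \<omega> * V h j \<omega> * ?J j \<omega>)" by simp
    qed
    also have "\<dots> = (\<Sum>j\<in>UNIV. \<integral>\<omega>. ?I \<omega> * V h j \<omega> * ?J j \<omega> \<partial>M)"
      by (rule Bochner_Integration.integral_sum[OF iVJ])
    also have "\<dots> = (\<Sum>j\<in>UNIV. \<integral>\<omega>. ?I \<omega> * V h j \<omega> * trans_prob u (u + h) (\<omega> u) j \<partial>M)"
      by (intro sum.cong refl markov_expectation[OF u _ IVm, of _ _ B])
         (use h order_trans[OF Ile Vle] in auto)
    also have "\<dots> = (\<integral>\<omega>. (\<Sum>j\<in>UNIV. ?I \<omega> * V h j \<omega> * trans_prob u (u + h) (\<omega> u) j) \<partial>M)"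
      by (rule Bochner_Integration.integral_sum[OF iVt, symmetric])
    finally have key: "?V1 = (\<integral>\<omega>. (\<Sum>j\<in>UNIV. ?I \<omega> * V h j \<omega> * trans_prob u (u + h) (\<omega> u) j) \<partial>M)" .
    have "(\<integral>\<omega>. T1 h \<omega> \<partial>M) = (\<integral>\<omega>. (?I \<omega> * Y \<kappa> (u + h) \<omega> - ?I \<omega> * V h (\<omega> (u + h)) \<omega>) / h \<partial>M)"
      by (simp add: T1_def right_diff_distrib)
    also have "\<dots> = (?Y1 - ?V1) / h"
      using iY[of "u + h"] iV u h by simp
    finally have 1: "(\<integral>\<omega>. T1 h \<omega> \<partial>M) = (?Y1 - ?V1) / h" .
    have "(\<integral>\<omega>. T2 h \<omega> \<partial>M) = (\<integral>\<omega>. ((\<Sum>j\<in>UNIV. ?I \<omega> * V h j \<omega> * trans_prob u (u + h) (\<omega> u) j) - ?I \<omega> * Y \<kappa> u \<omega>) / h \<partial>M)"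
      by (simp add: T2_def right_diff_distrib sum_distrib_left mult.assoc)
    also have "\<dots> = ((\<integral>\<omega>. (\<Sum>j\<in>UNIV. ?I \<omega> * V h j \<omega> * trans_prob u (u + h) (\<omega> u) j) \<partial>M) - ?Y0) / h"
      using iY[OF u] iVt by (simp add: Bochner_Integration.integral_diff Bochner_Integration.integrable_sum)
    finally show ?thesis using 1 key by (simp add: diff_divide_distrib)
  qed
  have t1: "((\<lambda>h. \<integral>\<omega>. T1 h \<omega> \<partial>M) \<longlongrightarrow> (\<integral>\<omega>. 0 \<partial>M)) (at_right 0)"
  proof (rule integral_tendsto_at_right[where B = "2 * c * L", OF prob_space_axioms T1m])
    have bd: "\<bar>T1 h \<omega>\<bar> \<le> L * \<bar>clock w s (u + h) \<omega> - clock w s u \<omega> - h * w (\<omega> u)\<bar> / h" if h: "h > 0" for h \<omega>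
    proof -
      have "\<bar>T1 h \<omega>\<bar> = \<bar>?I \<omega> * (Y \<kappa> (u + h) \<omega> - V h (\<omega> (u + h)) \<omega>)\<bar> / h" using h by (simp add: T1_def abs_divide)
      also have "\<dots> \<le> \<bar>Y \<kappa> (u + h) \<omega> - V h (\<omega> (u + h)) \<omega>\<bar> / h"
        using h by (intro divide_right_mono Ile) simp
      also have "\<dots> \<le> L * (\<bar>(\<kappa> - clock w s (u + h) \<omega>) - (?k \<omega> - h * w (\<omega> u))\<bar> + \<bar>(u + h) - (u + h)\<bar>) / h"
        unfolding Y_def V_def using h u0 by (intro divide_right_mono U_lip) auto
      also have "\<bar>(\<kappa> - clock w s (u + h) \<omega>) - (?k \<omega> - h * w (\<omega> u))\<bar> = \<bar>clock w s (u + h) \<omega> - clock w s u \<omega> - h * w (\<omega> u)\<bar>" by linarith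
      finally show ?thesis by simp
    qed
    show "eventually (\<lambda>h. \<forall>\<omega>\<in>space M. \<bar>T1 h \<omega>\<bar> \<le> 2 * c * L) (at_right 0)"
      using eventually_at_right_less[of 0]
    proof (eventually_elim, intro ballI)
      fix h \<omega> assume h: "(0::real) < h" and "\<omega> \<in> space M"
      hence \<omega>: "\<omega> \<in> paths" by simp
      have "\<bar>clock w s (u + h) \<omega> - clock w s u \<omega>\<bar> \<le> c * h"
        using clock_lipschitz[OF \<omega> s u, of "u + h" w c] w_le h by simp
      moreover have "\<bar>h * w (\<omega> u)\<bar> \<le> c * h" using w_le[of "\<omega> u"] h by (simp add: abs_mult mult.commute mult_right_mono)
      ultimately have "\<bar>clock w s (u + h) \<omega> - clock w s u \<omega> - h * w (\<omega> u)\<bar> \<le> 2 * c * h" by linarith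
      hence "L * \<bar>clock w s (u + h) \<omega> - clock w s u \<omega> - h * w (\<omega> u)\<bar> / h \<le> L * (2 * c * h) / h"
        using h L_nonneg by (intro divide_right_mono mult_left_mono) auto
      with bd[OF h, of \<omega>] show "\<bar>T1 h \<omega>\<bar> \<le> 2 * c * L" using h by (simp add: mult.commute)
    qed
    fix \<omega> assume "\<omega> \<in> space M"
    hence \<omega>: "\<omega> \<in> paths" by simp
    obtain d where d: "d > 0" "\<forall>h\<in>{0..d}. clock w s (u + h) \<omega> = clock w s u \<omega> + h * w (\<omega> u)"
      using clock_right_linear[where w = w, OF \<omega> s u w_le] by blast
    have "eventually (\<lambda>h. T1 h \<omega> = 0) (at_right 0)"
      using eventually_at_right_real[OF d(1)]
    proof eventually_elim
      case (elim h)
      hence "\<bar>T1 h \<omega>\<bar> \<le> 0" using bd[of h \<omega>] d(2) by simp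
      thus ?case by simp
    qed
    thus "((\<lambda>h. T1 h \<omega>) \<longlongrightarrow> 0) (at_right 0)" by (rule tendsto_eventually)
  qed simp_all
  let ?\<delta> = "\<lambda>k j. if j = k then 1 else 0 :: real"
  have T2_eq: "T2 h \<omega> = ?I \<omega> * ((U (?k \<omega> - h * w (\<omega> u)) (u + h) (\<omega> u) - U (?k \<omega>) u (\<omega> u)) / h
      + (\<Sum>j\<in>UNIV. V h j \<omega> * ((trans_prob u (u + h) (\<omega> u) j - ?\<delta> (\<omega> u) j) / h)))" if h: "h > 0" for h \<omega>
  proof -
    have "(\<Sum>j\<in>UNIV. V h j \<omega> * ?\<delta> (\<omega> u) j) = V h (\<omega> u) \<omega>" by (simp add: if_distrib cong: if_cong)
    hence "(\<Sum>j\<in>UNIV. V h j \<omega> * ((trans_prob u (u + h) (\<omega> u) j - ?\<delta> (\<omega> u) j) / h)) =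
       ((\<Sum>j\<in>UNIV. V h j \<omega> * trans_prob u (u + h) (\<omega> u) j) - V h (\<omega> u) \<omega>) / h"
      by (simp add: right_diff_distrib sum_subtractf flip: sum_divide_distrib)
    moreover have "a * (x - y) / h = a * ((z - y) / h + (x - z) / h)" for a x y z :: real
      using h by (simp add: field_simps)
    ultimately show ?thesis unfolding T2_def Y_def by (simp only: V_def)
  qed
  let ?Bd = "(\<Sum>k\<in>UNIV. \<Sum>j\<in>UNIV. B * (\<bar>\<Lambda> u $ k $ j\<bar> + 1))"
  have t2: "((\<lambda>h. \<integral>\<omega>. T2 h \<omega> \<partial>M) \<longlongrightarrow> (\<integral>\<omega>. 0 \<partial>M)) (at_right 0)"
  proof (rule integral_tendsto_at_right[where B = "L * (c + 1) + ?Bd", OF prob_space_axioms T2m])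
    have "eventually (\<lambda>h. \<bar>(trans_prob u (u + h) k j - ?\<delta> k j) / h\<bar> < \<bar>\<Lambda> u $ k $ j\<bar> + 1) (at_right 0)" for k j
      by (rule order_tendstoD(2)[OF tendsto_rabs[OF trans_prob_deriv[OF u0]]]) simp
    hence "eventually (\<lambda>h. \<forall>k j. \<bar>(trans_prob u (u + h) k j - ?\<delta> k j) / h\<bar> < \<bar>\<Lambda> u $ k $ j\<bar> + 1) (at_right 0)"
      by (intro eventually_all_finite)
    thus "eventually (\<lambda>h. \<forall>\<omega>\<in>space M. \<bar>T2 h \<omega>\<bar> \<le> L * (c + 1) + ?Bd) (at_right 0)"
      using eventually_at_right_less[of 0]
    proof (eventually_elim, intro ballI)
      fix h :: real and \<omega> :: "real \<Rightarrow> 'a"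
      assume tpb: "\<forall>k j. \<bar>(trans_prob u (u + h) k j - ?\<delta> k j) / h\<bar> < \<bar>\<Lambda> u $ k $ j\<bar> + 1" and h: "0 < h"
      define k where "k = \<omega> u"
      have "\<bar>U (?k \<omega> - h * w k) (u + h) k - U (?k \<omega>) u k\<bar> \<le> L * (\<bar>(?k \<omega> - h * w k) - ?k \<omega>\<bar> + \<bar>(u + h) - u\<bar>)"
        using u0 h by (intro U_lip) auto
      also have "\<dots> = L * (h * \<bar>w k\<bar> + h)" using h by (simp add: abs_mult)
      also have "\<dots> \<le> L * (h * c + h)" using w_le[of k] h L_nonneg by (intro mult_left_mono add_right_mono) auto
      finally have a: "\<bar>(U (?k \<omega> - h * w k) (u + h) k - U (?k \<omega>) u k) / h\<bar> \<le> L * (c + 1)"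
        using h by (simp add: abs_divide divide_le_eq algebra_simps)
      have "\<bar>\<Sum>j\<in>UNIV. V h j \<omega> * ((trans_prob u (u + h) k j - ?\<delta> k j) / h)\<bar> \<le> (\<Sum>j\<in>UNIV. B * (\<bar>\<Lambda> u $ k $ j\<bar> + 1))"
        by (rule order_trans[OF sum_abs sum_mono], subst abs_mult, rule mult_mono)
           (use Vle B_nonneg less_imp_le[OF tpb[rule_format]] in auto)
      also have "\<dots> \<le> ?Bd"
        by (rule member_le_sum) (use B_nonneg in \<open>auto intro!: sum_nonneg\<close>)
      finally have b: "\<bar>\<Sum>j\<in>UNIV. V h j \<omega> * ((trans_prob u (u + h) k j - ?\<delta> k j) / h)\<bar> \<le> ?Bd" .
      show "\<bar>T2 h \<omega>\<bar> \<le> L * (c + 1) + ?Bd"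
        unfolding T2_eq[OF h] k_def[symmetric] by (rule order_trans[OF Ile]) (rule order_trans[OF abs_triangle_ineq add_mono[OF a b]])
    qed
    fix \<omega> assume "\<omega> \<in> space M"
    show "((\<lambda>h. T2 h \<omega>) \<longlongrightarrow> 0) (at_right 0)"
    proof (cases "\<omega> \<in> A")
      case False
      thus ?thesis by (simp add: T2_def)
    next
      case True
      define k where "k = \<omega> u"
      have kpos: "?k \<omega> > 0" using pos[OF True] by simp
      have Vlim: "((\<lambda>h. V h j \<omega>) \<longlongrightarrow> U (?k \<omega>) u j) (at_right 0)" for j
      proof (rule LIM_zero_cancel, rule Lim_null_comparison)
        show "eventually (\<lambda>h. norm (V h j \<omega> - U (?k \<omega>) u j) \<le> L * (\<bar>h * w k\<bar> + \<bar>h\<bar>)) (at_right 0)"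
          using eventually_at_right_less[of 0]
        proof eventually_elim
          case (elim h)
          have "\<bar>V h j \<omega> - U (?k \<omega>) u j\<bar> \<le> L * (\<bar>?k \<omega> - h * w (\<omega> u) - ?k \<omega>\<bar> + \<bar>u + h - u\<bar>)"
            unfolding V_def using elim u0 by (intro U_lip) auto
          thus ?case by (simp add: k_def)
        qed
        have "((\<lambda>h. L * (\<bar>h * w k\<bar> + \<bar>h\<bar>)) \<longlongrightarrow> L * (\<bar>0 * w k\<bar> + \<bar>0\<bar>)) (at_right 0)" by (intro tendsto_intros)
        thus "((\<lambda>h. L * (\<bar>h * w k\<bar> + \<bar>h\<bar>)) \<longlongrightarrow> 0) (at_right 0)" by simp
      qed
      have "((\<lambda>h. (U (?k \<omega> - h * w k) (u + h) k - U (?k \<omega>) u k) / h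
         + (\<Sum>j\<in>UNIV. V h j \<omega> * ((trans_prob u (u + h) k j - ?\<delta> k j) / h))) \<longlongrightarrow>
         - (\<Sum>j\<in>UNIV. \<Lambda> u $ k $ j * U (?k \<omega>) u j) + (\<Sum>j\<in>UNIV. U (?k \<omega>) u j * \<Lambda> u $ k $ j)) (at_right 0)"
        by (intro tendsto_add U_dir kpos u0 tendsto_sum tendsto_mult Vlim trans_prob_deriv)
      hence "((\<lambda>h. (U (?k \<omega> - h * w k) (u + h) k - U (?k \<omega>) u k) / h
         + (\<Sum>j\<in>UNIV. V h j \<omega> * ((trans_prob u (u + h) k j - ?\<delta> k j) / h))) \<longlongrightarrow> 0) (at_right 0)"
        by (simp add: mult.commute)
      thus ?thesis
      proof (rule Lim_transform_eventually)
        show "eventually (\<lambda>h. (U (?k \<omega> - h * w k) (u + h) k - U (?k \<omega>) u k) / h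
         + (\<Sum>j\<in>UNIV. V h j \<omega> * ((trans_prob u (u + h) k j - ?\<delta> k j) / h)) = T2 h \<omega>) (at_right 0)"
          using eventually_at_right_less[of 0] by eventually_elim (use True in \<open>simp add: T2_eq k_def\<close>)
      qed
    qed
  qed simp_all
  have "((\<lambda>h. (\<integral>\<omega>. T1 h \<omega> \<partial>M) + (\<integral>\<omega>. T2 h \<omega> \<partial>M)) \<longlongrightarrow> 0) (at_right 0)"
    using tendsto_add[OF t1 t2] by simp
  thus ?thesis
    by (rule Lim_transform_eventually)
       (use eventually_at_right_less[of 0] in eventually_elim, simp add: split)
qed

text \<open>
  On \<open>A\<close> the clock stays below \<open>\<kappa>\<close> up to \<open>t'\<close> since it moves with speed at most \<open>c\<close>. The expectation is then
  a continuous function of time with zero right derivative, hence constant.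
\<close>

lemma Y_martingale_step:
  assumes A: "A \<in> sets (filt_fin (ereal s) t)" and t: "s \<le> t" "t \<le> t'"
    and pos: "\<And>\<omega>. \<omega> \<in> A \<Longrightarrow> clock w s t \<omega> + c * (t' - t) < \<kappa>"
  shows "(\<integral>\<omega>. indicator A \<omega> * Y \<kappa> t' \<omega> \<partial>M) = (\<integral>\<omega>. indicator A \<omega> * Y \<kappa> t \<omega> \<partial>M)"
proof -
  let ?D = "\<lambda>u. \<integral>\<omega>. indicator A \<omega> * Y \<kappa> u \<omega> \<partial>M"
  have AM: "A \<in> sets M" using A filt_subalgebra[OF t(1)] by (auto simp: subalgebra_def)
  have "\<bar>?D t' - ?D t\<bar> \<le> 0 * (t' - t)"
  proof (rule right_derivative_bound[OF t(2) Y_expectation_continuous[OF AM t(1)]])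
    fix u assume u: "t \<le> u" "u < t'"
    have "A \<in> sets (filt_fin (ereal s) u)" using A filt_fin_mono[OF u(1)] by blast
    moreover have "clock w s u \<omega> < \<kappa>" if "\<omega> \<in> A" for \<omega>
    proof -
      have "\<omega> \<in> paths" using that sets_filt_fin_le[OF A] by blast
      from clock_lipschitz[OF this s t(1) u(1), of w c] w_le
      have "clock w s u \<omega> \<le> clock w s t \<omega> + c * (u - t)" by (simp add: abs_le_iff)
      also have "\<dots> \<le> clock w s t \<omega> + c * (t' - t)" using c_nonneg u by (intro add_left_mono mult_left_mono) auto
      finally show ?thesis using pos[OF that] by simp
    qed
    ultimately have "((\<lambda>h. (?D (u + h) - ?D u) / h) \<longlongrightarrow> 0) (at_right 0)"
      using u t by (intro Y_expectation_right_deriv) auto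
    thus "\<exists>d. \<bar>d\<bar> \<le> 0 \<and> ((\<lambda>h. (?D (u + h) - ?D u) / h) \<longlongrightarrow> d) (at_right 0)"
      by (intro exI[of _ 0]) simp
  qed
  thus ?thesis by simp
qed

section \<open>Stopping at the passage time\<close>

text \<open>
  For \<open>w = speed v \<sigma>\<close> this is the event that the passage time is at least \<open>t\<close>, in a form that depends on the
  path up to time \<open>t\<close> only.
\<close>

definition below :: "real \<Rightarrow> real \<Rightarrow> (real \<Rightarrow> 'a) set" where
  "below l t = {\<omega>\<in>paths. \<forall>r. s \<le> r \<longrightarrow> r \<le> t \<longrightarrow> clock w s r \<omega> \<le> l}"

text \<open>
  By continuity of the clock it suffices to test rational times, clipped to \<open>[s, t]\<close>.
\<close>

lemma below_measurable:
  assumes t: "s \<le> t" shows "below l t \<in> sets (filt_fin (ereal s) t)"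
proof -
  let ?g = "\<lambda>q. max s (min t q)"
  let ?F = "\<lambda>q. {\<omega>\<in>paths. clock w s (?g q) \<omega> \<le> l}"
  have "?F q \<in> sets (filt_fin (ereal s) t)" for q
  proof -
    have "clock w s (?g q) \<in> borel_measurable (filt_fin (ereal s) t)" using s t by (intro clock_measurable) auto
    from measurable_sets[OF this, of "{..l}"] show ?thesis by (simp add: vimage_def Int_def conj_commute)
  qed
  hence "(\<Inter>q\<in>\<rat>. ?F q) \<in> sets (filt_fin (ereal s) t)"
    by (intro sets.countable_INT' countable_rat) auto
  also have "(\<Inter>q\<in>\<rat>. ?F q) = below l t"
  proof (intro equalityI subsetI)
    fix \<omega> assume "\<omega> \<in> below l t"
    thus "\<omega> \<in> (\<Inter>q\<in>\<rat>. ?F q)" using t by (auto simp: below_def)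
  next
    fix \<omega> assume o: "\<omega> \<in> (\<Inter>q\<in>\<rat>. ?F q)"
    hence \<omega>: "\<omega> \<in> paths" by (auto dest!: INT_D[OF _ Rats_0])
    have "continuous_on UNIV (\<lambda>q. clock w s (?g q) \<omega>)"
      by (rule continuous_on_compose2[OF clock_continuous[where w = w, OF \<omega> s w_le]]) (auto intro!: continuous_intros)
    hence "closed {q. clock w s (?g q) \<omega> \<le> l}" by (intro closed_Collect_le continuous_on_const)
    hence "closure \<rat> \<subseteq> {q. clock w s (?g q) \<omega> \<le> l}" using o by (intro closure_minimal) auto
    hence "clock w s (?g q) \<omega> \<le> l" for q by (auto simp: Rats_closure_real)
    from this[of r for r] show "\<omega> \<in> below l t" using \<omega> unfolding below_def
      by (auto simp: max_def min_def split: if_splits) (metis order_antisym_conv)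
  qed
  finally show ?thesis .
qed

definition grid :: "real \<Rightarrow> nat \<Rightarrow> nat \<Rightarrow> real" where
  "grid T N k = s + real k * ((T - s) / real N)"

text \<open>
  The martingale stopped at the first grid time after the passage, or at \<open>T\<close>, written as a sum of increments.
  In this form its expectation follows from the one-step identity by linearity.
\<close>

definition stopped_sum :: "real \<Rightarrow> real \<Rightarrow> real \<Rightarrow> nat \<Rightarrow> (real \<Rightarrow> 'a) \<Rightarrow> real" where
  "stopped_sum \<kappa> l T N \<omega> = Y \<kappa> s \<omega> +
     (\<Sum>k<N. indicator (below l (grid T N k)) \<omega> * (Y \<kappa> (grid T N (Suc k)) \<omega> - Y \<kappa> (grid T N k) \<omega>))"

lemma grid_Suc: "grid T N (Suc k) = grid T N k + (T - s) / real N"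
  unfolding grid_def of_nat_Suc distrib_right by simp

lemma grid_mono: "s \<le> T \<Longrightarrow> s \<le> grid T N k \<and> grid T N k \<le> grid T N (Suc k)"
  unfolding grid_Suc by (simp add: grid_def)

lemma stopped_sum_measurable: "s \<le> T \<Longrightarrow> stopped_sum \<kappa> l T N \<in> borel_measurable M"
  unfolding stopped_sum_def
  by (intro borel_measurable_add borel_measurable_sum borel_measurable_times borel_measurable_diff Y_measurable_M
      meas_M[OF _ borel_measurable_indicator[OF below_measurable]] order_refl)
     (use grid_mono in \<open>auto intro: order_trans\<close>)

lemma expectation_start: "(\<integral>\<omega>. Y \<kappa> s \<omega> \<partial>M) = U \<kappa> s i"
proof -
  have st: "{\<omega>\<in>paths. \<omega> s = i} \<in> sets M"
    using state_event[OF order_refl order_refl, of i] filt_subalgebra[OF order_refl] by (auto simp: subalgebra_def)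
  have "AE \<omega> in M. \<omega> \<in> {\<omega>\<in>paths. \<omega> s = i}" by (rule AE_prob_1[OF P_start[OF s]])
  hence "AE \<omega> in M. Y \<kappa> s \<omega> = U \<kappa> s i" by eventually_elim (simp add: Y_def)
  hence "(\<integral>\<omega>. Y \<kappa> s \<omega> \<partial>M) = (\<integral>\<omega>. U \<kappa> s i \<partial>M)"
    by (intro integral_cong_AE Y_measurable_M) auto
  thus ?thesis by (simp add: prob_space[unfolded space_M])
qed

text \<open>
  A clock value of at most \<open>l\<close> at a grid time leaves it below \<open>\<kappa>\<close> for one more grid step, because the overshoot is
  at most \<open>c\<close> times the step. This is why the function is used at a level \<open>\<kappa> > l\<close>.
\<close>

lemma expectation_stopped_sum:
  assumes T: "s \<le> T" and step: "l + c * ((T - s) / real N) < \<kappa>"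
  shows "(\<integral>\<omega>. stopped_sum \<kappa> l T N \<omega> \<partial>M) = U \<kappa> s i"
proof -
  let ?t = "grid T N"
  let ?I = "\<lambda>k. indicator (below l (?t k)) :: _ \<Rightarrow> real"
  have g: "s \<le> ?t k" "?t k \<le> ?t (Suc k)" "?t (Suc k) - ?t k = (T - s) / real N" for k
    using grid_mono[OF T] by (auto simp: grid_Suc)
  have iY: "integrable M (Y \<kappa> u)" if "s \<le> u" for u
    by (rule integrable_bd[OF Y_measurable_M[OF that] Y_le])
  have iIY: "integrable M (\<lambda>\<omega>. ?I k \<omega> * Y \<kappa> u \<omega>)" if "s \<le> u" for k u
    by (rule integrable_bd[of _ B], rule borel_measurable_times[OF meas_M[OF g(1) borel_measurable_indicator[OF below_measurable[OF g(1)]]] Y_measurable_M[OF that]])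
       (use Y_le B_nonneg in \<open>auto simp: indicator_def\<close>)
  have z: "(\<integral>\<omega>. ?I k \<omega> * (Y \<kappa> (?t (Suc k)) \<omega> - Y \<kappa> (?t k) \<omega>) \<partial>M) = 0" for k
  proof -
    have "(\<integral>\<omega>. ?I k \<omega> * Y \<kappa> (?t (Suc k)) \<omega> \<partial>M) = (\<integral>\<omega>. ?I k \<omega> * Y \<kappa> (?t k) \<omega> \<partial>M)"
    proof (rule Y_martingale_step[OF below_measurable[OF g(1)] g(1,2)])
      fix \<omega> assume "\<omega> \<in> below l (?t k)"
      hence "clock w s (?t k) \<omega> \<le> l" using g(1)[of k] by (simp add: below_def)
      thus "clock w s (?t k) \<omega> + c * (?t (Suc k) - ?t k) < \<kappa>" unfolding g(3) using step by linarith
    qed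
    thus ?thesis using iIY[OF g(1)] by (simp add: right_diff_distrib)
  qed
  have "(\<integral>\<omega>. stopped_sum \<kappa> l T N \<omega> \<partial>M) = (\<integral>\<omega>. Y \<kappa> s \<omega> \<partial>M) +
     (\<integral>\<omega>. (\<Sum>k<N. ?I k \<omega> * (Y \<kappa> (?t (Suc k)) \<omega> - Y \<kappa> (?t k) \<omega>)) \<partial>M)"
    unfolding stopped_sum_def
    by (rule Bochner_Integration.integral_add[OF iY[OF order_refl]])
       (auto simp: right_diff_distrib intro!: Bochner_Integration.integrable_sum Bochner_Integration.integrable_diff iIY g(1))
  also have "(\<integral>\<omega>. (\<Sum>k<N. ?I k \<omega> * (Y \<kappa> (?t (Suc k)) \<omega> - Y \<kappa> (?t k) \<omega>)) \<partial>M)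
     = (\<Sum>k<N. \<integral>\<omega>. ?I k \<omega> * (Y \<kappa> (?t (Suc k)) \<omega> - Y \<kappa> (?t k) \<omega>) \<partial>M)"
    by (rule Bochner_Integration.integral_sum)
       (auto simp: right_diff_distrib intro!: Bochner_Integration.integrable_diff iIY g(1))
  finally show ?thesis by (simp add: z expectation_start)
qed

lemma stopped_sum_telescope:
  assumes K: "K \<le> N" and b: "\<And>k. k < N \<Longrightarrow> \<omega> \<in> below l (grid T N k) \<longleftrightarrow> k < K"
  shows "stopped_sum \<kappa> l T N \<omega> = Y \<kappa> (grid T N K) \<omega>"
proof -
  let ?y = "\<lambda>k. Y \<kappa> (grid T N k) \<omega>"
  have "(\<Sum>k<N. indicator (below l (grid T N k)) \<omega> * (?y (Suc k) - ?y k)) = (\<Sum>k<N. if k < K then ?y (Suc k) - ?y k else 0)"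
    by (rule sum.cong) (use b in \<open>auto simp: indicator_def\<close>)
  also have "\<dots> = (\<Sum>k\<in>{..<N} \<inter> {k. k < K}. ?y (Suc k) - ?y k)" by (simp add: sum.inter_restrict)
  also have "{..<N} \<inter> {k. k < K} = {..<K}" using K by auto
  also have "(\<Sum>k<K. ?y (Suc k) - ?y k) = ?y K - ?y 0" by (rule sum_lessThan_telescope)
  finally show ?thesis by (simp add: stopped_sum_def grid_def)
qed

lemma stopped_sum_at_grid_time:
  fixes \<tau> :: ereal
  assumes T: "s < T" and N: "N > 0" and st: "ereal s \<le> \<tau>"
    and b: "\<And>t. s \<le> t \<Longrightarrow> \<omega> \<in> below l t \<longleftrightarrow> ereal t \<le> \<tau>"
  shows "\<tau> \<ge> ereal T \<Longrightarrow> stopped_sum \<kappa> l T N \<omega> = Y \<kappa> T \<omega>"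
    and "\<tau> = ereal r \<Longrightarrow> r < T \<Longrightarrow> \<exists>x. r < x \<and> x \<le> r + (T - s) / real N \<and> stopped_sum \<kappa> l T N \<omega> = Y \<kappa> x \<omega>"
proof -
  define h where "h = (T - s) / real N"
  have h: "h > 0" "real N * h = T - s" using T N by (auto simp: h_def)
  have gk: "grid T N k = s + real k * h" for k by (simp add: grid_def h_def)
  have gs: "s \<le> grid T N k" for k using h by (simp add: gk)
  {
    assume t: "\<tau> \<ge> ereal T"
    have "stopped_sum \<kappa> l T N \<omega> = Y \<kappa> (grid T N N) \<omega>"
    proof (rule stopped_sum_telescope[OF order_refl])
      fix k assume k: "k < N"
      hence "real k * h \<le> real N * h" using h by (intro mult_right_mono) auto
      hence "grid T N k \<le> T" using h by (simp add: gk)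
      hence "ereal (grid T N k) \<le> \<tau>" using t by (meson ereal_less_eq(3) order_trans)
      thus "\<omega> \<in> below l (grid T N k) \<longleftrightarrow> k < N" using b[OF gs] k by simp
    qed
    thus "stopped_sum \<kappa> l T N \<omega> = Y \<kappa> T \<omega>" using h by (simp add: gk)
  next
    assume t: "\<tau> = ereal r" and r: "r < T"
    have rs: "s \<le> r" using st t by simp
    \<comment> \<open>The index of the first grid time strictly after the passage time.\<close>
    define K where "K = nat \<lfloor>(r - s) / h\<rfloor> + 1"
    have q0: "(r - s) / h \<ge> 0" using rs h by simp
    have K1: "real K = of_int \<lfloor>(r - s) / h\<rfloor> + 1" using q0 by (simp add: K_def)
    have "of_int \<lfloor>(r - s) / h\<rfloor> \<le> (r - s) / h" "(r - s) / h < of_int \<lfloor>(r - s) / h\<rfloor> + 1" by linarith+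
    hence Kb: "real K - 1 \<le> (r - s) / h" "(r - s) / h < real K" using K1 by auto
    hence Kh: "(real K - 1) * h \<le> r - s" "r - s < real K * h" using h by (auto simp: pos_le_divide_eq pos_divide_less_eq)
    have "(r - s) / h < real N" using r h by (simp add: pos_divide_less_eq)
    hence "real K < real N + 1" using Kb by linarith
    hence KN: "K \<le> N" by simp
    have "stopped_sum \<kappa> l T N \<omega> = Y \<kappa> (grid T N K) \<omega>"
    proof (rule stopped_sum_telescope[OF KN])
      fix k
      have "\<omega> \<in> below l (grid T N k) \<longleftrightarrow> real k * h \<le> r - s" using b[OF gs[of k]] t by (auto simp: gk)
      also have "\<dots> \<longleftrightarrow> k < K"
      proof
        assume "real k * h \<le> r - s"
        hence "real k * h < real K * h" using Kh by linarith
        thus "k < K" using h by simp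
      next
        assume "k < K"
        hence "real k \<le> real K - 1" by simp
        hence "real k * h \<le> (real K - 1) * h" using h by (intro mult_right_mono) auto
        thus "real k * h \<le> r - s" using Kh by linarith
      qed
      finally show "\<omega> \<in> below l (grid T N k) \<longleftrightarrow> k < K" .
    qed
    moreover have "r < grid T N K" "grid T N K \<le> r + h" using Kh by (auto simp: gk algebra_simps)
    ultimately show "\<exists>x. r < x \<and> x \<le> r + (T - s) / real N \<and> stopped_sum \<kappa> l T N \<omega> = Y \<kappa> x \<omega>"
      unfolding h_def by blast
  }
qed

lemma Y_right_continuous:
  assumes \<omega>: "\<omega> \<in> paths" and r: "s \<le> r"
  shows "((\<lambda>x. Y \<kappa> x \<omega>) \<longlongrightarrow> Y \<kappa> r \<omega>) (at_right r)"
proof (rule LIM_zero_cancel, rule Lim_null_comparison)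
  show "eventually (\<lambda>x. norm (Y \<kappa> x \<omega> - Y \<kappa> r \<omega>) \<le> L * (c + 1) * \<bar>x - r\<bar>) (at_right r)"
    using paths_right[OF \<omega> order_trans[OF s r]] eventually_at_right_less[of r]
  proof eventually_elim
    case (elim x)
    have "\<bar>Y \<kappa> x \<omega> - Y \<kappa> r \<omega>\<bar> \<le> L * (\<bar>(\<kappa> - clock w s x \<omega>) - (\<kappa> - clock w s r \<omega>)\<bar> + \<bar>x - r\<bar>)"
      unfolding Y_def elim(1) by (rule U_lip) (use s r elim in auto)
    also have "\<dots> \<le> L * (c * \<bar>x - r\<bar> + \<bar>x - r\<bar>)"
      using clock_lipschitz[OF \<omega> s r, of x w c] w_le elim
      by (intro mult_left_mono L_nonneg add_mono) (auto simp: abs_minus_commute)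
    finally show ?case by (simp add: algebra_simps)
  qed
  have "((\<lambda>x. L * (c + 1) * \<bar>x - r\<bar>) \<longlongrightarrow> L * (c + 1) * \<bar>r - r\<bar>) (at_right r)" by (intro tendsto_intros)
  thus "((\<lambda>x. L * (c + 1) * \<bar>x - r\<bar>) \<longlongrightarrow> 0) (at_right r)" by simp
qed

lemma stopped_sum_le:
  fixes \<tau> :: ereal
  assumes T: "s < T" and N: "N > 0" and st: "ereal s \<le> \<tau>"
    and b: "\<And>t. s \<le> t \<Longrightarrow> \<omega> \<in> below l t \<longleftrightarrow> ereal t \<le> \<tau>"
  shows "\<bar>stopped_sum \<kappa> l T N \<omega>\<bar> \<le> B"
proof (cases "\<tau> \<ge> ereal T")
  case True
  thus ?thesis using stopped_sum_at_grid_time(1)[OF assms, of \<kappa>] Y_le by simp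
next
  case False
  then obtain r where "\<tau> = ereal r" "r < T" using st by (cases \<tau>) auto
  from stopped_sum_at_grid_time(2)[OF assms this] Y_le show ?thesis by metis
qed

text \<open>
  The stopping times on the grid converge to the passage time from strictly above, so right continuity of
  the path identifies the limit.
\<close>

lemma stopped_sum_limit:
  fixes \<tau> :: ereal
  assumes \<omega>: "\<omega> \<in> paths" and T: "s < T" and st: "ereal s \<le> \<tau>"
    and b: "\<And>t. s \<le> t \<Longrightarrow> \<omega> \<in> below l t \<longleftrightarrow> ereal t \<le> \<tau>"
  shows "(\<lambda>N. stopped_sum \<kappa> l T (Suc N) \<omega>) \<longlonglongrightarrow> (if \<tau> < ereal T then Y \<kappa> (real_of_ereal \<tau>) \<omega> else Y \<kappa> T \<omega>)"
proof (cases "\<tau> < ereal T")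
  case False
  thus ?thesis using stopped_sum_at_grid_time(1)[OF T _ st b] by simp
next
  case True
  then obtain r where r: "\<tau> = ereal r" "r < T" using st by (cases \<tau>) auto
  have sr: "s \<le> r" using st r by simp
  have "\<exists>x. r < x \<and> x \<le> r + (T - s) / real (Suc N) \<and> stopped_sum \<kappa> l T (Suc N) \<omega> = Y \<kappa> x \<omega>" for N
    by (rule stopped_sum_at_grid_time(2)[OF T _ st b r]) simp_all
  hence "\<forall>N. \<exists>x. r < x \<and> x \<le> r + (T - s) / real (Suc N) \<and> stopped_sum \<kappa> l T (Suc N) \<omega> = Y \<kappa> x \<omega>"
    by (intro allI)
  from choice[OF this] obtain x where "\<forall>N. r < x N \<and> x N \<le> r + (T - s) / real (Suc N) \<and>
      stopped_sum \<kappa> l T (Suc N) \<omega> = Y \<kappa> (x N) \<omega>" by (elim exE)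
  hence x: "r < x N" "x N \<le> r + (T - s) / real (Suc N)" "stopped_sum \<kappa> l T (Suc N) \<omega> = Y \<kappa> (x N) \<omega>" for N
    by simp_all
  have "(\<lambda>N. r + (T - s) * inverse (real (Suc N))) \<longlonglongrightarrow> r + (T - s) * 0"
    by (intro tendsto_intros LIMSEQ_inverse_real_of_nat)
  hence rlim: "(\<lambda>N. r + (T - s) / real (Suc N)) \<longlonglongrightarrow> r" by (simp only: divide_inverse mult_zero_right add_0_right)
  have "x \<longlonglongrightarrow> r"
    by (rule tendsto_sandwich[OF _ _ tendsto_const rlim])
       (rule always_eventually, intro allI less_imp_le x(1), rule always_eventually, intro allI x(2))
  hence "filterlim x (at_right r) sequentially" unfolding filterlim_at
    by (intro conjI always_eventually allI) (simp_all add: x(1) less_imp_neq[OF x(1), symmetric])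
  from filterlim_compose[OF Y_right_continuous[OF \<omega> sr] this]
  show ?thesis using True r by (simp add: x(3))
qed

text \<open>
  At the passage time the clock equals \<open>l\<close>, which leaves \<open>\<kappa> - l\<close> in the first argument. Since \<open>U\<close> vanishes after
  \<open>\<eta>\<close>, paths that have not passed by a time \<open>T \<ge> \<eta>\<close> contribute nothing.
\<close>

lemma passage_identity:
  fixes v :: "'a option \<Rightarrow> real"
  assumes w: "w = speed v \<sigma>" and l: "l \<ge> 0" and \<kappa>: "l < \<kappa>"
    and vanish: "\<And>k t j. t \<ge> \<eta> \<Longrightarrow> U k t j = 0"
  defines "hit \<equiv> \<lambda>\<omega>. (if tau v \<sigma> l (ereal s) \<omega> = \<infinity> then 0
     else U (\<kappa> - l) (real_of_ereal (tau v \<sigma> l (ereal s) \<omega>)) (\<omega> (real_of_ereal (tau v \<sigma> l (ereal s) \<omega>))))"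
  shows "hit \<in> borel_measurable M" "(\<integral>\<omega>. hit \<omega> \<partial>M) = U \<kappa> s i"
proof -
  define T where "T = max s \<eta> + 1"
  have T: "s < T" "\<eta> \<le> T" by (auto simp: T_def)
  let ?\<tau> = "\<lambda>\<omega>. tau v \<sigma> l (ereal s) \<omega>"
  have b: "\<omega> \<in> below l t \<longleftrightarrow> ereal t \<le> ?\<tau> \<omega>" if "\<omega> \<in> paths" "s \<le> t" for \<omega> t
    using le_tau_iff[OF that(1) s l, of t v \<sigma>, folded w] that by (simp add: below_def)
  have lim: "(\<lambda>N. stopped_sum \<kappa> l T (Suc N) \<omega>) \<longlonglongrightarrow> hit \<omega>" if \<omega>: "\<omega> \<in> paths" for \<omega>
  proof -
    have "(if ?\<tau> \<omega> < ereal T then Y \<kappa> (real_of_ereal (?\<tau> \<omega>)) \<omega> else Y \<kappa> T \<omega>) = hit \<omega>"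
    proof (cases "?\<tau> \<omega>")
      case (real r)
      note r = at_tau[OF \<omega> s l real]
      have "Y \<kappa> r \<omega> = hit \<omega>" using r(2)[folded w] real by (simp add: hit_def Y_def)
      moreover have "Y \<kappa> T \<omega> = 0" "\<not> r < T \<Longrightarrow> Y \<kappa> r \<omega> = 0" using T by (auto simp: Y_def vanish)
      ultimately show ?thesis using real by auto
    next
      case PInf
      thus ?thesis using T by (simp add: hit_def Y_def vanish)
    next
      case MInf
      thus ?thesis using tau_ge_start[of s v \<sigma> l \<omega>] by simp
    qed
    thus ?thesis using stopped_sum_limit[OF \<omega> T(1) tau_ge_start b[OF \<omega>], of \<kappa>] by simp
  qed
  have meas: "stopped_sum \<kappa> l T N \<in> borel_measurable M" for N
    using T by (intro stopped_sum_measurable) simp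
  show hm: "hit \<in> borel_measurable M"
    by (rule borel_measurable_LIMSEQ_real[OF _ meas[of "Suc N" for N]]) (use lim in auto)
  have "(\<lambda>N. \<integral>\<omega>. stopped_sum \<kappa> l T (Suc N) \<omega> \<partial>M) \<longlonglongrightarrow> (\<integral>\<omega>. hit \<omega> \<partial>M)"
  proof (rule integral_dominated_convergence[where w = "\<lambda>_. B", OF hm meas])
    show "AE \<omega> in M. norm (stopped_sum \<kappa> l T (Suc N) \<omega>) \<le> B" for N
      unfolding real_norm_def by (rule AE_I2, rule stopped_sum_le[OF T(1) _ tau_ge_start b]) auto
  qed (use lim in auto)
  moreover have "eventually (\<lambda>N. (\<integral>\<omega>. stopped_sum \<kappa> l T (Suc N) \<omega> \<partial>M) = U \<kappa> s i) sequentially"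
  proof -
    have "(\<lambda>N. l + c * ((T - s) * inverse (real (Suc N)))) \<longlonglongrightarrow> l + c * ((T - s) * 0)"
      by (intro tendsto_intros LIMSEQ_inverse_real_of_nat)
    hence "eventually (\<lambda>N. l + c * ((T - s) * inverse (real (Suc N))) < \<kappa>) sequentially"
      using \<kappa> by (intro order_tendstoD) auto
    thus ?thesis
    proof eventually_elim
      case (elim N)
      thus ?case using T by (intro expectation_stopped_sum) (auto simp: divide_inverse)
    qed
  qed
  hence "(\<lambda>N. \<integral>\<omega>. stopped_sum \<kappa> l T (Suc N) \<omega> \<partial>M) \<longlonglongrightarrow> U \<kappa> s i" by (rule tendsto_eventually)
  ultimately show "(\<integral>\<omega>. hit \<omega> \<partial>M) = U \<kappa> s i" by (rule LIMSEQ_unique)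
qed

end

section \<open>Identification of the operators\<close>

locale wiener_hopf_markov = wiener_hopf +
  fixes P :: "'a pt \<Rightarrow> (real \<Rightarrow> 'a) measure"
  assumes family: "canonical_markov_family \<Lambda> P"
begin

definition passage_value :: "pm \<Rightarrow> real \<Rightarrow> 'a xfun \<Rightarrow> real \<Rightarrow> (real \<Rightarrow> 'a) \<Rightarrow> real" where
  "passage_value \<sigma> l g s \<omega> = g (tau v \<sigma> l (ereal s) \<omega>, Xst (tau v \<sigma> l (ereal s) \<omega>) \<omega>)"

lemma C0_inf: "g \<in> C0 v \<sigma> \<Longrightarrow> g (\<infinity>, None) = 0"
  by (erule C0_zero_off) (simp add: X_pm_def)

lemma C0_off_sign: "g \<in> C0 v \<sigma> \<Longrightarrow> i \<notin> E_pm v \<sigma> \<Longrightarrow> g (ereal t, Some i) = 0"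
  by (erule C0_zero_off) (simp add: X_pm_def)

text \<open>
  At the passage time the state has positive speed, and there the extension \<open>F\<close> is the function itself.
\<close>

lemma F_on_sign:
  assumes g: "g \<in> C0 v \<sigma>" and i: "i \<in> E_pm v \<sigma>"
  shows "F \<sigma> g (ereal t, Some i) = g (ereal t, Some i)"
proof -
  have "i \<notin> E_pm v (opp \<sigma>)" using i by (simp add: E_pm_iff speed_opp)
  from C0_off_sign[OF S_C0[OF g] this] show ?thesis by (simp add: F_def)
qed

text \<open>
  The passage identity at levels \<open>\<kappa>\<close> decreasing to \<open>l\<close>.
\<close>

lemma passage_smooth:
  assumes g: "g \<in> C01 v \<sigma>" and \<eta>: "\<eta> > 0" and z: "\<And>t i. t \<ge> \<eta> \<Longrightarrow> g (ereal t, Some i) = 0"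
    and l: "l \<ge> 0" and s: "s \<ge> 0"
  shows "passage_value \<sigma> l g s \<in> borel_measurable (P (ereal s, Some i))"
    and "(\<integral>\<omega>. passage_value \<sigma> l g s \<omega> \<partial>P (ereal s, Some i)) = F \<sigma> (Q \<sigma> l g) (ereal s, Some i)"
proof -
  have g0: "g \<in> C0 v \<sigma>" by (rule C01_C0[OF g])
  obtain L where L: "L \<ge> 0" "\<And>k k' t t' j. t \<ge> 0 \<Longrightarrow> t' \<ge> 0 \<Longrightarrow> \<bar>U \<sigma> g k t j - U \<sigma> g k' t' j\<bar> \<le> L * (\<bar>k - k'\<bar> + \<bar>t - t'\<bar>)"
    using U_lipschitz[OF g] by (elim exE conjE) (erule that, simp)
  define c where "c = Max (range (\<lambda>j. \<bar>speed v \<sigma> j\<bar>))"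
  have c: "\<bar>speed v \<sigma> j\<bar> \<le> c" for j unfolding c_def by (intro Max_ge) auto
  define B where "B = CF \<sigma> * sup_norm g"
  interpret D: additive_dynkin \<Lambda> P s i "speed v \<sigma>" c "U \<sigma> g" B L
    by unfold_locales (rule family, rule s, rule c, unfold B_def, rule U_bounded[OF g0], rule L(1), rule L(2), assumption, assumption, rule U_characteristic_deriv[OF g])
  define \<kappa> where "\<kappa> n = l + inverse (real (Suc n))" for n
  have \<kappa>: "l < \<kappa> n" for n by (simp add: \<kappa>_def)
  have klim: "\<kappa> \<longlonglongrightarrow> l"
    using tendsto_add[OF tendsto_const[of l] LIMSEQ_inverse_real_of_nat] by (simp add: \<kappa>_def[abs_def])
  have Ulim: "(\<lambda>n. U \<sigma> g (\<kappa> n - m) t j) \<longlonglongrightarrow> U \<sigma> g (l - m) t j" if "t \<ge> 0" for m t j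
  proof (rule LIM_zero_cancel, rule Lim_null_comparison)
    show "eventually (\<lambda>n. norm (U \<sigma> g (\<kappa> n - m) t j - U \<sigma> g (l - m) t j) \<le> L * \<bar>\<kappa> n - l\<bar>) sequentially"
    proof (rule always_eventually, rule allI)
      fix n show "norm (U \<sigma> g (\<kappa> n - m) t j - U \<sigma> g (l - m) t j) \<le> L * \<bar>\<kappa> n - l\<bar>"
        using L(2)[OF that that, of "\<kappa> n - m" j "l - m"] by simp
    qed
    have "(\<lambda>n. L * \<bar>\<kappa> n - l\<bar>) \<longlonglongrightarrow> L * \<bar>l - l\<bar>" by (intro tendsto_intros klim)
    thus "(\<lambda>n. L * \<bar>\<kappa> n - l\<bar>) \<longlonglongrightarrow> 0" by simp
  qed
  define hit where "hit n \<omega> = (if tau v \<sigma> l (ereal s) \<omega> = \<infinity> then 0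
     else U \<sigma> g (\<kappa> n - l) (real_of_ereal (tau v \<sigma> l (ereal s) \<omega>)) (\<omega> (real_of_ereal (tau v \<sigma> l (ereal s) \<omega>))))" for n \<omega>
  have hm: "hit n \<in> borel_measurable D.M" and hi: "(\<integral>\<omega>. hit n \<omega> \<partial>D.M) = U \<sigma> g (\<kappa> n) s i" for n
    unfolding hit_def[abs_def]
    using D.passage_identity[OF refl l \<kappa> U_local[OF \<eta> g z]] by blast+
  have lim: "(\<lambda>n. hit n \<omega>) \<longlonglongrightarrow> passage_value \<sigma> l g s \<omega>" if \<omega>: "\<omega> \<in> paths" for \<omega>
  proof (cases "tau v \<sigma> l (ereal s) \<omega>")
    case (real r)
    note r = at_tau[OF \<omega> s l real]
    have "U \<sigma> g (l - l) r (\<omega> r) = g (ereal r, Some (\<omega> r))"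
      using F_on_sign[OF g0, of "\<omega> r" r] r(3) Q_0[OF order_refl g0] by (simp add: U_def E_pm_iff)
    thus ?thesis using Ulim[of r l "\<omega> r"] r(1) s real by (simp add: hit_def passage_value_def Xst_def)
  next
    case PInf
    thus ?thesis using C0_inf[OF g0] by (simp add: hit_def passage_value_def Xst_def)
  next
    case MInf
    thus ?thesis using tau_ge_start[of s v \<sigma> l \<omega>] by simp
  qed
  show pm: "passage_value \<sigma> l g s \<in> borel_measurable D.M"
    by (rule borel_measurable_LIMSEQ_real[OF _ hm]) (use lim in auto)
  have "(\<lambda>n. \<integral>\<omega>. hit n \<omega> \<partial>D.M) \<longlonglongrightarrow> (\<integral>\<omega>. passage_value \<sigma> l g s \<omega> \<partial>D.M)"
  proof (rule integral_dominated_convergence[where w = "\<lambda>_. B", OF pm hm])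
    show "AE \<omega> in D.M. norm (hit n \<omega>) \<le> B" for n
      by (rule AE_I2) (use U_bounded[OF g0] D.B_nonneg in \<open>simp add: hit_def B_def\<close>)
  qed (use lim in auto)
  moreover have "(\<lambda>n. \<integral>\<omega>. hit n \<omega> \<partial>D.M) \<longlonglongrightarrow> U \<sigma> g l s i"
    using Ulim[OF s, of 0 i] by (simp add: hi)
  ultimately have "(\<integral>\<omega>. passage_value \<sigma> l g s \<omega> \<partial>D.M) = U \<sigma> g l s i" by (rule LIMSEQ_unique)
  thus "(\<integral>\<omega>. passage_value \<sigma> l g s \<omega> \<partial>D.M) = F \<sigma> (Q \<sigma> l g) (ereal s, Some i)"
    using l by (simp add: U_def max_absorb2)
qed

text \<open>
  Both sides are bounded operators in \<open>g\<close>, so smooth functions of bounded support suffice.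
\<close>

lemma passage_expectation:
  assumes g: "g \<in> C0 v \<sigma>" and l: "l \<ge> 0" and s: "s \<ge> 0"
  shows "passage_exp P v \<sigma> l g (ereal s, Some i) = F \<sigma> (Q \<sigma> l g) (ereal s, Some i)"
proof -
  interpret markov_start \<Lambda> P s i by unfold_locales (rule family, rule s)
  have "\<forall>n. \<exists>f. f \<in> C01 v \<sigma> \<and> (\<exists>\<eta>>0. \<forall>t\<ge>\<eta>. \<forall>i. f (ereal t, Some i) = 0) \<and> (\<forall>p. \<bar>g p - f p\<bar> \<le> inverse (real (Suc n)))"
  proof
    fix n
    have "inverse (real (Suc n)) > 0" by simp
    from C01_bounded_support_dense[OF g this]
    show "\<exists>f. f \<in> C01 v \<sigma> \<and> (\<exists>\<eta>>0. \<forall>t\<ge>\<eta>. \<forall>i. f (ereal t, Some i) = 0) \<and> (\<forall>p. \<bar>g p - f p\<bar> \<le> inverse (real (Suc n)))"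
      by blast
  qed
  from choice[OF this] obtain f where f: "\<forall>n. f n \<in> C01 v \<sigma> \<and> (\<exists>\<eta>>0. \<forall>t\<ge>\<eta>. \<forall>i. f n (ereal t, Some i) = 0) \<and>
     (\<forall>p. \<bar>g p - f n p\<bar> \<le> inverse (real (Suc n)))" by (elim exE)
  have f1: "f n \<in> C01 v \<sigma>" and f2: "\<exists>\<eta>>0. \<forall>t\<ge>\<eta>. \<forall>i. f n (ereal t, Some i) = 0"
    and f3: "\<bar>g p - f n p\<bar> \<le> inverse (real (Suc n))" for n p
    using spec[OF f, of n] by (simp_all del: split_paired_All)
  have f0: "f n \<in> C0 v \<sigma>" for n by (rule C01_C0[OF f1])
  have PV: "passage_value \<sigma> l (f n) s \<in> borel_measurable M \<and>
      (\<integral>\<omega>. passage_value \<sigma> l (f n) s \<omega> \<partial>M) = F \<sigma> (Q \<sigma> l (f n)) (ereal s, Some i)" for n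
  proof -
    obtain \<eta> where \<eta>: "\<eta> > 0" "\<forall>t\<ge>\<eta>. \<forall>i. f n (ereal t, Some i) = 0" using f2[of n] by (elim exE conjE)
    show ?thesis using passage_smooth[OF f1 \<eta>(1) _ l s] \<eta>(2) by blast
  qed
  have small: "x \<longlonglongrightarrow> y" if "\<And>n. \<bar>x n - y\<bar> \<le> C * inverse (real (Suc n))" for x y C
  proof (rule LIM_zero_cancel, rule Lim_null_comparison)
    show "eventually (\<lambda>n. norm (x n - y) \<le> C * inverse (real (Suc n))) sequentially"
      unfolding real_norm_def by (intro always_eventually allI that)
    show "(\<lambda>n. C * inverse (real (Suc n))) \<longlonglongrightarrow> 0"
      using tendsto_mult[OF tendsto_const[of C] LIMSEQ_inverse_real_of_nat] by simp
  qed
  have lim: "(\<lambda>n. passage_value \<sigma> l (f n) s \<omega>) \<longlonglongrightarrow> passage_value \<sigma> l g s \<omega>" for \<omega>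
    unfolding passage_value_def by (rule small[of _ _ 1], unfold mult_1_left, subst abs_minus_commute, rule f3)
  have pm: "passage_value \<sigma> l g s \<in> borel_measurable M"
    by (rule borel_measurable_LIMSEQ_real[OF lim]) (use PV in blast)
  have "(\<lambda>n. \<integral>\<omega>. passage_value \<sigma> l (f n) s \<omega> \<partial>M) \<longlonglongrightarrow> (\<integral>\<omega>. passage_value \<sigma> l g s \<omega> \<partial>M)"
  proof (rule integral_dominated_convergence[where w = "\<lambda>_. sup_norm g + 1", OF pm])
    show "AE \<omega> in M. norm (passage_value \<sigma> l (f n) s \<omega>) \<le> sup_norm g + 1" for n
    proof (rule AE_I2)
      fix \<omega>
      have "\<bar>f n p\<bar> \<le> sup_norm g + 1" for p
      proof -
        have "inverse (real (Suc n)) \<le> 1" by (simp add: inverse_le_1_iff)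
        thus ?thesis using f3[of p n] abs_le_sup_norm[OF g, of p] by linarith
      qed
      thus "norm (passage_value \<sigma> l (f n) s \<omega>) \<le> sup_norm g + 1" by (simp add: passage_value_def)
    qed
  qed (use PV lim in auto)
  moreover have "(\<lambda>n. \<integral>\<omega>. passage_value \<sigma> l (f n) s \<omega> \<partial>M) \<longlonglongrightarrow> F \<sigma> (Q \<sigma> l g) (ereal s, Some i)"
  proof (rule small)
    fix n
    have "F \<sigma> (Q \<sigma> l (f n)) (ereal s, Some i) - F \<sigma> (Q \<sigma> l g) (ereal s, Some i)
       = F \<sigma> (\<lambda>p. 1 * Q \<sigma> l (f n) p + (-1) * Q \<sigma> l g p) (ereal s, Some i)"
      unfolding F_lin[OF Q_C0[OF l f0] Q_C0[OF l g]] by simp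
    also have "(\<lambda>p. 1 * Q \<sigma> l (f n) p + (-1) * Q \<sigma> l g p) = Q \<sigma> l (\<lambda>p. 1 * f n p + (-1) * g p)"
      by (rule Q_lin[OF l f0 g, symmetric])
    also have "\<bar>F \<sigma> \<dots> (ereal s, Some i)\<bar> \<le> CF \<sigma> * inverse (real (Suc n))"
    proof (intro F_le Q_C0 Q_le C0_lin l f0 g)
      show "\<bar>1 * f n p + (-1) * g p\<bar> \<le> inverse (real (Suc n))" for p using f3[of p n] by linarith
    qed
    finally show "\<bar>(\<integral>\<omega>. passage_value \<sigma> l (f n) s \<omega> \<partial>M) - F \<sigma> (Q \<sigma> l g) (ereal s, Some i)\<bar> \<le> CF \<sigma> * inverse (real (Suc n))"
      using PV by simp
  qed
  ultimately have "(\<integral>\<omega>. passage_value \<sigma> l g s \<omega> \<partial>M) = F \<sigma> (Q \<sigma> l g) (ereal s, Some i)" by (rule LIMSEQ_unique)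
  thus ?thesis by (simp add: passage_exp_def passage_value_def)
qed

lemma passage_exp_inf: "g \<in> C0 v \<sigma> \<Longrightarrow> passage_exp P v \<sigma> l g (\<infinity>, None) = 0"
proof -
  assume g: "g \<in> C0 v \<sigma>"
  have "tau v \<sigma> l \<infinity> \<omega> \<ge> \<infinity>" for \<omega>
    by (cases \<sigma>) (simp_all only: tau.simps, (rule Inf_greatest, simp)+)
  hence "tau v \<sigma> l \<infinity> \<omega> = \<infinity>" for \<omega> by simp
  thus ?thesis using C0_inf[OF g] by (simp add: passage_exp_def Xst_def)
qed

text \<open>
  The passage formula for \<open>l = 0\<close> at points of the opposite half-space, where \<open>F \<sigma> g\<close> is \<open>S \<sigma> g\<close>.
\<close>

lemma S_eq_J: assumes g: "g \<in> C0 v \<sigma>" shows "S \<sigma> g = J_op P v \<sigma> g"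
proof
  fix p
  consider "p \<in> X_pm v (opp \<sigma>)" | "p = (\<infinity>, None)" | "p \<notin> Xbar_pm v (opp \<sigma>)" by (auto simp: Xbar_pm_def)
  thus "S \<sigma> g p = J_op P v \<sigma> g p"
  proof cases
    case 1
    then obtain s i where p: "p = (ereal s, Some i)" "s \<ge> 0" "i \<in> E_pm v (opp \<sigma>)" by (auto simp: X_pm_def)
    have "i \<notin> E_pm v \<sigma>" using p by (simp add: E_pm_iff speed_opp)
    hence "F \<sigma> g p = S \<sigma> g p" using C0_off_sign[OF g] p by (simp add: F_def)
    thus ?thesis using passage_expectation[OF g order_refl p(2), of i] 1 p(1) Q_0[OF order_refl g]
      by (simp add: J_op_def Xbar_pm_def)
  next
    case 2
    thus ?thesis using passage_exp_inf[OF g] C0_inf[OF S_C0[OF g]] by (simp add: J_op_def)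
  next
    case 3
    hence "p \<notin> X_pm v (opp \<sigma>)" by (simp add: Xbar_pm_def)
    from C0_zero_off[OF S_C0[OF g] this] 3 show ?thesis by (simp add: J_op_def)
  qed
qed

text \<open>
  The passage formula at points of the half-space of \<open>\<sigma>\<close> itself, where \<open>F \<sigma>\<close> acts as the identity.
\<close>

lemma Q_eq_P: assumes g: "g \<in> C0 v \<sigma>" and l: "l \<ge> 0" shows "Q \<sigma> l g = P_op P v \<sigma> l g"
proof
  fix p
  consider "p \<in> X_pm v \<sigma>" | "p = (\<infinity>, None)" | "p \<notin> Xbar_pm v \<sigma>" by (auto simp: Xbar_pm_def)
  thus "Q \<sigma> l g p = P_op P v \<sigma> l g p"
  proof cases
    case 1
    then obtain s i where p: "p = (ereal s, Some i)" "s \<ge> 0" "i \<in> E_pm v \<sigma>" by (auto simp: X_pm_def)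
    thus ?thesis using passage_expectation[OF g l p(2), of i] 1 F_on_sign[OF Q_C0[OF l g] p(3)]
      by (simp add: P_op_def Xbar_pm_def)
  next
    case 2
    thus ?thesis using passage_exp_inf[OF g] C0_inf[OF Q_C0[OF l g]] by (simp add: P_op_def)
  next
    case 3
    hence "p \<notin> X_pm v \<sigma>" by (simp add: Xbar_pm_def)
    from C0_zero_off[OF Q_C0[OF l g] this] 3 show ?thesis by (simp add: P_op_def)
  qed
qed

lemma quotient_eventually_eq:
  assumes g: "g \<in> C0 v \<sigma>"
  shows "eventually (\<lambda>l. (\<lambda>p. (P_op P v \<sigma> l g p - g p) / l) = (\<lambda>p. (Q \<sigma> l g p - g p) / l)) (at_right 0)"
  using eventually_at_right_less[of 0] by eventually_elim (simp add: Q_eq_P[OF g])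

lemma uniform_limit_P_iff:
  assumes g: "g \<in> C0 v \<sigma>"
  shows "uniform_limit UNIV (\<lambda>l p. (P_op P v \<sigma> l g p - g p) / l) h (at_right 0) \<longleftrightarrow>
    uniform_limit UNIV (\<lambda>l p. (Q \<sigma> l g p - g p) / l) h (at_right 0)"
  by (rule uniform_limit_cong) (use quotient_eventually_eq[OF g] in \<open>auto elim!: eventually_mono dest: fun_cong\<close>)

lemma P_limit:
  assumes g: "g \<in> C01 v \<sigma>"
  shows "((\<lambda>l. (P_op P v \<sigma> l g p - g p) / l) \<longlongrightarrow> H \<sigma> g p) (at_right 0)"
  using H_limit[OF g] unfolding uniform_limit_P_iff[OF C01_C0[OF g], symmetric]
  by (rule tendsto_uniform_limitI) simp

lemma C01_subset_G_dom: "C01 v \<sigma> \<subseteq> G_dom P v \<sigma>"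
  using P_limit C01_C0 unfolding G_dom_def by (intro subsetI CollectI conjI ballI exI)

lemma G_eq_H: assumes g: "g \<in> C01 v \<sigma>" shows "G_op P v \<sigma> g = H \<sigma> g"
proof
  fix p
  show "G_op P v \<sigma> g p = H \<sigma> g p"
  proof (cases "p \<in> Xbar_pm v \<sigma>")
    case True
    have "Lim (at_right 0) (\<lambda>l. (P_op P v \<sigma> l g p - g p) / l) = H \<sigma> g p"
      by (rule tendsto_Lim[OF _ P_limit[OF g]]) simp
    thus ?thesis using True by (simp add: G_op_def)
  next
    case False
    hence "p \<notin> X_pm v \<sigma>" by (simp add: Xbar_pm_def)
    from C0_zero_off[OF H_C0[OF g] this] False show ?thesis by (simp add: G_op_def)
  qed
qed

lemma P_strong_generator: "strong_generator (C0 v \<sigma>) (P_op P v \<sigma>) (G_op P v \<sigma>) (C01 v \<sigma>)"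
proof -
  have "strong_generator (C0 v \<sigma>) (Q \<sigma>) (H \<sigma>) (C01 v \<sigma>)" using cond_b[of \<sigma>] by (simp add: cond_b_def)
  hence D: "C01 v \<sigma> = {g \<in> C0 v \<sigma>. \<exists>h. uniform_limit UNIV (\<lambda>l p. (Q \<sigma> l g p - g p) / l) h (at_right 0)}"
    unfolding strong_generator_def by blast
  show ?thesis unfolding strong_generator_def
  proof (intro conjI ballI)
    show "C01 v \<sigma> = {g \<in> C0 v \<sigma>. \<exists>h. uniform_limit UNIV (\<lambda>l p. (P_op P v \<sigma> l g p - g p) / l) h (at_right 0)}"
      by (subst D, rule Collect_cong, rule conj_cong[OF refl]) (simp only: uniform_limit_P_iff)
    fix g assume g: "g \<in> C01 v \<sigma>"
    show "uniform_limit UNIV (\<lambda>l p. (P_op P v \<sigma> l g p - g p) / l) (G_op P v \<sigma> g) (at_right 0)"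
      unfolding uniform_limit_P_iff[OF C01_C0[OF g]] G_eq_H[OF g] by (rule H_limit[OF g])
  qed
qed

end

theorem theorem3p2:
  fixes \<Lambda> :: "real \<Rightarrow> real^'e::finite^'e"
    and v :: "'e option \<Rightarrow> real"
    and P :: "ereal \<times> 'e option \<Rightarrow> (real \<Rightarrow> 'e) measure"
    and S H :: "pm \<Rightarrow> (ereal \<times> 'e option \<Rightarrow> real) \<Rightarrow> (ereal \<times> 'e option \<Rightarrow> real)"
    and Q :: "pm \<Rightarrow> real \<Rightarrow> (ereal \<times> 'e option \<Rightarrow> real) \<Rightarrow> (ereal \<times> 'e option \<Rightarrow> real)"
  assumes "CARD('e) > 1"
    and "generator_family \<Lambda>"
    and "\<forall>i. v (Some i) \<noteq> 0" and "v None = 0"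
    and "E_pm v Plus \<noteq> {}" and "E_pm v Minus \<noteq> {}"
    and "canonical_markov_family \<Lambda> P"
    and "wiener_hopf_eq \<Lambda> v S H"
    and "\<forall>\<sigma>. cond_a v \<sigma> (S \<sigma>)"
    and "\<forall>\<sigma>. cond_b v \<sigma> (H \<sigma>) (Q \<sigma>)"
  shows "(\<forall>\<sigma>. \<forall>g\<in>C0 v \<sigma>. S \<sigma> g = J_op P v \<sigma> g \<and> (\<forall>l\<ge>0. Q \<sigma> l g = P_op P v \<sigma> l g)) \<and>
         (\<forall>\<sigma>. C01 v \<sigma> \<subseteq> G_dom P v \<sigma> \<and>
              strong_generator (C0 v \<sigma>) (P_op P v \<sigma>) (G_op P v \<sigma>) (C01 v \<sigma>))"
proof -
  interpret wiener_hopf_markov \<Lambda> v S H Q P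
    by unfold_locales (use assms in blast)+
  show ?thesis
    using S_eq_J Q_eq_P C01_subset_G_dom P_strong_generator by (intro conjI allI ballI impI)
qed

end
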